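(* For any constant $\delta\in(0,1/2)$ there exist a constant $\varepsilon>0$ and a one-pass deterministic polynomial-time algorithm in the asymmetric streaming model that, for any two strings $x,y\in\{0,1\}^n$, outputs a $(2-\varepsilon)$-approximation of $\mathsf{LCS}(x,y)$ using $\tilde{O}(n^{\delta}/\delta)$ space.
   Context: $\mathsf{LCS}(x,y)$ is the length of a longest common subsequence of $x$ and $y$. A $(2-\varepsilon)$-approximation means outputting a value $\lambda$ with $\mathsf{LCS}(x,y)\le\lambda\le(2-\varepsilon)\mathsf{LCS}(x,y)$ (equivalently, a $1/(2-\varepsilon)$ approximation in the usual normalization). In the asymmetric streaming model the algorithm has streaming access to $x$ (reading it left to right; one pass) and random access to $y$; space is the working memory of the algorithm. $\tilde{O}$ hides polylogarithmic factors in $n$. *)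

theory Defs
  imports Complex_Main "HOL-Library.Sublist" "HOL-Library.Log_Nat"
begin

definition lcs :: "'a list \<Rightarrow> 'a list \<Rightarrow> nat" where
  "lcs x y = Max {length z | z. subseq z x \<and> subseq z y}"

text \<open>
  The asymmetric streaming model, as structured programs for a random access machine. The
  working memory is a sequence of cells holding natural numbers (\<open>i\<close>, \<open>j\<close>, \<open>k\<close> below are
  cell addresses). The string \<open>x\<close> is accessible only through \<open>Next\<close>, which consumes its next
  symbol, so that there is a single left-to-right pass; \<open>y\<close> is accessible only through
  \<open>Query\<close>, at any position. Strings over the alphabet 0, 1 are lists of type \<^typ>\<open>bool list\<close>
  (\<^const>\<open>True\<close> is 1); both input instructions deliver 2 beyond the end of the string.
\<close>

datatype instr =
    Const nat nat        \<comment> \<open>\<open>M[i] := c\<close>\<close>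
  | Copy nat nat         \<comment> \<open>\<open>M[i] := M[j]\<close>\<close>
  | Add nat nat nat      \<comment> \<open>\<open>M[i] := M[j] + M[k]\<close>\<close>
  | Sub nat nat nat      \<comment> \<open>\<open>M[i] := M[j] - M[k]\<close>, truncated at 0\<close>
  | Mult nat nat nat     \<comment> \<open>\<open>M[i] := M[j] * M[k]\<close>\<close>
  | Div nat nat nat      \<comment> \<open>\<open>M[i] := M[j] div M[k]\<close>\<close>
  | Load nat nat         \<comment> \<open>\<open>M[i] := M[M[j]]\<close>\<close>
  | Store nat nat        \<comment> \<open>\<open>M[M[i]] := M[j]\<close>\<close>
  | Next nat             \<comment> \<open>\<open>M[i] :=\<close> next symbol of \<open>x\<close>\<close>
  | Query nat nat        \<comment> \<open>\<open>M[i] := y[M[j]]\<close>\<close>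

datatype prog =
    Skip
  | Instr instr
  | Seq prog prog
  | IfNZ nat prog prog   \<comment> \<open>first branch iff \<open>M[i] \<noteq> 0\<close>\<close>
  | WhileNZ nat prog     \<comment> \<open>loop as long as \<open>M[i] \<noteq> 0\<close>\<close>

text \<open>A configuration consists of the unread suffix of \<open>x\<close> and the memory.\<close>

type_synonym config = "bool list \<times> (nat \<Rightarrow> nat)"

fun step :: "bool list \<Rightarrow> instr \<Rightarrow> config \<Rightarrow> config" where
  "step y (Const i c) (xs, M) = (xs, M(i := c))"
| "step y (Copy i j) (xs, M) = (xs, M(i := M j))"
| "step y (Add i j k) (xs, M) = (xs, M(i := M j + M k))"
| "step y (Sub i j k) (xs, M) = (xs, M(i := M j - M k))"
| "step y (Mult i j k) (xs, M) = (xs, M(i := M j * M k))"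
| "step y (Div i j k) (xs, M) = (xs, M(i := M j div M k))"
| "step y (Load i j) (xs, M) = (xs, M(i := M (M j)))"
| "step y (Store i j) (xs, M) = (xs, M(M i := M j))"
| "step y (Next i) (xs, M) = (tl xs, M(i := (case xs of [] \<Rightarrow> 2 | b # _ \<Rightarrow> of_bool b)))"
| "step y (Query i j) (xs, M) =
     (xs, M(i := (if M j < length y then of_bool (y ! M j) else 2)))"

text \<open>
  The number of bits needed to write down the addresses and the contents of all nonzero cells.
  Charging for the addresses prevents information from being hidden in the choice of a cell.
  The sum is finite for every reachable configuration (see \<open>exec_finite\<close> below). The unread
  part of \<open>x\<close> is not working memory.
\<close>

definition space_of :: "config \<Rightarrow> nat" where
  "space_of s = (\<Sum>i | snd s i \<noteq> 0. floorlog 2 i + floorlog 2 (snd s i))"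

text \<open>
  \<open>exec y p s t m s'\<close>: started in configuration \<open>s\<close>, the program \<open>p\<close> halts in configuration
  \<open>s'\<close> after \<open>t\<close> instructions and tests, and \<open>m\<close> is the maximum of \<^const>\<open>space_of\<close> over all
  configurations on the way. Intermediate results all live in memory cells and are thus
  charged for. Every instruction has unit cost; as the operands have at most \<open>m\<close> bits each,
  a polynomial bound on \<open>t\<close> and \<open>m\<close> is a polynomial bound on the number of bit operations.
\<close>

inductive exec :: "bool list \<Rightarrow> prog \<Rightarrow> config \<Rightarrow> nat \<Rightarrow> nat \<Rightarrow> config \<Rightarrow> bool" for y where
  Skip: "exec y Skip s 1 (space_of s) s"
| Instr: "exec y (Instr a) s 1 (max (space_of s) (space_of (step y a s))) (step y a s)"
| Seq: "\<lbrakk>exec y p s t m s'; exec y q s' t' m' s''\<rbrakk>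
    \<Longrightarrow> exec y (Seq p q) s (t + t') (max m m') s''"
| IfTrue: "\<lbrakk>snd s i \<noteq> 0; exec y p s t m s'\<rbrakk> \<Longrightarrow> exec y (IfNZ i p q) s (t + 1) m s'"
| IfFalse: "\<lbrakk>snd s i = 0; exec y q s t m s'\<rbrakk> \<Longrightarrow> exec y (IfNZ i p q) s (t + 1) m s'"
| WhileFalse: "snd s i = 0 \<Longrightarrow> exec y (WhileNZ i p) s 1 (space_of s) s"
| WhileTrue: "\<lbrakk>snd s i \<noteq> 0; exec y p s t m s'; exec y (WhileNZ i p) s' t' m' s''\<rbrakk>
    \<Longrightarrow> exec y (WhileNZ i p) s (t + t' + 1) (max m m') s''"

text \<open>
  The program is told the length of \<open>x\<close> in cell 0, all other cells being 0 initially, and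
  leaves its output in cell 0.
\<close>

definition init :: "bool list \<Rightarrow> config" where
  "init x = (x, (\<lambda>_. 0)(0 := length x))"

definition computes :: "prog \<Rightarrow> bool list \<Rightarrow> bool list \<Rightarrow> nat \<Rightarrow> nat \<Rightarrow> nat \<Rightarrow> bool" where
  "computes p x y out t m \<longleftrightarrow>
     (\<exists>s. exec y p (init x) t m s \<and> snd s 0 = out)"

lemma exec_deterministic:
  "exec y p s t m s' \<Longrightarrow> exec y p s t' m' s'' \<Longrightarrow> t = t' \<and> m = m' \<and> s' = s''"
proof (induction arbitrary: t' m' s'' rule: exec.induct)
  case (Skip s)
  then show ?case by (auto elim: exec.cases)
next
  case (Instr a s)
  then show ?case by (auto elim: exec.cases)
next
  case (Seq p s t m s1 q t2 m2 s2)
  from Seq.prems Seq.IH show ?case by (cases rule: exec.cases) blast+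
next
  case (IfTrue s i p t m s1 q)
  from IfTrue.prems IfTrue.IH IfTrue.hyps show ?case by (cases rule: exec.cases) blast+
next
  case (IfFalse s i q t m s1 p)
  from IfFalse.prems IfFalse.IH IfFalse.hyps show ?case by (cases rule: exec.cases) fastforce+
next
  case (WhileFalse s i p)
  from WhileFalse.prems WhileFalse.hyps show ?case by (cases rule: exec.cases) auto
next
  case (WhileTrue s i p t m s1 t2 m2 s2)
  from WhileTrue.prems WhileTrue.IH WhileTrue.hyps show ?case
    by (cases rule: exec.cases) blast+
qed

lemma finite_support_upd:
  fixes M :: "nat \<Rightarrow> nat"
  shows "finite {i. M i \<noteq> 0} \<Longrightarrow> finite {i. (M(j := v)) i \<noteq> 0}"
  by (rule finite_subset[of _ "insert j {i. M i \<noteq> 0}"]) auto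

lemma exec_finite:
  "exec y p s t m s' \<Longrightarrow> finite {i. snd s i \<noteq> 0} \<Longrightarrow> finite {i. snd s' i \<noteq> 0}"
proof (induction rule: exec.induct)
  case (Instr a s)
  then show ?case
    by (cases s; cases a) (simp_all only: step.simps snd_conv finite_support_upd)
qed auto

lemma computes_unique:
  "\<lbrakk>computes p x y u t m; computes p x y u' t' m'\<rbrakk> \<Longrightarrow> u = u' \<and> t = t' \<and> m = m'"
  unfolding computes_def by (blast dest: exec_deterministic)

end

theory Submission
  imports Defs "HOL-Library.Nat_Bijection"
begin

text \<open>
  Exchanging the symbols if necessary, let \<open>y\<close> have \<open>m \<le> n / 2\<close> ones. Matching only zeros or only ones
  is a 2-approximation of the LCS. If it is not better than that, then \<open>x\<close> has about \<open>m\<close> zeros and the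
  LCS has length about \<open>2 * m\<close>. Then either matching one symbol before and the other one after some cut
  of both strings gains over \<open>m\<close>, or the first \<open>m\<close> or the last \<open>m\<close> symbols of the two strings are nearly
  equal. Conversely, a gainful cut or a pair of nearly equal ends forces the LCS to exceed \<open>m\<close> by a
  constant factor. So it suffices to detect these events.

  Cuts are tested while reading, with counters for \<open>x\<close> and a scan of \<open>y\<close>. For nearness, the block of
  \<open>x\<close> is the yield of a tree of depth \<open>D\<close> and branching \<open>k \<approx> m powr (1 / D)\<close>: every node is represented
  by a pointer to a segment of \<open>y\<close> that best fits the concatenation of the segments of its children, and
  a single counter accumulates the errors made. By the triangle inequality for the indel distance it
  certifies nearness, and it is at most a constant times the true distance plus a small fraction
  of \<open>m\<close>. Fits are evaluated by a recursive dynamic program whose cut points are rounded to a grid of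
  \<open>O(k)\<close> points, so that \<open>O(k)\<close> numbers per level suffice.
\<close>

text \<open>Let a and b be the lengths reached by matching only zeros and only ones. The LCS lies
  between max(a, b) and a + b, so the output a + b is always large enough, and (2 - 1/(2Q)) max(a,
  b) is always small enough. The events merely select one of the two, and each choice leaves one
  inequality to prove: a detected event must force a large LCS, an undetected one a small LCS. One
  obstacle is that the number of zeros of x is unknown until the stream ends. Cuts are therefore
  evaluated as if x had exactly m zeros, and the flag is consulted only if the final count differs
  from m by at most m/Q. If it differs by more, a and b are so unequal that max(a, b) alone
  suffices. The other obstacle is that a node of the tree no longer sees its block of x, only the
  stand-ins chosen by its children. Their errors count twice, once as reported and once by
  misleading the choice of the pointer, so the error doubles with every level. This puts a power of
  2 with exponent about D into Q, and 1/(2Q) is the final epsilon. Since D depends on delta alone,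
  it is a constant, and the recursion can be unrolled in the program text.\<close>

lemma lcs_attained: "\<exists>z. subseq z x \<and> subseq z y \<and> length z = lcs x y"
  and lcs_ge: "subseq z x \<Longrightarrow> subseq z y \<Longrightarrow> length z \<le> lcs x y"
proof -
  let ?S = "{length z | z. subseq z x \<and> subseq z y}"
  have fin: "finite ?S"
    by (rule finite_subset[of _ "{..length x}"]) (auto dest: list_emb_length)
  have "subseq [] x \<and> subseq [] y" by simp
  then have ne: "?S \<noteq> {}" by blast
  have "lcs x y \<in> ?S" unfolding lcs_def by (rule Max_in[OF fin ne])
  then show "\<exists>z. subseq z x \<and> subseq z y \<and> length z = lcs x y" by force
  show "length z \<le> lcs x y" if "subseq z x" "subseq z y"
    unfolding lcs_def by (rule Max_ge[OF fin]) (use that in blast)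
qed

lemma lcs_sym: "lcs x y = lcs y x"
  unfolding lcs_def by (metis conj_commute)

lemma lcs_le_left: "lcs x y \<le> length x"
  by (metis lcs_attained list_emb_length)

lemma lcs_le_right: "lcs x y \<le> length y"
  by (metis lcs_attained list_emb_length)

lemma lcs_mono: "subseq x x' \<Longrightarrow> subseq y y' \<Longrightarrow> lcs x y \<le> lcs x' y'"
  by (metis lcs_attained lcs_ge subseq_order.order_trans)

lemma lcs_append_ge: "lcs a c + lcs b d \<le> lcs (a @ b) (c @ d)"
  by (metis lcs_attained lcs_ge length_append list_emb_append_mono)

text \<open>An optimal common subsequence is cut after its first \<open>r\<close> elements, and both
  strings are cut along its embeddings. With \<open>r = 1\<close> this isolates the first
  match.\<close>

lemma lcs_split_at_length:
  assumes "r \<le> lcs x y"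
  shows "\<exists>i j. i \<le> length x \<and> j \<le> length y \<and> r \<le> lcs (take i x) (take j y) \<and>
    lcs x y - r \<le> lcs (drop i x) (drop j y)"
proof -
  obtain z where z: "subseq z x" "subseq z y" "length z = lcs x y" using lcs_attained by blast
  have zz: "z = take r z @ drop r z" by simp
  obtain x1 x2 where x: "x = x1 @ x2" "subseq (take r z) x1" "subseq (drop r z) x2"
    using list_emb_appendD[of "(=)" "take r z" "drop r z" x] z(1) by auto
  obtain y1 y2 where y: "y = y1 @ y2" "subseq (take r z) y1" "subseq (drop r z) y2"
    using list_emb_appendD[of "(=)" "take r z" "drop r z" y] z(2) by auto
  have "length (take r z) = r" "length (drop r z) = lcs x y - r" using z(3) assms by auto
  then have "r \<le> lcs x1 y1" "lcs x y - r \<le> lcs x2 y2"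
    using lcs_ge x y by metis+
  then show ?thesis using x(1) y(1) assms
    by (intro exI[of _ "length x1"] exI[of _ "length y1"]) auto
qed

text \<open>An optimal common subsequence breaks at the border of \<open>x1\<close> and
  \<open>x2\<close>, and its embedding into \<open>y\<close> breaks with it; superadditivity turns
  the resulting inequality into an equation. All later cutting of alignments rests on this.\<close>

lemma lcs_split_left:
  "\<exists>y1 y2. y = y1 @ y2 \<and> lcs (x1 @ x2) y = lcs x1 y1 + lcs x2 y2"
proof -
  obtain z where z: "subseq z (x1 @ x2)" "subseq z y" "length z = lcs (x1 @ x2) y"
    using lcs_attained by blast
  obtain z1 z2 where zz: "z = z1 @ z2" "subseq z1 x1" "subseq z2 x2"
    using z(1) by (auto elim: subseq_appendE)
  obtain y1 y2 where y: "y = y1 @ y2" "subseq z1 y1" "subseq z2 y2"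
    using list_emb_appendD[of "(=)" z1 z2 y] z(2) zz(1) by auto
  have "length z1 \<le> lcs x1 y1" "length z2 \<le> lcs x2 y2" using zz y lcs_ge by auto
  moreover have "lcs x1 y1 + lcs x2 y2 \<le> lcs (x1 @ x2) y" using lcs_append_ge y(1) by metis
  ultimately show ?thesis using y(1) z(3) zz(1) by (intro exI[of _ y1] exI[of _ y2]) auto
qed

lemma lcs_split_take:
  "\<exists>j\<le>length y. lcs x y = lcs (take i x) (take j y) + lcs (drop i x) (drop j y)"
proof -
  obtain y1 y2 where "y = y1 @ y2" "lcs (take i x @ drop i x) y = lcs (take i x) y1 + lcs (drop i x) y2"
    using lcs_split_left by metis
  then show ?thesis by (intro exI[of _ "length y1"]) auto
qed

lemma lcs_append_le: "lcs x (a @ b) \<le> lcs x a + length b"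
proof -
  obtain x1 x2 where "x = x1 @ x2" "lcs (a @ b) x = lcs a x1 + lcs b x2"
    using lcs_split_left by metis
  moreover have "lcs a x1 \<le> lcs a x" using calculation by (intro lcs_mono) auto
  moreover have "lcs b x2 \<le> length b" by (rule lcs_le_left)
  ultimately show ?thesis using lcs_sym by (metis add_mono)
qed

lemma lcs_Nil [simp]: "lcs [] y = 0" "lcs y [] = 0"
  using lcs_le_left[of "[]" y] lcs_le_right[of y "[]"] by auto

lemma lcs_same: "lcs x x = length x"
  using lcs_ge[of x x x] lcs_le_left[of x x] by simp

lemma lcs_rev: "lcs (rev x) (rev y) = lcs x y"
proof -
  have le: "lcs x y \<le> lcs (rev x) (rev y)" for x y :: "'b list"
  proof -
    obtain z where z: "subseq z x" "subseq z y" "length z = lcs x y" using lcs_attained by blast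
    have "subseq (rev a) (rev b)" if "subseq a b" for a b :: "'b list"
      using that by induction (auto intro: list_emb_append_mono subseq_rev_drop_many)
    then have "subseq (rev z) (rev x)" "subseq (rev z) (rev y)" using z by blast+
    then show ?thesis using lcs_ge z(3) by (metis length_rev)
  qed
  from le[of x y] le[of "rev x" "rev y"] show ?thesis by simp
qed

lemma lcs_map_le: "lcs x y \<le> lcs (map f x) (map f y)"
  by (metis lcs_attained lcs_ge length_map subseq_map)

lemma lcs_map_inj: assumes "inj f" shows "lcs (map f x) (map f y) = lcs x y"
  using lcs_map_le[of x y f] lcs_map_le[of "map f x" "map f y" "inv f"] assms
  by (simp add: comp_def)

text \<open>Whatever the head of a common subsequence is matched to, its tail embeds into the tails
  of both strings.\<close>

lemma lcs_Cons_Cons_le: "lcs (a # x) (b # y) \<le> Suc (lcs x y)"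
proof -
  obtain z where z: "subseq z (a # x)" "subseq z (b # y)" "length z = lcs (a # x) (b # y)"
    using lcs_attained by blast
  have "subseq (tl z) x" "subseq (tl z) y"
    using z(1,2) by (cases z; auto dest: subseq_Cons' split: if_splits)+
  then have "length (tl z) \<le> lcs x y" by (rule lcs_ge)
  then show ?thesis using z(3) by auto
qed

lemma lcs_drop_drop: "lcs x y \<le> lcs (drop k x) (drop k y) + k"
proof (induction k arbitrary: x y)
  case (Suc k)
  show ?case
  proof (cases x; cases y)
    fix a x' b y' assume xy: "x = a # x'" "y = b # y'"
    show ?thesis using Suc[of x' y'] lcs_Cons_Cons_le[of a x' b y'] xy by simp
  qed auto
qed auto

lemma lcs_append_same: "lcs (x @ s) (y @ s) = lcs x y + length s"
proof -
  have "lcs (s' @ x) (s' @ y) \<le> lcs x y + length s'" for s' x y :: "'b list"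
    using lcs_drop_drop[of "s' @ x" "s' @ y" "length s'"] by simp
  from this[of "rev s" "rev x" "rev y"] have "lcs (x @ s) (y @ s) \<le> lcs x y + length s"
    by (metis lcs_rev length_rev rev_append)
  moreover have "lcs x y + length s \<le> lcs (x @ s) (y @ s)" using lcs_append_ge[of x y s s] lcs_same by metis
  ultimately show ?thesis by simp
qed

text \<open>Inclusion and exclusion: \<open>a\<close> and \<open>b\<close> occupy two sets of
  positions of \<open>v\<close>, and the common positions spell \<open>c\<close>. Instead of
  handling positions, the induction asks whether \<open>a\<close> and \<open>b\<close> still embed
  once the head of \<open>v\<close> is removed.\<close>

lemma subseq_inter:
  "subseq a v \<Longrightarrow> subseq b v \<Longrightarrow> \<exists>c. subseq c a \<and> subseq c b \<and> length a + length b \<le> length c + length v"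
proof (induction v arbitrary: a b)
  case (Cons e v)
  show ?case
  proof (cases "subseq a v")
    case True
    show ?thesis
    proof (cases "subseq b v")
      case True
      then show ?thesis using Cons.IH[OF \<open>subseq a v\<close>] by force
    next
      case False
      then obtain b' where b: "b = e # b'" "subseq b' v" using Cons.prems(2)
        by (cases b) (auto split: if_splits)
      from Cons.IH[OF True b(2)] obtain c where "subseq c a" "subseq c b'"
        "length a + length b' \<le> length c + length v" by blast
      then show ?thesis using b by (intro exI[of _ c]) auto
    qed
  next
    case False
    then obtain a' where a: "a = e # a'" "subseq a' v" using Cons.prems(1)
      by (cases a) (auto split: if_splits)
    show ?thesis
    proof (cases "subseq b v")
      case True
      from Cons.IH[OF a(2) True] obtain c where "subseq c a'" "subseq c b"
        "length a' + length b \<le> length c + length v" by blast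
      then show ?thesis using a by (intro exI[of _ c]) auto
    next
      case False
      then obtain b' where b: "b = e # b'" "subseq b' v" using Cons.prems(2)
        by (cases b) (auto split: if_splits)
      from Cons.IH[OF a(2) b(2)] obtain c where "subseq c a'" "subseq c b'"
        "length a' + length b' \<le> length c + length v" by blast
      then show ?thesis using a b by (intro exI[of _ "e # c"]) auto
    qed
  qed
qed auto

text \<open>Written with |u| + |v| - 2 lcs u v, this is the triangle inequality of the indel
  distance. It permits a block to be replaced by a stand-in at the price of the distance between
  them.\<close>

lemma lcs_triangle: "lcs u v + lcs v w \<le> lcs u w + length v"
proof -
  obtain a where a: "subseq a u" "subseq a v" "length a = lcs u v" using lcs_attained by blast
  obtain b where b: "subseq b v" "subseq b w" "length b = lcs v w" using lcs_attained by blast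
  obtain c where c: "subseq c a" "subseq c b" "length a + length b \<le> length c + length v"
    using subseq_inter[OF a(2) b(1)] by blast
  have "length c \<le> lcs u w" using a b c by (meson lcs_ge subseq_order.order_trans)
  then show ?thesis using a b c by linarith
qed

section \<open>Binary strings\<close>

abbreviation ones :: "bool list \<Rightarrow> nat" where "ones x \<equiv> length (filter id x)"
abbreviation zeros :: "bool list \<Rightarrow> nat" where "zeros x \<equiv> length (filter Not x)"

lemma zeros_ones: "zeros x + ones x = length x"
  by (induction x) auto

lemma lcs_ge_zeros: "min (zeros x) (zeros y) \<le> lcs x y"
  and lcs_ge_ones: "min (ones x) (ones y) \<le> lcs x y"
proof -
  have r: "filter Not z = replicate (zeros z) False" "filter id z = replicate (ones z) True" for z
    by (induction z) auto
  have sub: "subseq (replicate k b) (replicate l b)" if "k \<le> l" for k l and b :: bool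
  proof -
    have "replicate l b = replicate k b @ replicate (l - k) b"
      using that by (simp add: replicate_add[symmetric])
    then show ?thesis by (metis prefixI prefix_imp_subseq)
  qed
  have "subseq (replicate (min (zeros x) (zeros y)) False) x"
    "subseq (replicate (min (zeros x) (zeros y)) False) y"
    by (metis min.cobounded1 min.cobounded2 r(1) sub subseq_filter_left subseq_order.order_trans)+
  from lcs_ge[OF this] show "min (zeros x) (zeros y) \<le> lcs x y" by simp
  have "subseq (replicate (min (ones x) (ones y)) True) x"
    "subseq (replicate (min (ones x) (ones y)) True) y"
    by (metis min.cobounded1 min.cobounded2 r(2) sub subseq_filter_left subseq_order.order_trans)+
  from lcs_ge[OF this] show "min (ones x) (ones y) \<le> lcs x y" by simp
qed

lemma lcs_le_zeros_ones: "lcs x y \<le> min (zeros x) (zeros y) + min (ones x) (ones y)"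
proof -
  obtain z where z: "subseq z x" "subseq z y" "length z = lcs x y" using lcs_attained by blast
  have "zeros z \<le> min (zeros x) (zeros y)" "ones z \<le> min (ones x) (ones y)"
    using z(1,2) by (auto intro!: list_emb_length[of "(=)"])
  then show ?thesis using z(3) zeros_ones[of z] by linarith
qed

lemma zeros_take_drop: "zeros (take i x) + zeros (drop i x) = zeros x"
  and ones_take_drop: "ones (take i x) + ones (drop i x) = ones x"
  by (metis append_take_drop_id filter_append length_append)+

lemma zeros_map_Not: "zeros (map Not x) = ones x" and ones_map_Not: "ones (map Not x) = zeros x"
  by (induction x) auto

text \<open>The values of matching zeros before and ones after the cut \<open>(i, j)\<close>, and conversely.\<close>

definition cut01 :: "bool list \<Rightarrow> bool list \<Rightarrow> nat \<Rightarrow> nat \<Rightarrow> nat" where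
  "cut01 x y i j = min (zeros (take i x)) (zeros (take j y)) + min (ones (drop i x)) (ones (drop j y))"

definition cut10 :: "bool list \<Rightarrow> bool list \<Rightarrow> nat \<Rightarrow> nat \<Rightarrow> nat" where
  "cut10 x y i j = min (ones (take i x)) (ones (take j y)) + min (zeros (drop i x)) (zeros (drop j y))"

lemma cut01_le_lcs: "cut01 x y i j \<le> lcs x y" and cut10_le_lcs: "cut10 x y i j \<le> lcs x y"
proof -
  have "cut01 x y i j \<le> lcs (take i x) (take j y) + lcs (drop i x) (drop j y)"
    "cut10 x y i j \<le> lcs (take i x) (take j y) + lcs (drop i x) (drop j y)"
    unfolding cut01_def cut10_def by (intro add_mono lcs_ge_zeros lcs_ge_ones)+
  then show "cut01 x y i j \<le> lcs x y" "cut10 x y i j \<le> lcs x y"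
    using lcs_append_ge[of "take i x" "take j y" "drop i x" "drop j y"] by simp_all
qed

text \<open>Exchanging the two strings while complementing the symbols maps cuts to cuts. This
  symmetry later halves the case analysis.\<close>

lemma cut_swap: "cut01 (map Not y) (map Not x) j i = cut10 x y i j"
  "cut10 (map Not y) (map Not x) j i = cut01 x y i j"
  unfolding cut01_def cut10_def
  by (simp_all add: take_map drop_map zeros_map_Not ones_map_Not min.commute del: length_filter_map)

section \<open>Pairs with an LCS close to 2m but no gainful cut\<close>

lemma zeros_take_attains:
  "c \<le> zeros x \<Longrightarrow> \<exists>i\<le>length x. zeros (take i x) = c"
proof (induction x arbitrary: c)
  case (Cons a x)
  show ?case
  proof (cases "c = 0")
    case False
    with Cons.prems have "c - of_bool (\<not> a) \<le> zeros x" by (cases a) auto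
    from Cons.IH[OF this] obtain i where "i \<le> length x" "zeros (take i x) = c - of_bool (\<not> a)" by blast
    then show ?thesis using False by (intro exI[of _ "Suc i"]) (cases a; auto)
  qed auto
qed auto

lemma ones_take_attains:
  assumes "c \<le> ones x" shows "\<exists>i\<le>length x. ones (take i x) = c"
  using zeros_take_attains[of c "map Not x"] assms
  by (simp add: take_map zeros_map_Not del: length_filter_map)

text \<open>\<open>g\<close> is a common slack for all quantities. Only the zeros of
  \<open>x\<close> and the ones of \<open>y\<close> are tied to \<open>m\<close>, which makes the
  assumptions invariant under exchanging the strings and complementing the symbols.\<close>

locale near_extremal =
  fixes x y :: "bool list" and n m g :: nat
  assumes len: "length x = n" "length y = n"
    and U: "m \<le> zeros x + g" "zeros x \<le> m + g" and W: "m \<le> ones y + g" "ones y \<le> m + g"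
    and big: "2 * m \<le> lcs x y + g"
    and c01: "\<And>i j. cut01 x y i j \<le> m + g" and c10: "\<And>i j. cut10 x y i j \<le> m + g"
begin

abbreviation u where "u i \<equiv> zeros (take i x)"
abbreviation v where "v i \<equiv> ones (take i x)"
abbreviation u' where "u' i \<equiv> zeros (drop i x)"
abbreviation v' where "v' i \<equiv> ones (drop i x)"
abbreviation s where "s i \<equiv> zeros (take i y)"
abbreviation w where "w i \<equiv> ones (take i y)"
abbreviation s' where "s' i \<equiv> zeros (drop i y)"
abbreviation w' where "w' i \<equiv> ones (drop i y)"

lemma sums: "u i + u' i = zeros x" "v i + v' i = ones x" "s i + s' i = zeros y" "w i + w' i = ones y"
  using zeros_take_drop[of i x] ones_take_drop[of i x] zeros_take_drop[of i y] ones_take_drop[of i y] by auto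

lemma totals: "zeros x + ones x = n" "zeros y + ones y = n"
  using zeros_ones len by auto

definition aligned :: "nat \<Rightarrow> nat \<Rightarrow> bool" where
  "aligned i j \<longleftrightarrow> lcs x y = lcs (take i x) (take j y) + lcs (drop i x) (drop j y)"

text \<open>The LCS is at most \<open>p1 + p2 + p3 + p4\<close>, where \<open>p1\<close> and
  \<open>p3\<close> are limited by the zeros of \<open>x\<close>, and \<open>p2\<close> and
  \<open>p4\<close> by the ones of \<open>y\<close>, about \<open>m\<close> each. An LCS of about 2m
  leaves no room: nearly every zero of \<open>x\<close> and every one of \<open>y\<close> is matched
  on its own side of the cut. Hence \<open>p1 + p4\<close> is nearly \<open>u i + w' j\<close>, and
  the bound on the cut 01 gives that \<open>u i\<close> hardly exceeds \<open>w j\<close>; the cut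
  10 gives the converse.\<close>

lemma alignedD:
  assumes "aligned i j"
  shows "u i \<le> s j + 3 * g" "w j \<le> v i + 3 * g" "u' i \<le> s' j + 3 * g" "w' j \<le> v' i + 3 * g"
    and "u i \<le> w j + 5 * g" "w j \<le> u i + 5 * g"
    and "u i + w j \<le> lcs (take i x) (take j y) + 3 * g" "u' i + w' j \<le> lcs (drop i x) (drop j y) + 3 * g"
    and "lcs (take i x) (take j y) \<le> u i + w j"
proof -
  define p1 p2 p3 p4 where "p1 = min (u i) (s j)" and "p2 = min (v i) (w j)"
    and "p3 = min (u' i) (s' j)" and "p4 = min (v' i) (w' j)"
  note p_def = this
  have p: "p1 \<le> u i" "p1 \<le> s j" "p2 \<le> v i" "p2 \<le> w j" "p3 \<le> u' i" "p3 \<le> s' j" "p4 \<le> v' i" "p4 \<le> w' j"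
    unfolding p_def by simp_all
  have l: "lcs (take i x) (take j y) \<le> p1 + p2" "lcs (drop i x) (drop j y) \<le> p3 + p4"
    unfolding p_def by (rule lcs_le_zeros_ones)+
  have c: "p1 + p4 \<le> m + g" "p2 + p3 \<le> m + g"
    using c01[of i j] c10[of i j] unfolding cut01_def cut10_def p_def by auto
  have tot: "u i + u' i \<le> m + g" "w j + w' j \<le> m + g" "m \<le> u i + u' i + g" "m \<le> w j + w' j + g"
    using sums[of i] sums[of j] U W by simp_all
  have Lam: "2 * m \<le> lcs (take i x) (take j y) + lcs (drop i x) (drop j y) + g"
    using big assms[unfolded aligned_def] by simp
  have q4: "2 * m \<le> p1 + p2 + p3 + p4 + g" using Lam l by linarith
  have "u i \<le> p1 + 3 * g" "w j \<le> p2 + 3 * g" "u' i \<le> p3 + 3 * g" "w' j \<le> p4 + 3 * g"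
    using q4 p(1,4,5,8) tot(1,2) by linarith+
  then show "u i \<le> s j + 3 * g" "w j \<le> v i + 3 * g" "u' i \<le> s' j + 3 * g" "w' j \<le> v' i + 3 * g"
    using p(2,3,6,7) by linarith+
  have "u i + w' j \<le> p1 + p4 + 3 * g" using q4 p(4,5) tot(1,2) by linarith
  then show "u i \<le> w j + 5 * g" using c(1) tot(4) by linarith
  have "u' i + w j \<le> p2 + p3 + 3 * g" using q4 p(1,8) tot(1,2) by linarith
  then show "w j \<le> u i + 5 * g" using c(2) tot(3) by linarith
  show "lcs (take i x) (take j y) \<le> u i + w j" using l(1) p(1,4) by linarith
  have "lcs (drop i x) (drop j y) \<le> u' i + w' j" using l(2) p(5,8) by linarith
  then show "u i + w j \<le> lcs (take i x) (take j y) + 3 * g" using Lam tot(1,2) by linarith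
  show "u' i + w' j \<le> lcs (drop i x) (drop j y) + 3 * g"
    using \<open>lcs (take i x) (take j y) \<le> u i + w j\<close> Lam tot(1,2) by linarith
qed

lemma aligned_left: obtains j where "j \<le> n" "aligned i j"
  using lcs_split_take[of y x i] len unfolding aligned_def by auto

end

text \<open>Removing \<open>d\<close> leading symbols from both suffixes costs at most
  \<open>d\<close> matches and leaves parts of the last \<open>k\<close> symbols.\<close>

lemma lcs_suffixes_ge:
  assumes "k \<le> length x" "k \<le> length y" "i \<le> length x" "j \<le> length y"
    "length x - i \<le> k + d" "length y - j \<le> k + d"
  shows "lcs (drop i x) (drop j y) \<le> lcs (drop (length x - k) x) (drop (length y - k) y) + d"
proof -
  have "lcs (drop i x) (drop j y) \<le> lcs (drop d (drop i x)) (drop d (drop j y)) + d"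
    by (rule lcs_drop_drop)
  also have "drop d (drop i x) = drop (d + i - (length x - k)) (drop (length x - k) x)"
    using assms by simp
  also have "drop d (drop j y) = drop (d + j - (length y - k)) (drop (length y - k) y)"
    using assms by simp
  also have "lcs (drop (d + i - (length x - k)) (drop (length x - k) x)) (drop (d + j - (length y - k)) (drop (length y - k) y))
    \<le> lcs (drop (length x - k) x) (drop (length y - k) y)"
    by (intro lcs_mono) (rule suffix_imp_subseq, rule suffix_drop)+
  finally show ?thesis by simp
qed

context near_extremal
begin

text \<open>If the prefixes differ, \<open>x\<close> starts with a majority of ones. Then matching
  ones first and zeros afterwards would be gainful unless \<open>y\<close> runs out of zeros, and in
  turn \<open>x\<close> runs out of ones. So soon after the start both strings have suffixes hardly
  longer than the number of their matches, and these match nearly perfectly.\<close>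

lemma ends_similar_if_aligned:
  assumes g: "1 \<le> g" and m: "m \<le> n" and j0: "aligned m j0" "j0 \<le> m"
  shows "m \<le> lcs (take m x) (take m y) + 34 * g \<or> m \<le> lcs (drop (n - m) x) (drop (n - m) y) + 34 * g"
proof (rule ccontr)
  assume neg: "\<not> ?thesis"
  let ?t = "lcs (take m x) (take j0 y)"
  have "take j0 y = take j0 (take m y)" using j0(2) by (simp add: min_def)
  then have "?t \<le> lcs (take m x) (take m y)"
    by (intro lcs_mono) (auto intro: prefix_imp_subseq take_is_prefix simp del: take_take)
  then have t: "?t + 34 * g < m" using neg by linarith
  note a0 = alignedD[OF j0(1)]
  have um: "u m + v m = m" using zeros_ones[of "take m x"] m len by simp
  \<comment> \<open>The prefix of \<open>y\<close> aligned with the first \<open>m\<close> symbols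
    of \<open>x\<close> has about \<open>u m\<close> ones, and nearly all of these and of the
    \<open>u m\<close> zeros are matched. Twice \<open>u m\<close> is thus at most
    \<open>?t + 8 * g\<close>, and 26 is 34 - 8.\<close>
  have u0: "2 * u m + 26 * g < m" using a0(5,7) t by linarith
  \<comment> \<open>The ones of \<open>y\<close> behind \<open>j0\<close>, about
    \<open>m - u m\<close>, need partners among the ones of \<open>x\<close> behind position
    \<open>m\<close>, which forces \<open>n\<close> to be large.\<close>
  have n: "2 * m + v m \<le> n + u m + 10 * g"
    using a0(4,6) sums(2)[of m] sums(4)[of j0] totals(1) U(1) W(1) by linarith
  \<comment> \<open>The shift by \<open>8 * g\<close> survives the tolerance \<open>5 * g\<close> of
    an aligned pair: \<open>j2\<close> still has at least \<open>u m + 3 * g\<close> ones before it,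
    enough to push the sums in \<open>C1\<close>, \<open>C2\<close> and \<open>C3\<close> strictly
    above \<open>m + g\<close>.\<close>
  have "u m + 8 * g \<le> zeros x" using u0 U(1) by linarith
  then obtain i2 where i2: "i2 \<le> n" "u i2 = u m + 8 * g" using zeros_take_attains len by metis
  obtain j2 where j2: "j2 \<le> n" "aligned i2 j2" by (rule aligned_left)
  note a2 = alignedD[OF j2(2)]
  have "u m + 3 * g \<le> ones y" using u0 W(1) by linarith
  then obtain j where j: "j \<le> n" "w j = u m + 3 * g" using ones_take_attains len by metis
  \<comment> \<open>Of the two possible values of the second minimum, \<open>u' m\<close> would
    violate the bound on cuts. So the minimum is \<open>s' j2\<close>: few zeros of \<open>y\<close>
    remain behind \<open>j2\<close>.\<close>
  have C1: "s' j2 + w j2 \<le> m + g"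
  proof -
    have "min (v m) (w j2) + min (u' m) (s' j2) \<le> m + g" using c10[of m j2] unfolding cut10_def .
    moreover have "w j2 \<le> v m" using a2(6) i2(2) um u0 by linarith
    moreover have "w j2 + u' m > m + g" using a2(5) i2(2) sums(1)[of m] U(1) g by linarith
    ultimately show ?thesis by linarith
  qed
  have C2: "s' j + w j \<le> m + g"
  proof -
    have "min (v m) (w j) + min (u' m) (s' j) \<le> m + g" using c10[of m j] unfolding cut10_def .
    moreover have "w j \<le> v m" using j(2) um u0 by linarith
    moreover have "w j + u' m > m + g" using j(2) sums(1)[of m] U(1) g by linarith
    ultimately show ?thesis by linarith
  qed
  have C3: "v' i2 + u i2 \<le> m + g"
  proof -
    have "min (u i2) (s j) + min (v' i2) (w' j) \<le> m + g" using c01[of i2 j] unfolding cut01_def .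
    moreover have "u i2 \<le> s j" using C2 j(2) i2(2) n sums(3)[of j] totals(2) W(2) um u0 by linarith
    moreover have "u i2 + w' j > m + g" using i2(2) j(2) sums(4)[of j] W(1) g by linarith
    ultimately show ?thesis by linarith
  qed
  have lx: "length x - i2 = u' i2 + v' i2" using zeros_ones[of "drop i2 x"] by simp
  have ly: "length y - j2 = s' j2 + w' j2" using zeros_ones[of "drop j2 y"] by simp
  \<comment> \<open>\<open>mu\<close> is the smaller of \<open>u i2\<close> and \<open>w j2\<close>,
    and \<open>d\<close> is \<open>m + 2 * g - 2 * mu\<close> truncated at 0, an upper bound on the
    excess of the two suffixes over length \<open>m\<close>. Both enter only through linear facts,
    which keeps the arithmetic linear.\<close>
  have "\<exists>c. c \<le> a \<and> c \<le> b \<and> (c = a \<or> c = b)" for a b :: nat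
    by (intro exI[of _ "min a b"]) (simp add: min_def)
  then obtain mu where mu: "mu \<le> u i2" "mu \<le> w j2" "mu = u i2 \<or> mu = w j2" by blast
  have "\<exists>d. a \<le> b + d \<and> (d = 0 \<or> a = b + d)" for a b :: nat
    by (intro exI[of _ "a - b"]) auto
  then obtain d where d: "m + 2 * g \<le> 2 * mu + d" "d = 0 \<or> m + 2 * g = 2 * mu + d" by blast
  have e1: "u i2 + u' i2 \<le> m + g" "w j2 + w' j2 \<le> m + g" using sums[of i2] sums[of j2] U W by simp_all
  have lin: "b + a + 2 * c \<le> 2 * m + 2 * g" if "a + e \<le> m + g" "e + b \<le> m + g" "c \<le> e" for a b c e :: nat
    using that by linarith
  have "u' i2 + v' i2 + 2 * mu \<le> 2 * m + 2 * g" using lin[OF C3 e1(1) mu(1)] .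
  then have "length x - i2 + 2 * mu \<le> 2 * m + 2 * g" using lx by simp
  then have dx: "length x - i2 \<le> m + d" using d(1) by linarith
  have "s' j2 + w' j2 + 2 * mu \<le> 2 * m + 2 * g" using lin[OF C1 e1(2) mu(2)] by simp
  then have "length y - j2 + 2 * mu \<le> 2 * m + 2 * g" using ly by simp
  then have dy: "length y - j2 \<le> m + d" using d(1) by linarith
  have "lcs (drop i2 x) (drop j2 y) \<le> lcs (drop (n - m) x) (drop (n - m) y) + d"
    using lcs_suffixes_ge[of m x y i2 j2 d] dx dy i2 j2 m len by simp
  moreover have "2 * m \<le> lcs (drop i2 x) (drop j2 y) + 5 * g + u i2 + w j2"
    using a2(8) sums(1)[of i2] sums(4)[of j2] U(1) W(1) by linarith
  moreover have "lcs (drop (n - m) x) (drop (n - m) y) + 34 * g < m" using neg by linarith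
  ultimately have "m + 29 * g < d + u i2 + w j2" by linarith
  then show False using d(2) mu(3) a2(5,6) i2(2) u0 by (elim disjE) linarith+
qed

end

lemma near_extremal_swap:
  assumes "near_extremal x y n m g"
  shows "near_extremal (map Not y) (map Not x) n m g"
proof -
  interpret near_extremal x y n m g by fact
  show ?thesis
    using len U W big c01 c10
    by unfold_locales (simp_all add: zeros_map_Not ones_map_Not cut_swap lcs_map_inj lcs_sym[of "map Not y"] inj_def del: length_filter_map)
qed

text \<open>Some optimal alignment cuts \<open>x\<close> at position \<open>m\<close>. If it cuts
  \<open>y\<close> beyond \<open>m\<close>, splitting the aligned prefixes again at position
  \<open>m\<close> of \<open>y\<close> gives an optimal cut \<open>(i0, m)\<close> with
  \<open>i0\<close> at most \<open>m\<close>, and the exchange of the strings reduces this to the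
  previous lemma.\<close>

lemma near_extremal_ends_similar:
  assumes ne: "near_extremal x y n m g" and m: "m \<le> n" and g: "1 \<le> g"
  shows "m \<le> lcs (take m x) (take m y) + 34 * g \<or> m \<le> lcs (drop (n - m) x) (drop (n - m) y) + 34 * g"
proof -
  interpret near_extremal x y n m g by fact
  obtain j0 where j0: "j0 \<le> n" "aligned m j0" by (rule aligned_left)
  show ?thesis
  proof (cases "j0 \<le> m")
    case True
    then show ?thesis using ends_similar_if_aligned[OF g m j0(2)] by blast
  next
    case False
    obtain i0 where i0: "i0 \<le> length (take m x)" "lcs (take j0 y) (take m x) =
        lcs (take m (take j0 y)) (take i0 (take m x)) + lcs (drop m (take j0 y)) (drop i0 (take m x))"
      using lcs_split_take[where x = "take j0 y" and y = "take m x" and i = m] by blast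
    have i0m: "i0 \<le> m" using i0(1) by simp
    then have tk: "take m (take j0 y) = take m y" "take i0 (take m x) = take i0 x" using False by (auto simp: min_def)
    have dr: "drop i0 (take m x) @ drop m x = drop i0 x" "drop m (take j0 y) @ drop j0 y = drop m y"
      using i0m False append_take_drop_id[of "m - i0" "drop i0 x"] append_take_drop_id[of "j0 - m" "drop m y"]
      by (simp_all add: drop_take)
    have "lcs x y \<le> lcs (take i0 x) (take m y) + lcs (drop i0 x) (drop m y)"
      using j0(2)[unfolded aligned_def] i0(2) tk lcs_append_ge[of "drop i0 (take m x)" "drop m (take j0 y)" "drop m x" "drop j0 y"]
      unfolding dr by (simp add: lcs_sym)
    moreover have "lcs (take i0 x) (take m y) + lcs (drop i0 x) (drop m y) \<le> lcs x y"
      using lcs_append_ge[of "take i0 x" "take m y" "drop i0 x" "drop m y"] by simp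
    ultimately have eq: "lcs x y = lcs (take i0 x) (take m y) + lcs (drop i0 x) (drop m y)" by simp
    interpret S: near_extremal "map Not y" "map Not x" n m g by (rule near_extremal_swap[OF ne])
    have nn: "lcs (map Not a) (map Not b) = lcs b a" for a b
      using lcs_map_inj[of Not a b] lcs_sym[of a b] by (simp add: inj_def)
    have "S.aligned m i0" unfolding S.aligned_def using eq
      by (simp add: take_map drop_map nn lcs_sym[of y x])
    from S.ends_similar_if_aligned[OF g m this i0m] show ?thesis by (simp add: take_map drop_map nn)
  qed
qed

text \<open>With no slack at all, cutting after the first matched symbol contradicts the balance of every cut.\<close>

lemma near_extremal_0_False:
  assumes ne: "near_extremal x y n m 0" and m: "1 \<le> m"
  shows False
proof -
  interpret near_extremal x y n m 0 by fact
  have "1 \<le> lcs x y" using big m by linarith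
  then obtain i j where ij: "1 \<le> lcs (take i x) (take j y)" "lcs x y - 1 \<le> lcs (drop i x) (drop j y)"
    using lcs_split_at_length[of 1 x y] by blast
  have "lcs (take i x) (take j y) + lcs (drop i x) (drop j y) \<le> lcs x y"
    using lcs_append_ge[of "take i x" "take j y" "drop i x" "drop j y"] by simp
  with ij \<open>1 \<le> lcs x y\<close> have "aligned i j" "lcs (take i x) (take j y) = 1" unfolding aligned_def by linarith+
  \<comment> \<open>Without slack \<open>u i\<close> equals \<open>w j\<close>, while their sum is
    1: a contradiction of parity.\<close>
  with alignedD(5-)[OF this(1)] show False by presburger
qed

section \<open>Segments of a string given as a function on positions, and their
  concatenations\<close>

definition seg :: "(nat \<Rightarrow> nat) \<Rightarrow> nat \<Rightarrow> nat \<Rightarrow> nat list" where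
  "seg Y p l = map Y [p..<p + l]"

lemma length_seg [simp]: "length (seg Y p l) = l"
  by (simp add: seg_def)

definition segs :: "(nat \<Rightarrow> nat list) \<Rightarrow> nat \<Rightarrow> nat list" where
  "segs B j = concat (map B [0..<j])"

lemma segs_0 [simp]: "segs B 0 = []" and segs_Suc: "segs B (Suc j) = segs B j @ B j"
  by (simp_all add: segs_def)

lemma map_upt_append: "a \<le> b \<Longrightarrow> b \<le> c \<Longrightarrow> map Y [a..<b] @ map Y [b..<c] = map Y [a..<c]"
  by (metis le_Suc_ex map_append upt_add_eq_append)

lemma segs_seg: "segs (\<lambda>i. seg Y (p + i * L) L) j = seg Y p (j * L)"
proof (induction j)
  case (Suc j)
  have "seg Y p (j * L) @ seg Y (p + j * L) L = seg Y p (Suc j * L)"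
    unfolding seg_def using map_upt_append[of p "p + j * L" "p + j * L + L" Y]
    by (simp add: algebra_simps)
  then show ?case using Suc by (simp add: segs_Suc)
qed (simp add: seg_def)

lemma length_segs: "(\<And>i. i < j \<Longrightarrow> length (B i) = L) \<Longrightarrow> length (segs B j) = j * L"
  by (induction j) (simp_all add: segs_Suc)

lemma lcs_segs_ge: "(\<Sum>i<j. lcs (A i) (B i)) \<le> lcs (segs A j) (segs B j)"
proof (induction j)
  case (Suc j)
  then show ?case using lcs_append_ge[of "segs A j" "segs B j" "A j" "B j"] by (simp add: segs_Suc)
qed simp

lemma split_map_upt:
  assumes "y1 @ y2 = map Y [a..<b]" "a \<le> b"
  obtains c where "a \<le> c" "c \<le> b" "y1 = map Y [a..<c]" "y2 = map Y [c..<b]"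
proof
  let ?c = "a + length y1"
  have l: "length y1 + length y2 = b - a" using arg_cong[OF assms(1), of length] by simp
  show "a \<le> ?c" "?c \<le> b" using l assms(2) by auto
  have "y1 = take (length y1) (map Y [a..<b])" using assms(1) by (metis append_eq_conv_conj)
  moreover have "take (length y1) [a..<b] = [a..<?c]" using l assms(2) by (intro take_upt) auto
  ultimately show "y1 = map Y [a..<?c]" by (metis take_map)
  have "y2 = drop (length y1) (map Y [a..<b])" using assms(1) by (metis append_eq_conv_conj)
  then show "y2 = map Y [?c..<b]" by (simp add: drop_map)
qed

lemma lcs_split_upt:
  assumes "a \<le> b"
  obtains c where "a \<le> c" "c \<le> b"
    "lcs (u @ v) (map Y [a..<b]) = lcs u (map Y [a..<c]) + lcs v (map Y [c..<b])"
proof -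
  obtain y1 y2 where y: "map Y [a..<b] = y1 @ y2" "lcs (u @ v) (map Y [a..<b]) = lcs u y1 + lcs v y2"
    using lcs_split_left by metis
  from split_map_upt[OF y(1)[symmetric] assms] show ?thesis using y(2) that by metis
qed

text \<open>The last block is split off repeatedly. The equation, rather than an inequality, is what
  makes distances of the blocks add up exactly in the error analysis.\<close>

lemma lcs_segs_split:
  assumes "a \<le> b" "0 < j"
  shows "\<exists>c. c 0 = a \<and> c j = b \<and> (\<forall>i<j. c i \<le> c (Suc i)) \<and>
    (\<Sum>i<j. lcs (B i) (map Y [c i..<c (Suc i)])) = lcs (segs B j) (map Y [a..<b])"
  using assms(2,1)
proof (induction j arbitrary: b rule: nat_induct_non_zero)
  case 1
  show ?case using 1 by (intro exI[of _ "\<lambda>i. if i = 0 then a else b"]) (simp add: segs_Suc[of B 0, simplified])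
next
  case (Suc j)
  obtain c' where c': "a \<le> c'" "c' \<le> b"
    "lcs (segs B j @ B j) (map Y [a..<b]) = lcs (segs B j) (map Y [a..<c']) + lcs (B j) (map Y [c'..<b])"
    using lcs_split_upt[OF Suc.prems] by blast
  obtain c where c: "c 0 = a" "c j = c'" "\<forall>i<j. c i \<le> c (Suc i)"
    "(\<Sum>i<j. lcs (B i) (map Y [c i..<c (Suc i)])) = lcs (segs B j) (map Y [a..<c'])"
    using Suc.IH[OF c'(1)] by blast
  let ?c = "c(Suc j := b)"
  have "(\<Sum>i<j. lcs (B i) (map Y [?c i..<?c (Suc i)])) = (\<Sum>i<j. lcs (B i) (map Y [c i..<c (Suc i)]))"
    by (intro sum.cong) auto
  then show ?case using c c' Suc.hyps
    by (intro exI[of _ ?c]) (auto simp: segs_Suc less_Suc_eq)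
qed

section \<open>Approximate comparison by dynamic programming over a grid\<close>

text \<open>The first \<open>j\<close> pieces are laid in order along the positions
  \<open>g 0\<close> to \<open>g t\<close>; \<open>s\<close> is the grid index at which the last
  piece begins. \<open>f\<close> abstracts from how one piece is compared with one interval, so that
  the recursion over levels can plug in itself.\<close>

fun dpv :: "(nat \<Rightarrow> nat \<Rightarrow> nat \<Rightarrow> nat) \<Rightarrow> (nat \<Rightarrow> nat) \<Rightarrow> (nat \<Rightarrow> nat) \<Rightarrow> nat \<Rightarrow> nat \<Rightarrow> nat" where
  "dpv f P g 0 t = 0"
| "dpv f P g (Suc j) t = Max ((\<lambda>s. dpv f P g j s + f (P j) (g s) (g t)) ` {..t})"

definition grid :: "nat \<Rightarrow> nat \<Rightarrow> nat \<Rightarrow> nat \<Rightarrow> nat" where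
  "grid a b K t = a + (b - a) * t div K"

definition cmpf :: "(nat \<Rightarrow> nat \<Rightarrow> nat \<Rightarrow> nat) \<Rightarrow> (nat \<Rightarrow> nat) \<Rightarrow> nat \<Rightarrow> nat \<Rightarrow> nat \<Rightarrow> nat \<Rightarrow> nat" where
  "cmpf f P k C a b = dpv f P (grid a b (k * C)) k (k * C)"

text \<open>Both arguments are parts of \<open>Y\<close>, so every value can be recomputed by random
  access and nothing needs to be stored between levels. Here the pieces are consecutive; a node of
  the tree calls \<open>cmpf\<close> directly, with the scattered pointers of its children.\<close>

fun acf :: "(nat \<Rightarrow> nat) \<Rightarrow> nat \<Rightarrow> nat \<Rightarrow> nat \<Rightarrow> nat \<Rightarrow> nat \<Rightarrow> nat \<Rightarrow> nat" where
  "acf Y k C 0 p a b = of_bool (\<exists>z. a \<le> z \<and> z < b \<and> Y z = Y p)"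
| "acf Y k C (Suc l) p a b = cmpf (acf Y k C l) (\<lambda>i. p + i * k ^ l) k C a b"

lemma grid_mono: "s \<le> t \<Longrightarrow> grid a b K s \<le> grid a b K t"
  by (simp add: grid_def div_le_mono)

lemma grid_0 [simp]: "grid a b K 0 = a"
  by (simp add: grid_def)

lemma grid_K: "a \<le> b \<Longrightarrow> 0 < K \<Longrightarrow> grid a b K K = b"
  by (simp add: grid_def)

text \<open>The largest grid point up to \<open>c\<close> is taken. Consecutive grid points differ
  by at most \<open>(b - a) div K + 1\<close>, and \<open>c\<close> lies strictly below the next
  one, which saves the 1. Rounding is therefore exact when the interval is shorter than
  \<open>K\<close>.\<close>

lemma grid_round:
  assumes "a \<le> c" "c \<le> grid a b K t" "0 < K"
  shows "\<exists>s\<le>t. grid a b K s \<le> c \<and> c \<le> grid a b K s + (b - a) div K"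
proof -
  let ?S = "{s. s \<le> t \<and> grid a b K s \<le> c}"
  have fin: "finite ?S" by (rule finite_subset[of _ "{..t}"]) auto
  have "0 \<in> ?S" using assms by simp
  then have s: "Max ?S \<in> ?S" using Max_in[OF fin] by blast
  define s where "s = Max ?S"
  have s: "s \<le> t" "grid a b K s \<le> c" using s unfolding s_def by auto
  have "c \<le> grid a b K s + (b - a) div K"
  proof (cases "s = t")
    case True
    then show ?thesis using assms by simp
  next
    case False
    have "c < grid a b K (Suc s)"
    proof (rule ccontr)
      assume "\<not> ?thesis"
      then have "Suc s \<in> ?S" using False s by auto
      then show False using Max_ge[OF fin] s_def by fastforce
    qed
    moreover have "(b - a) * Suc s div K \<le> (b - a) * s div K + (b - a) div K + 1"
    proof -
      have "(b - a) * Suc s = (b - a) * s + (b - a)" by simp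
      moreover have "(p + q) div K \<le> p div K + q div K + 1" for p q
      proof -
        have "p mod K + q mod K < 2 * K" using assms(3) mod_less_divisor[of K p] mod_less_divisor[of K q] by linarith
        then have "(p mod K + q mod K) div K < 2" using assms(3) by (simp add: div_less_iff_less_mult)
        then show ?thesis using div_add1_eq[of p q K] by linarith
      qed
      ultimately show ?thesis by metis
    qed
    ultimately show ?thesis by (simp add: grid_def)
  qed
  with s show ?thesis by blast
qed

lemma dpv_sound:
  assumes f: "\<And>p a b. a \<le> b \<Longrightarrow> f p a b \<le> lcs (seg Y p L) (map Y [a..<b])"
    and g: "\<And>s t. s \<le> t \<Longrightarrow> g s \<le> g t"
  shows "dpv f P g j t \<le> lcs (segs (\<lambda>i. seg Y (P i) L) j) (map Y [g 0..<g t])"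
proof (induction j arbitrary: t)
  case (Suc j)
  have "dpv f P g j s + f (P j) (g s) (g t) \<le> lcs (segs (\<lambda>i. seg Y (P i) L) (Suc j)) (map Y [g 0..<g t])"
    if "s \<le> t" for s
  proof -
    have "dpv f P g j s + f (P j) (g s) (g t)
      \<le> lcs (segs (\<lambda>i. seg Y (P i) L) j) (map Y [g 0..<g s]) + lcs (seg Y (P j) L) (map Y [g s..<g t])"
      by (intro add_mono Suc f g that)
    also have "\<dots> \<le> lcs (segs (\<lambda>i. seg Y (P i) L) (Suc j)) (map Y [g 0..<g s] @ map Y [g s..<g t])"
      unfolding segs_Suc by (rule lcs_append_ge)
    also have "map Y [g 0..<g s] @ map Y [g s..<g t] = map Y [g 0..<g t]"
      by (intro map_upt_append g that) simp
    finally show ?thesis .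
  qed
  then show ?case by (subst dpv.simps(2), subst Max_le_iff) auto
qed simp

text \<open>Everything is scaled by \<open>C\<close> to measure relative errors of
  \<open>l / C\<close> in natural numbers. The errors of \<open>f\<close> are proportional to the
  lengths of consecutive intervals and add up to \<open>l * (g t - a)\<close>; each row adds one
  rounding of a cut point.\<close>

lemma dpv_complete:
  assumes f: "\<And>p a b. a \<le> b \<Longrightarrow> C * lcs (seg Y p L) (map Y [a..<b]) \<le> C * f p a b + l * (b - a)"
    and K: "0 < K" and ab: "a \<le> b" and t: "t \<le> K"
  defines "g \<equiv> grid a b K"
  shows "C * lcs (segs (\<lambda>i. seg Y (P i) L) j) (map Y [a..<g t])
    \<le> C * dpv f P g j t + l * (g t - a) + C * (j * ((b - a) div K))"
  using t
proof (induction j arbitrary: t)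
  case (Suc j)
  let ?B = "\<lambda>i. seg Y (P i) L"
  let ?d = "(b - a) div K"
  have "a \<le> g t" unfolding g_def by (simp add: grid_def)
  then obtain c where c: "a \<le> c" "c \<le> g t"
    "lcs (segs ?B j @ ?B j) (map Y [a..<g t]) = lcs (segs ?B j) (map Y [a..<c]) + lcs (?B j) (map Y [c..<g t])"
    by (rule lcs_split_upt)
  obtain s where s: "s \<le> t" "g s \<le> c" "c \<le> g s + ?d"
    using grid_round[of a c b K t] c K unfolding g_def by blast
  have as: "a \<le> g s" unfolding g_def by (simp add: grid_def)
  have "map Y [a..<c] = map Y [a..<g s] @ map Y [g s..<c]" using as s by (simp add: map_upt_append)
  then have 1: "lcs (segs ?B j) (map Y [a..<c]) \<le> lcs (segs ?B j) (map Y [a..<g s]) + ?d"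
    using lcs_append_le[of "segs ?B j" "map Y [a..<g s]" "map Y [g s..<c]"] s by simp
  have "map Y [g s..<g t] = map Y [g s..<c] @ map Y [c..<g t]" using s c by (simp add: map_upt_append)
  then have 2: "lcs (?B j) (map Y [c..<g t]) \<le> lcs (?B j) (map Y [g s..<g t])"
    by (intro lcs_mono) auto
  have gst: "g s \<le> g t" using s c by simp
  have "C * lcs (segs ?B (Suc j)) (map Y [a..<g t])
    \<le> C * lcs (segs ?B j) (map Y [a..<g s]) + C * ?d + C * lcs (?B j) (map Y [g s..<g t])"
    unfolding segs_Suc c(3) distrib_left[symmetric] using 1 2 by (intro mult_left_mono) auto
  also have "\<dots> \<le> (C * dpv f P g j s + l * (g s - a) + C * (j * ?d)) + C * ?d + (C * f (P j) (g s) (g t) + l * (g t - g s))"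
    using Suc.IH[of s] f[OF gst, of "P j"] Suc.prems s by (intro add_mono) auto
  also have "\<dots> = C * (dpv f P g j s + f (P j) (g s) (g t)) + l * ((g s - a) + (g t - g s)) + C * (Suc j * ?d)"
    by (simp add: algebra_simps)
  also have "(g s - a) + (g t - g s) = g t - a" using as gst by simp
  also have "dpv f P g j s + f (P j) (g s) (g t) \<le> dpv f P g (Suc j) t"
    using s by (subst dpv.simps(2)) (intro Max_ge; auto)
  finally show ?case by simp
qed simp

lemma cmpf_sound:
  assumes "\<And>p a b. a \<le> b \<Longrightarrow> f p a b \<le> lcs (seg Y p L) (map Y [a..<b])" "a \<le> b" "0 < k" "0 < C"
  shows "cmpf f P k C a b \<le> lcs (segs (\<lambda>i. seg Y (P i) L) k) (map Y [a..<b])"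
  using dpv_sound[of f Y L "grid a b (k * C)" P k "k * C"] assms grid_mono
  unfolding cmpf_def by (simp add: grid_K)

text \<open>With \<open>k * C\<close> grid steps, the \<open>k\<close> roundings cost at most
  \<open>(b - a) / C\<close> together. So each level of the recursion adds just one to the
  coefficient \<open>l\<close>.\<close>

lemma cmpf_complete:
  assumes "\<And>p a b. a \<le> b \<Longrightarrow> C * lcs (seg Y p L) (map Y [a..<b]) \<le> C * f p a b + l * (b - a)"
    "a \<le> b" "0 < k" "0 < C"
  shows "C * lcs (segs (\<lambda>i. seg Y (P i) L) k) (map Y [a..<b]) \<le> C * cmpf f P k C a b + Suc l * (b - a)"
proof -
  have "C * (k * ((b - a) div (k * C))) \<le> b - a"
    using times_div_less_eq_dividend[of "k * C" "b - a"] by (simp add: mult.assoc mult.left_commute mult.commute)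
  then show ?thesis
    using dpv_complete[of C Y L f l "k * C" a b "k * C" P k] assms
    unfolding cmpf_def by (simp add: grid_K)
qed

lemma lcs_singleton: "lcs [s] x = of_bool (s \<in> set x)"
proof (cases "s \<in> set x")
  case True
  then have "subseq [s] x" by (simp add: subseq_singleton_left)
  then show ?thesis using lcs_ge[of "[s]" "[s]" x] lcs_le_left[of "[s]" x] True by simp
next
  case False
  have "lcs [s] x = 0"
  proof (rule ccontr)
    assume "lcs [s] x \<noteq> 0"
    obtain z where z: "subseq z [s]" "subseq z x" "length z = lcs [s] x" using lcs_attained by blast
    then have "length z = 1" using \<open>lcs [s] x \<noteq> 0\<close> lcs_le_left[of "[s]" x] by simp
    then obtain c where "z = [c]" by (auto simp: length_Suc_conv)
    then have "c \<in> set [s]" "c \<in> set x" using z subseq_singleton_left by metis+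
    then show False using False by simp
  qed
  then show ?thesis using False by simp
qed

lemma lcs_unit: "lcs (seg X p (Suc 0)) (map Y [a..<b]) = of_bool (\<exists>z. a \<le> z \<and> z < b \<and> Y z = X p)"
proof -
  have "X p \<in> set (map Y [a..<b]) \<longleftrightarrow> (\<exists>z. a \<le> z \<and> z < b \<and> Y z = X p)"
    by (force simp: image_iff)
  then show ?thesis by (simp add: seg_def lcs_singleton del: set_map)
qed

lemma acf_sound:
  assumes "0 < k" "0 < C" "a \<le> b"
  shows "acf Y k C l p a b \<le> lcs (seg Y p (k ^ l)) (map Y [a..<b])"
  using assms(3)
proof (induction l arbitrary: p a b)
  case 0
  then show ?case by (simp add: lcs_unit)
next
  case (Suc l)
  show ?case using cmpf_sound[OF Suc.IH Suc.prems assms(1,2), where P = "\<lambda>i. p + i * k ^ l"]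
    by (simp add: segs_seg)
qed

lemma acf_complete:
  assumes "0 < k" "0 < C" "a \<le> b"
  shows "C * lcs (seg Y p (k ^ l)) (map Y [a..<b]) \<le> C * acf Y k C l p a b + l * (b - a)"
  using assms(3)
proof (induction l arbitrary: p a b)
  case 0
  then show ?case by (simp add: lcs_unit)
next
  case (Suc l)
  show ?case using cmpf_complete[OF Suc.IH Suc.prems assms(1,2), where P = "\<lambda>i. p + i * k ^ l"]
    by (simp add: segs_seg)
qed

section \<open>Hierarchical representation of the stream by pieces of the other string\<close>

text \<open>A relation and not a function, since ties between pointers may be broken arbitrarily.
  Pointers range up to \<open>N\<close> inclusively, because an interval of an optimal alignment may
  be empty and start at the very end.\<close>

fun node :: "(nat \<Rightarrow> nat) \<Rightarrow> (nat \<Rightarrow> nat) \<Rightarrow> nat \<Rightarrow> nat \<Rightarrow> nat \<Rightarrow> nat \<Rightarrow> nat \<Rightarrow> nat \<Rightarrow> nat \<Rightarrow> bool" where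
  "node X Y k C N 0 p q e \<longleftrightarrow> q \<le> N \<and> e = of_bool (\<forall>z\<le>N. Y z \<noteq> X p) \<and> (e = 0 \<longrightarrow> Y q = X p)"
| "node X Y k C N (Suc l) p q e \<longleftrightarrow> (\<exists>P E. (\<forall>i<k. node X Y k C N l (p + i * k ^ l) (P i) (E i)) \<and> q \<le> N \<and>
     (\<forall>z\<le>N. cmpf (acf Y k C l) P k C z (z + k ^ Suc l) \<le> cmpf (acf Y k C l) P k C q (q + k ^ Suc l)) \<and>
     e = (\<Sum>i<k. E i) + (k ^ Suc l - cmpf (acf Y k C l) P k C q (q + k ^ Suc l)))"

lemma node_ptr_le: "node X Y k C N l p q e \<Longrightarrow> q \<le> N"
  by (cases l) auto

text \<open>This keeps the error counter within the range of a register.\<close>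

lemma node_err_le: "node X Y k C N l p q e \<Longrightarrow> e \<le> Suc l * k ^ l"
proof (induction l arbitrary: p q e)
  case (Suc l)
  then obtain P E where PE: "\<forall>i<k. node X Y k C N l (p + i * k ^ l) (P i) (E i)"
    "e \<le> (\<Sum>i<k. E i) + k ^ Suc l" by auto
  have "(\<Sum>i<k. E i) \<le> (\<Sum>i<k. Suc l * k ^ l)" using Suc.IH PE by (intro sum_mono) auto
  then show ?case using PE(2) by (simp add: algebra_simps)
qed auto

lemma segs_near:
  assumes "\<And>i. i < k \<Longrightarrow> L \<le> lcs (A i) (B i) + E i" "\<And>i. i < k \<Longrightarrow> length (B i) = L"
  shows "k * L \<le> lcs (segs A k) (segs B k) + (\<Sum>i<k. E i)"
proof -
  have "k * L = (\<Sum>i<k. L)" by simp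
  also have "\<dots> \<le> (\<Sum>i<k. lcs (A i) (B i) + E i)" using assms by (intro sum_mono) auto
  also have "\<dots> \<le> lcs (segs A k) (segs B k) + (\<Sum>i<k. E i)"
    using lcs_segs_ge[where A = A and B = B and j = k] by (simp add: sum.distrib)
  finally show ?thesis .
qed

lemma node_sound:
  assumes k: "0 < k" "0 < C"
  shows "node X Y k C N l p q e \<Longrightarrow> k ^ l \<le> lcs (seg X p (k ^ l)) (seg Y q (k ^ l)) + e"
proof (induction l arbitrary: p q e)
  case 0
  then show ?case by (auto simp: seg_def lcs_singleton)
next
  case (Suc l)
  let ?f = "acf Y k C l"
  let ?L = "k ^ Suc l"
  from Suc.prems obtain P E where PE: "\<forall>i<k. node X Y k C N l (p + i * k ^ l) (P i) (E i)"
    "e = (\<Sum>i<k. E i) + (?L - cmpf ?f P k C q (q + ?L))" by auto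
  let ?u = "segs (\<lambda>i. seg Y (P i) (k ^ l)) k"
  have "k * k ^ l \<le> lcs (segs (\<lambda>i. seg X (p + i * k ^ l) (k ^ l)) k) ?u + (\<Sum>i<k. E i)"
    using Suc.IH PE(1) by (intro segs_near) auto
  then have 1: "?L \<le> lcs (seg X p ?L) ?u + (\<Sum>i<k. E i)" unfolding segs_seg by simp
  have "cmpf ?f P k C q (q + ?L) \<le> lcs ?u (map Y [q..<q + ?L])"
    using k by (intro cmpf_sound acf_sound) auto
  then have 2: "?L \<le> lcs ?u (seg Y q ?L) + (?L - cmpf ?f P k C q (q + ?L))"
    unfolding seg_def by linarith
  have "length ?u = ?L" by (subst length_segs[where L = "k ^ l"]) auto
  then have "lcs (seg X p ?L) ?u + lcs ?u (seg Y q ?L) \<le> lcs (seg X p ?L) (seg Y q ?L) + ?L"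
    using lcs_triangle by metis
  then show ?case using 1 2 PE(2) by linarith
qed

text \<open>The indel distance of a block to the interval of \<open>Y\<close> it is aligned with bounds the error; it is
  additive over the pieces of an optimal alignment.\<close>

lemma seg_near_interval:
  assumes "a \<le> b" and u: "length u = L"
  shows "2 * lcs u (map Y [a..<b]) \<le> lcs u (seg Y a L) + (b - a)"
proof -
  let ?lam = "lcs u (map Y [a..<b])"
  have le: "?lam \<le> L" "?lam \<le> b - a" using lcs_le_left[of u] lcs_le_right[of u "map Y [a..<b]"] u by auto
  show ?thesis
  proof (cases "b - a \<le> L")
    case True
    then have "map Y [a..<b] @ map Y [b..<a + L] = seg Y a L"
      unfolding seg_def using assms by (intro map_upt_append) auto
    moreover have "?lam \<le> lcs u (map Y [a..<b] @ map Y [b..<a + L])" by (intro lcs_mono) auto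
    ultimately have "?lam \<le> lcs u (seg Y a L)" by simp
    then show ?thesis using le by linarith
  next
    case False
    then have "seg Y a L @ map Y [a + L..<b] = map Y [a..<b]"
      unfolding seg_def using assms by (intro map_upt_append) auto
    then have "?lam \<le> lcs u (seg Y a L) + (b - a - L)"
      using lcs_append_le[of u "seg Y a L" "map Y [a + L..<b]"] by simp
    then show ?thesis using le False by linarith
  qed
qed

text \<open>Let u be the concatenation of the stand-ins of the children. The segment at
  \<open>a\<close> is within \<open>d\<close> plus the children's errors of u, so the loss added at
  this node is at most that plus the relative error of the comparison. The children's errors thus
  enter twice, and the coefficient obeys c' = 2c + 1, whose solution is
  \<open>2 ^ Suc l - 1\<close>.\<close>

lemma node_complete:
  assumes k: "0 < k" "0 < C"
  shows "node X Y k C N l p q e \<Longrightarrow> a \<le> b \<Longrightarrow> b \<le> N \<Longrightarrow>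
    d + 2 * lcs (seg X p (k ^ l)) (map Y [a..<b]) = k ^ l + (b - a) \<Longrightarrow>
    C * e \<le> (2 ^ Suc l - 1) * (C * d + l * k ^ l)"
proof (induction l arbitrary: p q e a b d)
  case 0
  have "e \<le> d"
  proof (cases "e = 0")
    case False
    then have "e = 1" "\<forall>z\<le>N. Y z \<noteq> X p" using 0 by (auto split: if_splits)
    then have "lcs (seg X p (k ^ 0)) (map Y [a..<b]) = 0" using 0 by (simp add: lcs_unit)
    then show ?thesis using 0 \<open>e = 1\<close> by simp
  qed simp
  then show ?case by simp
next
  case (Suc l)
  let ?f = "acf Y k C l"
  let ?L = "k ^ Suc l"
  let ?B = "\<lambda>i. seg X (p + i * k ^ l) (k ^ l)"
  from Suc.prems obtain P E where PE: "\<forall>i<k. node X Y k C N l (p + i * k ^ l) (P i) (E i)"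
    "e = (\<Sum>i<k. E i) + (?L - cmpf ?f P k C q (q + ?L))"
    "\<forall>z\<le>N. cmpf ?f P k C z (z + ?L) \<le> cmpf ?f P k C q (q + ?L)" by auto
  let ?u = "segs (\<lambda>i. seg Y (P i) (k ^ l)) k"
  have lu: "length ?u = ?L" by (subst length_segs[where L = "k ^ l"]) auto
  have sx: "segs ?B k = seg X p ?L" by (simp add: segs_seg)
  obtain c where c: "c 0 = a" "c k = b" "\<forall>i<k. c i \<le> c (Suc i)"
    "(\<Sum>i<k. lcs (?B i) (map Y [c i..<c (Suc i)])) = lcs (segs ?B k) (map Y [a..<b])"
    using lcs_segs_split[OF Suc.prems(2) k(1), of ?B Y] by blast
  have cmono: "c i \<le> c j" if "i \<le> j" "j \<le> k" for i j
    using that by (induction j rule: dec_induct) (use c(3) in \<open>auto intro: le_trans\<close>)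
  define di where "di i = k ^ l + (c (Suc i) - c i) - 2 * lcs (?B i) (map Y [c i..<c (Suc i)])" for i
  have di: "di i + 2 * lcs (?B i) (map Y [c i..<c (Suc i)]) = k ^ l + (c (Suc i) - c i)" for i
    using lcs_le_left[of "?B i" "map Y [c i..<c (Suc i)]"] lcs_le_right[of "?B i" "map Y [c i..<c (Suc i)]"]
    unfolding di_def by simp
  have tele: "(\<Sum>i<j. c (Suc i) - c i) = c j - c 0" if "j \<le> k" for j
    using that
  proof (induction j)
    case (Suc j)
    then show ?case using cmono[of 0 j] cmono[of j "Suc j"] by simp
  qed simp
  have "(\<Sum>i<k. di i) + 2 * (\<Sum>i<k. lcs (?B i) (map Y [c i..<c (Suc i)])) = (\<Sum>i<k. k ^ l + (c (Suc i) - c i))"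
    unfolding sum_distrib_left sum.distrib[symmetric] using di by simp
  also have "\<dots> = ?L + (b - a)" unfolding sum.distrib tele[OF order_refl] c(1,2) by simp
  finally have sd: "(\<Sum>i<k. di i) = d" using c(4) Suc.prems(4) sx by simp
  have "C * E i \<le> (2 ^ Suc l - 1) * (C * di i + l * k ^ l)" if "i < k" for i
    using that PE(1) c(3) cmono[of "Suc i" k] Suc.prems(3) c(2) di
    by (intro Suc.IH[of "p + i * k ^ l" "P i" "E i" "c i" "c (Suc i)" "di i"]) auto
  then have "(\<Sum>i<k. C * E i) \<le> (\<Sum>i<k. (2 ^ Suc l - 1) * (C * di i + l * k ^ l))"
    by (intro sum_mono) auto
  then have E: "C * (\<Sum>i<k. E i) \<le> (2 ^ Suc l - 1) * (C * d + l * ?L)"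
    by (simp add: sum_distrib_left[symmetric] sum.distrib sd mult.left_commute del: power_Suc) (simp add: mult.left_commute)
  have "k * k ^ l \<le> lcs (segs ?B k) ?u + (\<Sum>i<k. E i)"
    using node_sound[OF k] PE(1) by (intro segs_near) auto
  then have u1: "?L \<le> lcs (seg X p ?L) ?u + (\<Sum>i<k. E i)" unfolding sx by simp
  have "lcs ?u (seg X p ?L) + lcs (seg X p ?L) (seg Y a ?L) \<le> lcs ?u (seg Y a ?L) + ?L"
    using lcs_triangle[of ?u "seg X p ?L" "seg Y a ?L"] by simp
  moreover have "2 * lcs (seg X p ?L) (map Y [a..<b]) \<le> lcs (seg X p ?L) (seg Y a ?L) + (b - a)"
    using seg_near_interval[OF Suc.prems(2)] by simp
  ultimately have u2: "?L \<le> lcs ?u (seg Y a ?L) + (\<Sum>i<k. E i) + d"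
    using u1 Suc.prems(4) lcs_sym[of ?u "seg X p ?L"] by linarith
  have "C * lcs ?u (map Y [a..<a + ?L]) \<le> C * cmpf ?f P k C a (a + ?L) + Suc l * ((a + ?L) - a)"
    using k by (intro cmpf_complete acf_complete) auto
  \<comment> \<open>The left end of the aligned interval is itself a candidate, so the chosen
    pointer is at least as good.\<close>
  also have "cmpf ?f P k C a (a + ?L) \<le> cmpf ?f P k C q (q + ?L)" using PE(3) Suc.prems(2,3) by auto
  finally have u3: "C * lcs ?u (seg Y a ?L) \<le> C * cmpf ?f P k C q (q + ?L) + Suc l * ?L"
    by (simp add: seg_def)
  have "C * ?L \<le> C * lcs ?u (seg Y a ?L) + C * (\<Sum>i<k. E i) + C * d"
    using mult_left_mono[OF u2, of C] by (simp only: distrib_left le0)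
  then have "C * (?L - cmpf ?f P k C q (q + ?L)) \<le> C * (\<Sum>i<k. E i) + C * d + Suc l * ?L"
    using u3 by (simp add: diff_mult_distrib2 del: power_Suc)
  then have "C * e \<le> 2 * (C * (\<Sum>i<k. E i)) + (C * d + Suc l * ?L)"
    unfolding PE(2) distrib_left by linarith
  also have "\<dots> \<le> 2 * ((2 ^ Suc l - 1) * (C * d + l * ?L)) + (C * d + Suc l * ?L)"
    using E by linarith
  also have "\<dots> \<le> 2 * ((2 ^ Suc l - 1) * (C * d + Suc l * ?L)) + (C * d + Suc l * ?L)"
    by (intro add_mono mult_left_mono) auto
  also have "\<dots> = (2 * (2 ^ Suc l - 1) + 1) * (C * d + Suc l * ?L)" by (simp only: distrib_right mult.assoc mult_1)
  also have "2 * (2 ^ Suc l - 1) + 1 = (2 ^ Suc (Suc l) - 1 :: nat)"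
    using one_le_power[of "2::nat" "Suc l"] power_Suc[of "2::nat" "Suc l"] by linarith
  finally show ?case .
qed

lemma root_sound:
  assumes "0 < k" "0 < C" "node X Y k C N D 0 q e" "N = k ^ D"
  shows "N \<le> lcs (seg X 0 N) (seg Y 0 N) + (e + (N - acf Y k C D q 0 N))"
proof -
  have "N \<le> lcs (seg X 0 N) (seg Y q N) + e" using node_sound[OF assms(1-3)] assms(4) by simp
  moreover have "acf Y k C D q 0 N \<le> lcs (seg Y q N) (seg Y 0 N)"
    using acf_sound[OF assms(1,2), of 0 N Y D q] assms(4) by (simp add: seg_def)
  moreover have "lcs (seg X 0 N) (seg Y q N) + lcs (seg Y q N) (seg Y 0 N) \<le> lcs (seg X 0 N) (seg Y 0 N) + N"
    using lcs_triangle[of "seg X 0 N" "seg Y q N" "seg Y 0 N"] by simp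
  ultimately show ?thesis by linarith
qed

text \<open>The final comparison of the segment at the root with the block of \<open>Y\<close>
  itself doubles the error once more, like another level. For strings of equal length
  \<open>N\<close> the indel distance is twice \<open>N\<close> minus the LCS.\<close>

lemma root_complete:
  assumes "0 < k" "0 < C" "node X Y k C N D 0 q e" "N = k ^ D"
  shows "C * (e + (N - acf Y k C D q 0 N))
    \<le> 2 ^ (D + 2) * (2 * C * (N - lcs (seg X 0 N) (seg Y 0 N)) + D * N)"
proof -
  let ?lam = "lcs (seg X 0 N) (seg Y 0 N)"
  let ?d = "2 * (N - ?lam)"
  let ?Z = "C * ?d + D * N"
  have lam: "?lam \<le> N" using lcs_le_left[of "seg X 0 N"] by simp
  have e: "C * e \<le> (2 ^ Suc D - 1) * ?Z"
    using node_complete[OF assms(1-3), of 0 N ?d] assms(4) lam by (simp add: seg_def)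
  have "N \<le> lcs (seg X 0 N) (seg Y q N) + e" using node_sound[OF assms(1-3)] assms(4) by simp
  moreover have "lcs (seg Y q N) (seg X 0 N) + ?lam \<le> lcs (seg Y q N) (seg Y 0 N) + N"
    using lcs_triangle[of "seg Y q N" "seg X 0 N" "seg Y 0 N"] by simp
  ultimately have "N \<le> lcs (seg Y q N) (seg Y 0 N) + e + (N - ?lam)"
    using lam lcs_sym[of "seg Y q N" "seg X 0 N"] by linarith
  then have 1: "C * N \<le> C * lcs (seg Y q N) (seg Y 0 N) + C * e + C * (N - ?lam)"
    unfolding distrib_left[symmetric] by (rule mult_left_mono) simp
  have "C * lcs (seg Y q N) (seg Y 0 N) \<le> C * acf Y k C D q 0 N + D * N"
    using acf_complete[OF assms(1,2), of 0 N Y q D] assms(4) by (simp add: seg_def)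
  then have "C * (N - acf Y k C D q 0 N) \<le> C * e + C * (N - ?lam) + D * N"
    using 1 by (simp add: diff_mult_distrib2)
  moreover have "C * (N - ?lam) \<le> C * ?d" by simp
  ultimately have "C * (e + (N - acf Y k C D q 0 N)) \<le> 2 * (C * e) + ?Z"
    unfolding distrib_left by linarith
  also have "\<dots> \<le> 2 * ((2 ^ Suc D - 1) * ?Z) + ?Z" using e by linarith
  also have "\<dots> = (2 * (2 ^ Suc D - 1) + 1) * ?Z" by (simp only: distrib_right mult.assoc mult_1)
  also have "2 * (2 ^ Suc D - 1) + 1 \<le> (2 ^ (D + 2) :: nat)"
  proof -
    have "(2::nat) ^ (D + 2) = 2 * 2 ^ Suc D" by simp
    then show ?thesis using one_le_power[of "2::nat" "Suc D"] by linarith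
  qed
  finally show ?thesis by (simp add: mult.assoc mult.left_commute)
qed

section \<open>A structured language compiled to the machine\<close>

type_synonym reg = "nat \<times> nat"
type_synonym store = "reg \<Rightarrow> nat \<Rightarrow> nat"
type_synonym state = "bool list \<times> store"

datatype exp = K nat | Rd reg exp | Inp exp | Pl exp exp | Mi exp exp | Ti exp exp | Dv exp exp

text \<open>\<open>For r e a\<close> runs \<open>a\<close> for \<open>r = e - 1, \<dots>, 0\<close>; it counts down because the machine only tests for zero.\<close>

datatype cmd = Nop | Asg reg exp exp | Read reg | Then cmd cmd (infixr "\<triangleright>" 60)
  | Cond exp cmd cmd | For reg exp cmd

fun sym :: "bool list \<Rightarrow> nat \<Rightarrow> nat" where
  "sym y p = (if p < length y then of_bool (y ! p) else 2)"

fun ev :: "bool list \<Rightarrow> store \<Rightarrow> exp \<Rightarrow> nat" where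
  "ev y h (K c) = c"
| "ev y h (Rd r e) = h r (ev y h e)"
| "ev y h (Inp e) = sym y (ev y h e)"
| "ev y h (Pl a b) = ev y h a + ev y h b"
| "ev y h (Mi a b) = ev y h a - ev y h b"
| "ev y h (Ti a b) = ev y h a * ev y h b"
| "ev y h (Dv a b) = ev y h a div ev y h b"

text \<open>A weight bounds register codes, the number of temporary cells and the degree in \<open>B0\<close> of values.\<close>

fun wt :: "exp \<Rightarrow> nat" where
  "wt (K c) = c + 1"
| "wt (Rd r e) = prod_encode r + wt e + 2"
| "wt (Inp e) = wt e + 1"
| "wt (Pl a b) = wt a + wt b + 1"
| "wt (Mi a b) = wt a + wt b + 1"
| "wt (Ti a b) = wt a + wt b + 1"
| "wt (Dv a b) = wt a + wt b + 1"

fun wtc :: "cmd \<Rightarrow> nat" where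
  "wtc Nop = 0"
| "wtc (Asg r i e) = prod_encode r + wt i + wt e"
| "wtc (Read r) = prod_encode r"
| "wtc (Then a b) = wtc a + wtc b"
| "wtc (Cond e a b) = wt e + wtc a + wtc b"
| "wtc (For r e a) = prod_encode r + wt e + wtc a + 1"

text \<open>Valid for programs all of whose loops are executed at most \<open>Z\<close> times.\<close>

fun tb :: "nat \<Rightarrow> prog \<Rightarrow> nat" where
  "tb Z Skip = 1"
| "tb Z (Instr i) = 1"
| "tb Z (Seq p q) = tb Z p + tb Z q"
| "tb Z (IfNZ i p q) = tb Z p + tb Z q + 1"
| "tb Z (WhileNZ i p) = Z * (tb Z p + 1) + 1"

fun prog_size :: "prog \<Rightarrow> nat" where
  "prog_size Skip = 1"
| "prog_size (Instr i) = 1"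
| "prog_size (Seq p q) = prog_size p + prog_size q + 1"
| "prog_size (IfNZ i p q) = prog_size p + prog_size q + 1"
| "prog_size (WhileNZ i p) = prog_size p + 1"

text \<open>Two factors \<open>Z + 2\<close> per constructor pay for a sum as well as for the
  iterations of a loop. The exponent depends on the program alone, so the running time is polynomial
  as soon as \<open>Z\<close> is.\<close>

lemma tb_le: "tb Z p \<le> (Z + 2) ^ (2 * prog_size p)"
proof (induction p)
  case (Seq p q)
  let ?b = "Z + 2"
  have "tb Z p + tb Z q \<le> ?b ^ (2 * prog_size p) + ?b ^ (2 * prog_size q)" using Seq by simp
  also have "\<dots> \<le> ?b ^ (2 * (prog_size p + prog_size q)) + ?b ^ (2 * (prog_size p + prog_size q))"
    by (intro add_mono power_increasing) auto
  also have "\<dots> = 2 * ?b ^ (2 * (prog_size p + prog_size q))" by simp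
  also have "\<dots> \<le> ?b ^ 2 * ?b ^ (2 * (prog_size p + prog_size q))"
    by (intro mult_right_mono) (auto simp: power2_eq_square)
  also have "\<dots> = ?b ^ (2 * (prog_size p + prog_size q) + 2)" by (simp only: power_add mult.commute)
  finally show ?case by simp
next
  case (IfNZ i p q)
  let ?b = "Z + 2"
  let ?x = "?b ^ (2 * (prog_size p + prog_size q))"
  have "tb Z p + tb Z q \<le> ?b ^ (2 * prog_size p) + ?b ^ (2 * prog_size q)" using IfNZ by simp
  also have "\<dots> \<le> ?x + ?x"
    by (intro add_mono power_increasing) auto
  finally have "tb Z p + tb Z q \<le> ?x + ?x" .
  moreover have "1 \<le> ?x" by simp
  ultimately have "tb Z p + tb Z q + 1 \<le> ?x + ?x + ?x" by linarith
  also have "\<dots> = 3 * ?x" by simp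
  also have "\<dots> \<le> ?b ^ 2 * ?x"
    by (intro mult_right_mono) (auto simp: power2_eq_square)
  also have "\<dots> = ?b ^ (2 * (prog_size p + prog_size q) + 2)" by (simp only: power_add mult.commute)
  finally show ?case by simp
next
  case (WhileNZ i p)
  let ?b = "Z + 2"
  let ?x = "?b ^ (2 * prog_size p)"
  have x1: "1 \<le> ?x" by simp
  have "Z * (tb Z p + 1) + 1 \<le> Z * (?x + ?x) + ?x" using WhileNZ x1 by (intro add_mono mult_left_mono) auto
  also have "\<dots> = (2 * Z + 1) * ?x" by (simp add: algebra_simps)
  also have "\<dots> \<le> ?b ^ 2 * ?x" by (intro mult_right_mono) (auto simp: power2_eq_square)
  also have "\<dots> = ?b ^ (2 * prog_size p + 2)" by (simp only: power_add mult.commute)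
  finally show ?case by simp
qed auto

locale compiler =
  fixes \<omega> :: nat
begin

text \<open>The arrays of all registers are interleaved, so that none of them needs a size in
  advance. Residues up to \<open>\<omega>\<close> are register codes; the
  \<open>\<omega> + 8\<close> residues above them leave room in the first row for the temporary
  cells.\<close>

definition stride :: nat where "stride = 2 * \<omega> + 9"

text \<open>Temporary cells of the translated expressions; they are zero between commands.\<close>

definition tmp :: "nat \<Rightarrow> nat" where "tmp j = \<omega> + 1 + j"

text \<open>Entry \<open>i\<close> of register \<open>r\<close> lives in cell \<open>i * stride + prod_encode r\<close>.\<close>

definition conc :: "store \<Rightarrow> nat \<Rightarrow> nat" where
  "conc h a = (if a mod stride \<le> \<omega> then h (prod_decode (a mod stride)) (a div stride) else 0)"

definition addr :: "nat \<Rightarrow> reg \<Rightarrow> prog" where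
  "addr \<tau> r = Seq (Instr (Const (tmp (\<tau>+1)) stride))
     (Seq (Instr (Mult (tmp \<tau>) (tmp \<tau>) (tmp (\<tau>+1)))) (Seq (Instr (Const (tmp (\<tau>+1)) (prod_encode r)))
     (Instr (Add (tmp \<tau>) (tmp \<tau>) (tmp (\<tau>+1))))))"

fun cexp :: "exp \<Rightarrow> nat \<Rightarrow> prog" where
  "cexp (K c) \<tau> = Instr (Const (tmp \<tau>) c)"
| "cexp (Rd r e) \<tau> = Seq (cexp e \<tau>) (Seq (addr \<tau> r) (Instr (Load (tmp \<tau>) (tmp \<tau>))))"
| "cexp (Inp e) \<tau> = Seq (cexp e \<tau>) (Instr (Query (tmp \<tau>) (tmp \<tau>)))"
| "cexp (Pl a b) \<tau> = Seq (cexp a \<tau>) (Seq (cexp b (\<tau>+1)) (Instr (Add (tmp \<tau>) (tmp \<tau>) (tmp (\<tau>+1)))))"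
| "cexp (Mi a b) \<tau> = Seq (cexp a \<tau>) (Seq (cexp b (\<tau>+1)) (Instr (Sub (tmp \<tau>) (tmp \<tau>) (tmp (\<tau>+1)))))"
| "cexp (Ti a b) \<tau> = Seq (cexp a \<tau>) (Seq (cexp b (\<tau>+1)) (Instr (Mult (tmp \<tau>) (tmp \<tau>) (tmp (\<tau>+1)))))"
| "cexp (Dv a b) \<tau> = Seq (cexp a \<tau>) (Seq (cexp b (\<tau>+1)) (Instr (Div (tmp \<tau>) (tmp \<tau>) (tmp (\<tau>+1)))))"

fun cleanup :: "nat \<Rightarrow> prog" where
  "cleanup 0 = Skip"
| "cleanup (Suc k) = Seq (cleanup k) (Instr (Const (tmp k) 0))"

abbreviation clean :: prog where "clean \<equiv> cleanup (\<omega> + 8)"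

definition casg :: "reg \<Rightarrow> exp \<Rightarrow> exp \<Rightarrow> prog" where
  "casg r i e = Seq (cexp i 0) (Seq (addr 0 r) (Seq (cexp e 1) (Seq (Instr (Store (tmp 0) (tmp 1))) clean)))"

fun comp :: "cmd \<Rightarrow> prog" where
  "comp Nop = Skip"
| "comp (Asg r i e) = casg r i e"
| "comp (Read r) = Instr (Next (prod_encode r))"
| "comp (Then a b) = Seq (comp a) (comp b)"
| "comp (Cond e a b) = Seq (cexp e 0) (IfNZ (tmp 0) (Seq clean (comp a)) (Seq clean (comp b)))"
| "comp (For r e a) = Seq (casg r (K 0) e) (WhileNZ (prod_encode r)
     (Seq (Instr (Const (tmp 0) 1)) (Seq (Instr (Sub (prod_encode r) (prod_encode r) (tmp 0)))
     (Seq clean (comp a)))))"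

end

section \<open>Correctness, time and space of the translation\<close>

locale machine = compiler \<omega> for \<omega> :: nat +
  fixes y :: "bool list" and Al B0 :: nat
  assumes Al: "1 \<le> Al" and B0: "2 * \<omega> + 10 \<le> B0"
begin

text \<open>Bounds on the addresses and on the contents of the cells, temporary cells included.\<close>

definition AA :: nat where "AA = stride * Al"
definition BB :: nat where "BB = B0 ^ (\<omega> + 3) + 1"
definition SP :: nat where "SP = AA * (floorlog 2 AA + floorlog 2 BB)"

definition bounded :: "(nat \<Rightarrow> nat) \<Rightarrow> bool" where
  "bounded M \<longleftrightarrow> (\<forall>a. M a \<noteq> 0 \<longrightarrow> a < AA \<and> M a < BB)"

lemma space_le: assumes "bounded M" shows "space_of (xs, M) \<le> SP"
proof -
  have "{i. M i \<noteq> 0} \<subseteq> {..<AA}" using assms by (auto simp: bounded_def)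
  have "space_of (xs, M) = (\<Sum>i | M i \<noteq> 0. floorlog 2 i + floorlog 2 (M i))" by (simp add: space_of_def)
  also have "\<dots> \<le> (\<Sum>i | M i \<noteq> 0. floorlog 2 AA + floorlog 2 BB)"
    using assms by (intro sum_mono add_mono floorlog_mono) (auto simp: bounded_def less_imp_le)
  also have "\<dots> = card {i. M i \<noteq> 0} * (floorlog 2 AA + floorlog 2 BB)" by simp
  also have "\<dots> \<le> SP" unfolding SP_def
    using card_mono[OF _ \<open>{i. M i \<noteq> 0} \<subseteq> {..<AA}\<close>] by (intro mult_right_mono) auto
  finally show ?thesis .
qed

text \<open>Halting, time and space are bundled so that they compose through \<open>Seq\<close>.
  Configurations on the way are covered by the bound on the maximal space, whence only the last
  memory is required to be \<open>bounded\<close>.\<close>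

definition rex :: "prog \<Rightarrow> config \<Rightarrow> config \<Rightarrow> bool" where
  "rex p s s' \<longleftrightarrow> bounded (snd s') \<and> (\<exists>t m. exec y p s t m s' \<and> t \<le> tb B0 p \<and> m \<le> SP)"

lemma rex_instr:
  assumes "bounded (snd s)" "step y i s = s'" "bounded (snd s')"
  shows "rex (Instr i) s s'"
  unfolding rex_def using assms exec.Instr[of y i s]
  by (metis max.bounded_iff order_refl space_le surjective_pairing tb.simps(2))

lemma rex_skip: "bounded (snd s) \<Longrightarrow> rex Skip s s"
  unfolding rex_def using exec.Skip[of y s] by (metis order_refl space_le surjective_pairing tb.simps(1))

lemma rex_seq: "rex p s s' \<Longrightarrow> rex q s' s'' \<Longrightarrow> rex (Seq p q) s s''"
  unfolding rex_def
  by (force intro: exec.Seq add_mono)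

lemma rex_if:
  "rex (if snd s i \<noteq> 0 then p else q) s s' \<Longrightarrow> rex (IfNZ i p q) s s'"
  unfolding rex_def
  by (fastforce intro: exec.IfTrue exec.IfFalse split: if_splits)

lemma bounded_upd: "bounded M \<Longrightarrow> a < AA \<Longrightarrow> v < BB \<Longrightarrow> bounded (M(a := v))"
  by (auto simp: bounded_def)

lemma stride_le_AA: "stride \<le> AA"
  using Al by (simp add: AA_def)

lemma tmp_lt: "j < \<omega> + 8 \<Longrightarrow> tmp j < AA"
  using stride_le_AA by (simp add: tmp_def stride_def)

definition agr :: "store \<Rightarrow> (nat \<Rightarrow> nat) \<Rightarrow> bool" where
  "agr h M \<longleftrightarrow> (\<forall>a. \<not> (\<omega> < a \<and> a < stride) \<longrightarrow> M a = conc h a)"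

text \<open>This invariant is the whole space analysis: it suffices to bound the array indices in
  use and the values stored.\<close>

definition ok :: "store \<Rightarrow> bool" where
  "ok h \<longleftrightarrow> (\<forall>r i. h r i \<noteq> 0 \<longrightarrow> i < Al \<and> h r i < B0)"

lemma ok_lt: "ok h \<Longrightarrow> h r i < B0"
  using B0 by (cases "h r i = 0") (simp, metis ok_def)

lemma tmp_inj [simp]: "tmp i = tmp j \<longleftrightarrow> i = j"
  by (simp add: tmp_def)

lemma agr_tmp: "agr h M \<Longrightarrow> j < \<omega> + 8 \<Longrightarrow> agr h (M(tmp j := v))"
  by (auto simp: agr_def tmp_def stride_def)

text \<open>The exponent in \<open>BB\<close> is reached by addresses: an index has degree at most
  \<open>\<omega> + 1\<close>, and the factor \<open>stride\<close> and the added register code cost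
  one power of \<open>B0\<close> each.\<close>

lemma pow_lt_BB: "w \<le> \<omega> + 3 \<Longrightarrow> v \<le> B0 ^ w \<Longrightarrow> v < BB"
  using B0 power_increasing[of w "\<omega> + 3" B0] unfolding BB_def by linarith

lemma le_B0_lt_BB: "v \<le> B0 \<Longrightarrow> v < BB"
  using pow_lt_BB[of 1 v] by simp

lemma stride_le_B0: "stride \<le> B0"
  using B0 by (simp add: stride_def)

lemma ev_le: assumes "ok h" shows "ev y h e \<le> B0 ^ wt e"
proof (induction e)
  have b: "2 \<le> B0" using B0 by simp
  have one: "1 \<le> B0 ^ w" for w using b by simp
  { case (K c)
    have "c + 1 \<le> 2 ^ (c + 1)" using less_exp[of "c + 1"] by (rule less_imp_le)
    also have "\<dots> \<le> B0 ^ (c + 1)" using b by (rule power_mono) simp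
    finally show ?case by simp
  next
    case (Rd r e)
    have "h r (ev y h e) \<le> B0 ^ 1" using ok_lt[OF assms, of r] by (simp add: less_imp_le)
    also have "\<dots> \<le> B0 ^ wt (Rd r e)" using b by (intro power_increasing) auto
    finally show ?case by simp
  next
    case (Inp e)
    have "ev y h (Inp e) \<le> B0 ^ 1" using b by simp
    also have "\<dots> \<le> B0 ^ wt (Inp e)" using b by (intro power_increasing) auto
    finally show ?case by simp
  next
    case (Pl e f)
    have "ev y h (Pl e f) \<le> B0 ^ wt e + B0 ^ wt f" using Pl by simp
    also have "\<dots> \<le> B0 ^ (wt e + wt f) + B0 ^ (wt e + wt f)"
      using b by (intro add_mono power_increasing) auto
    also have "\<dots> = 2 * B0 ^ (wt e + wt f)" by simp
    also have "\<dots> \<le> B0 * B0 ^ (wt e + wt f)" by (rule mult_right_mono[OF b]) simp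
    finally show ?case by simp
  next
    case (Mi e f)
    have "ev y h (Mi e f) \<le> B0 ^ wt e" using Mi by simp
    also have "\<dots> \<le> B0 ^ wt (Mi e f)" using b by (intro power_increasing) auto
    finally show ?case .
  next
    case (Ti e f)
    have "ev y h (Ti e f) \<le> B0 ^ wt e * B0 ^ wt f" using Ti by (simp add: mult_le_mono)
    also have "\<dots> = B0 ^ (wt e + wt f)" by (simp add: power_add)
    also have "\<dots> \<le> B0 ^ wt (Ti e f)" using b by (intro power_increasing) auto
    finally show ?case .
  next
    case (Dv e f)
    have "ev y h (Dv e f) \<le> B0 ^ wt e" using Dv div_le_dividend le_trans by (metis ev.simps(7))
    also have "\<dots> \<le> B0 ^ wt (Dv e f)" using b by (intro power_increasing) auto
    finally show ?case . }
qed

lemma conc_addr: "prod_encode r \<le> \<omega> \<Longrightarrow> conc h (i * stride + prod_encode r) = h r i"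
  by (simp add: conc_def stride_def)

lemma addr_not_tmp: "prod_encode r \<le> \<omega> \<Longrightarrow> \<not> (\<omega> < i * stride + prod_encode r \<and> i * stride + prod_encode r < stride)"
  by (cases i) auto

lemma wt_pos: "1 \<le> wt e"
  by (induction e) auto

lemma rex_tmp:
  assumes "bounded M" "agr h M" "\<tau> < \<omega> + 8" "step y i (xs, M) = (xs, M(tmp \<tau> := v))" "v < BB"
  shows "rex (Instr i) (xs, M) (xs, M(tmp \<tau> := v)) \<and> agr h (M(tmp \<tau> := v)) \<and> bounded (M(tmp \<tau> := v))"
  using assms bounded_upd[OF assms(1) tmp_lt[OF assms(3)] assms(5)]
  by (auto intro!: rex_instr agr_tmp)

text \<open>The temporary cells act as a stack: the result goes to cell \<open>\<tau>\<close> and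
  the cells below it are preserved. The weight bounds the height of the stack.\<close>

definition cexp_spec :: "bool list \<Rightarrow> store \<Rightarrow> exp \<Rightarrow> bool" where
  "cexp_spec xs h e \<longleftrightarrow> (\<forall>\<tau> M. \<tau> + wt e \<le> \<omega> + 2 \<longrightarrow> bounded M \<longrightarrow> agr h M \<longrightarrow>
     (\<exists>M'. rex (cexp e \<tau>) (xs, M) (xs, M') \<and> bounded M' \<and> agr h M' \<and> M' (tmp \<tau>) = ev y h e \<and>
       (\<forall>j<\<tau>. M' (tmp j) = M (tmp j))))"

lemma cexp_binop:
  assumes h: "ok h" and e: "cexp_spec xs h e" and f: "cexp_spec xs h f"
    and c: "\<And>\<tau>. cexp g \<tau> = Seq (cexp e \<tau>) (Seq (cexp f (\<tau>+1)) (Instr (instr \<tau>)))"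
    and i: "\<And>\<tau> M. step y (instr \<tau>) (xs, M) = (xs, M(tmp \<tau> := op (M (tmp \<tau>)) (M (tmp (\<tau>+1)))))"
    and g: "ev y h g = op (ev y h e) (ev y h f)" "wt g = wt e + wt f + 1"
  shows "cexp_spec xs h g"
  unfolding cexp_spec_def
proof (intro allI impI)
  fix \<tau> M assume w: "\<tau> + wt g \<le> \<omega> + 2" and M: "bounded M" "agr h M"
  have "\<tau> + wt e \<le> \<omega> + 2" using w g by simp
  with e M obtain M1 where M1: "rex (cexp e \<tau>) (xs, M) (xs, M1)" "bounded M1" "agr h M1"
    "M1 (tmp \<tau>) = ev y h e" "\<forall>j<\<tau>. M1 (tmp j) = M (tmp j)" unfolding cexp_spec_def by metis
  have "\<tau> + 1 + wt f \<le> \<omega> + 2" using w g wt_pos[of e] by simp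
  with f M1 obtain M2 where M2: "rex (cexp f (\<tau>+1)) (xs, M1) (xs, M2)" "bounded M2" "agr h M2"
    "M2 (tmp (\<tau>+1)) = ev y h f" "\<forall>j<\<tau>+1. M2 (tmp j) = M1 (tmp j)" unfolding cexp_spec_def by metis
  let ?M3 = "M2(tmp \<tau> := ev y h g)"
  have "ev y h g < BB" using ev_le[OF h, of g] w by (intro pow_lt_BB[of "wt g"]) auto
  moreover have "step y (instr \<tau>) (xs, M2) = (xs, ?M3)" using i[of \<tau> M2] M1 M2 g(1) by simp
  ultimately have "rex (Instr (instr \<tau>)) (xs, M2) (xs, ?M3) \<and> agr h ?M3 \<and> bounded ?M3"
    using w by (intro rex_tmp M2) auto
  then show "\<exists>M'. rex (cexp g \<tau>) (xs, M) (xs, M') \<and> bounded M' \<and> agr h M' \<and> M' (tmp \<tau>) = ev y h g \<and>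
       (\<forall>j<\<tau>. M' (tmp j) = M (tmp j))"
    unfolding c using M1 M2 by (intro exI[of _ ?M3]) (auto intro: rex_seq)
qed

lemma addr_ok:
  assumes "bounded M" "agr h M" "\<tau> < \<omega> + 7" "M (tmp \<tau>) = v" "v \<le> B0 ^ w" "w \<le> \<omega> + 1"
    "prod_encode r \<le> \<omega>"
  shows "\<exists>M'. rex (addr \<tau> r) (xs, M) (xs, M') \<and> bounded M' \<and> agr h M' \<and>
    M' (tmp \<tau>) = v * stride + prod_encode r \<and> (\<forall>j<\<tau>. M' (tmp j) = M (tmp j))"
proof -
  let ?M1 = "M(tmp (\<tau>+1) := stride)"
  let ?M2 = "?M1(tmp \<tau> := v * stride)"
  let ?M3 = "?M2(tmp (\<tau>+1) := prod_encode r)"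
  let ?M4 = "?M3(tmp \<tau> := v * stride + prod_encode r)"
  have "v * stride \<le> B0 ^ w * B0" using assms(5) stride_le_B0 by (rule mult_le_mono)
  then have vs: "v * stride \<le> B0 ^ (w + 1)" by (simp add: mult.commute)
  then have b1: "v * stride < BB" using assms(6) by (intro pow_lt_BB[of "w + 1"]) auto
  have "v * stride + prod_encode r \<le> B0 ^ (w + 1) + \<omega>" using vs assms(7) by simp
  also have "\<dots> \<le> B0 ^ (w + 1) + B0 ^ (w + 1)"
    using B0 self_le_power[of B0 "w + 1"] by linarith
  also have "\<dots> = 2 * B0 ^ (w + 1)" by simp
  also have "\<dots> \<le> B0 * B0 ^ (w + 1)" using B0 by (intro mult_right_mono) auto
  also have "\<dots> = B0 ^ (w + 2)" by simp
  finally have b2: "v * stride + prod_encode r < BB" using assms(6) by (intro pow_lt_BB[of "w + 2"]) auto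
  have 1: "rex (Instr (Const (tmp (\<tau>+1)) stride)) (xs, M) (xs, ?M1) \<and> agr h ?M1 \<and> bounded ?M1"
    using assms le_B0_lt_BB[OF stride_le_B0] by (intro rex_tmp) auto
  have 2: "rex (Instr (Mult (tmp \<tau>) (tmp \<tau>) (tmp (\<tau>+1)))) (xs, ?M1) (xs, ?M2) \<and> agr h ?M2 \<and> bounded ?M2"
    using assms 1 b1 by (intro rex_tmp) auto
  have "prod_encode r < BB" using assms(7) B0 by (intro le_B0_lt_BB) auto
  then have 3: "rex (Instr (Const (tmp (\<tau>+1)) (prod_encode r))) (xs, ?M2) (xs, ?M3) \<and> agr h ?M3 \<and> bounded ?M3"
    using assms 2 by (intro rex_tmp) auto
  have 4: "rex (Instr (Add (tmp \<tau>) (tmp \<tau>) (tmp (\<tau>+1)))) (xs, ?M3) (xs, ?M4) \<and> agr h ?M4 \<and> bounded ?M4"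
    using assms 3 b2 by (intro rex_tmp) auto
  have "rex (addr \<tau> r) (xs, M) (xs, ?M4)" unfolding addr_def using 1 2 3 4 by (intro rex_seq) blast+
  then show ?thesis using 4 by (intro exI[of _ ?M4]) auto
qed

lemma cexp_ok: assumes "ok h" shows "cexp_spec xs h e"
proof (induction e)
  case (K c)
  show ?case unfolding cexp_spec_def
  proof (intro allI impI)
    fix \<tau> M assume M: "\<tau> + wt (K c) \<le> \<omega> + 2" "bounded M" "agr h M"
    have "c \<le> B0" using M B0 by simp
    then have "rex (Instr (Const (tmp \<tau>) c)) (xs, M) (xs, M(tmp \<tau> := c)) \<and> agr h (M(tmp \<tau> := c)) \<and> bounded (M(tmp \<tau> := c))"
      using M by (intro rex_tmp le_B0_lt_BB) auto
    then show "\<exists>M'. rex (cexp (K c) \<tau>) (xs, M) (xs, M') \<and> bounded M' \<and> agr h M' \<and>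
      M' (tmp \<tau>) = ev y h (K c) \<and> (\<forall>j<\<tau>. M' (tmp j) = M (tmp j))"
      by (intro exI[of _ "M(tmp \<tau> := c)"]) auto
  qed
next
  case (Rd r e)
  show ?case unfolding cexp_spec_def
  proof (intro allI impI)
    fix \<tau> M assume w: "\<tau> + wt (Rd r e) \<le> \<omega> + 2" and M: "bounded M" "agr h M"
    have "\<tau> + wt e \<le> \<omega> + 2" using w by simp
    with Rd M obtain M1 where M1: "rex (cexp e \<tau>) (xs, M) (xs, M1)" "bounded M1" "agr h M1"
      "M1 (tmp \<tau>) = ev y h e" "\<forall>j<\<tau>. M1 (tmp j) = M (tmp j)" unfolding cexp_spec_def by metis
    have r: "prod_encode r \<le> \<omega>" using w by simp
    obtain M2 where M2: "rex (addr \<tau> r) (xs, M1) (xs, M2)" "bounded M2" "agr h M2"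
      "M2 (tmp \<tau>) = ev y h e * stride + prod_encode r" "\<forall>j<\<tau>. M2 (tmp j) = M1 (tmp j)"
      using addr_ok[OF M1(2,3) _ M1(4) ev_le[OF assms] _ r] w by auto
    let ?v = "h r (ev y h e)"
    have "M2 (M2 (tmp \<tau>)) = ?v"
      using M2(3,4) addr_not_tmp[OF r] conc_addr[OF r, of h] by (simp add: agr_def)
    moreover have "?v < BB" using ok_lt[OF assms, of r] by (intro le_B0_lt_BB) (simp add: less_imp_le)
    ultimately have "rex (Instr (Load (tmp \<tau>) (tmp \<tau>))) (xs, M2) (xs, M2(tmp \<tau> := ?v)) \<and>
      agr h (M2(tmp \<tau> := ?v)) \<and> bounded (M2(tmp \<tau> := ?v))"
      using M2 w by (intro rex_tmp) auto
    then show "\<exists>M'. rex (cexp (Rd r e) \<tau>) (xs, M) (xs, M') \<and> bounded M' \<and> agr h M' \<and>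
      M' (tmp \<tau>) = ev y h (Rd r e) \<and> (\<forall>j<\<tau>. M' (tmp j) = M (tmp j))"
      using M1 M2 by (intro exI[of _ "M2(tmp \<tau> := ?v)"]) (auto intro!: rex_seq)
  qed
next
  case (Inp e)
  show ?case unfolding cexp_spec_def
  proof (intro allI impI)
    fix \<tau> M assume w: "\<tau> + wt (Inp e) \<le> \<omega> + 2" and M: "bounded M" "agr h M"
    have "\<tau> + wt e \<le> \<omega> + 2" using w by simp
    with Inp M obtain M1 where M1: "rex (cexp e \<tau>) (xs, M) (xs, M1)" "bounded M1" "agr h M1"
      "M1 (tmp \<tau>) = ev y h e" "\<forall>j<\<tau>. M1 (tmp j) = M (tmp j)" unfolding cexp_spec_def by metis
    let ?v = "sym y (ev y h e)"
    have "?v < BB" using B0 by (intro le_B0_lt_BB) simp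
    then have "rex (Instr (Query (tmp \<tau>) (tmp \<tau>))) (xs, M1) (xs, M1(tmp \<tau> := ?v)) \<and>
      agr h (M1(tmp \<tau> := ?v)) \<and> bounded (M1(tmp \<tau> := ?v))"
      using M1 w by (intro rex_tmp) auto
    then show "\<exists>M'. rex (cexp (Inp e) \<tau>) (xs, M) (xs, M') \<and> bounded M' \<and> agr h M' \<and>
      M' (tmp \<tau>) = ev y h (Inp e) \<and> (\<forall>j<\<tau>. M' (tmp j) = M (tmp j))"
      using M1 by (intro exI[of _ "M1(tmp \<tau> := ?v)"]) (auto intro!: rex_seq)
  qed
next
  case (Pl e f)
  show ?case by (rule cexp_binop[OF assms Pl, where op = "(+)"]) auto
next
  case (Mi e f)
  show ?case by (rule cexp_binop[OF assms Mi, where op = "(-)"]) auto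
next
  case (Ti e f)
  show ?case by (rule cexp_binop[OF assms Ti, where op = "(*)"]) auto
next
  case (Dv e f)
  show ?case by (rule cexp_binop[OF assms Dv, where op = "(div)"]) auto
qed

lemma bounded_conc: assumes "ok h" shows "bounded (conc h)"
  unfolding bounded_def
proof (intro allI impI)
  fix a assume a: "conc h a \<noteq> 0"
  then have *: "conc h a = h (prod_decode (a mod stride)) (a div stride)"
    by (auto simp: conc_def split: if_splits)
  with a assms have "a div stride < Al" unfolding ok_def by metis
  then have "a < AA" unfolding AA_def by (simp add: div_less_iff_less_mult stride_def mult.commute)
  moreover have "conc h a < BB" using * ok_lt[OF assms] le_B0_lt_BB by (simp add: less_imp_le)
  ultimately show "a < AA \<and> conc h a < BB" by simp
qed

lemma agr_conc: "agr h (conc h)"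
  by (simp add: agr_def)

lemma cexp_0:
  assumes h: "ok h" and w: "wt e \<le> \<omega>"
  obtains M where "rex (cexp e 0) (xs, conc h) (xs, M)" "bounded M" "agr h M" "M (tmp 0) = ev y h e"
proof -
  have "0 + wt e \<le> \<omega> + 2" using w by simp
  then show ?thesis
    using cexp_ok[OF h, of xs e] bounded_conc[OF h] agr_conc[of h] that unfolding cexp_spec_def by blast
qed

lemma cleanup_ok:
  assumes "bounded M" "agr h M" "k \<le> \<omega> + 8"
  shows "\<exists>M'. rex (cleanup k) (xs, M) (xs, M') \<and> bounded M' \<and> agr h M' \<and> (\<forall>j<k. M' (tmp j) = 0)"
  using assms(3)
proof (induction k)
  case 0
  then show ?case using rex_skip[of "(xs, M)"] assms by auto
next
  case (Suc k)
  then obtain M' where M': "rex (cleanup k) (xs, M) (xs, M')" "bounded M'" "agr h M'" "\<forall>j<k. M' (tmp j) = 0"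
    by auto
  have "rex (Instr (Const (tmp k) 0)) (xs, M') (xs, M'(tmp k := 0)) \<and> agr h (M'(tmp k := 0)) \<and> bounded (M'(tmp k := 0))"
    using M' Suc.prems by (intro rex_tmp) (auto simp: BB_def)
  moreover have "\<forall>j<Suc k. (M'(tmp k := 0)) (tmp j) = 0" using M'(4) by (auto simp: less_Suc_eq)
  ultimately show ?case unfolding cleanup.simps using rex_seq[OF M'(1)] by blast
qed

lemma clean_ok:
  assumes "bounded M" "agr h M"
  shows "rex clean (xs, M) (xs, conc h)"
proof -
  obtain M' where M': "rex clean (xs, M) (xs, M')" "agr h M'" "\<forall>j<\<omega>+8. M' (tmp j) = 0"
    using cleanup_ok[OF assms order_refl] by metis
  have "M' a = conc h a" for a
  proof (cases "\<omega> < a \<and> a < stride")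
    case True
    then have "a = tmp (a - \<omega> - 1)" "a - \<omega> - 1 < \<omega> + 8" by (auto simp: tmp_def stride_def)
    then have "M' a = 0" using M'(3) by metis
    then show ?thesis using True by (simp add: conc_def)
  qed (use M'(2) in \<open>auto simp: agr_def\<close>)
  then have "M' = conc h" by auto
  then show ?thesis using M'(1) by simp
qed

abbreviation upd :: "store \<Rightarrow> reg \<Rightarrow> nat \<Rightarrow> nat \<Rightarrow> store" where
  "upd h r i v \<equiv> h(r := (h r)(i := v))"

lemma conc_upd:
  assumes "prod_encode r \<le> \<omega>"
  shows "conc (upd h r i v) = (conc h)(i * stride + prod_encode r := v)"
proof
  fix a
  have lt: "prod_encode r < stride" using assms by (simp add: stride_def)
  have *: "(prod_decode (a mod stride) = r \<and> a div stride = i) = (a = i * stride + prod_encode r)"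
  proof
    assume "prod_decode (a mod stride) = r \<and> a div stride = i"
    then have "a mod stride = prod_encode r" "a div stride = i" by auto
    then show "a = i * stride + prod_encode r" by (metis div_mult_mod_eq)
  qed (use lt in auto)
  show "conc (upd h r i v) a = ((conc h)(i * stride + prod_encode r := v)) a"
  proof (cases "a = i * stride + prod_encode r")
    case True
    then show ?thesis using lt assms by (simp add: conc_def)
  next
    case False
    then show ?thesis using * by (auto simp: conc_def)
  qed
qed

lemma ok_upd: "ok h \<Longrightarrow> i < Al \<Longrightarrow> v < B0 \<Longrightarrow> ok (upd h r i v)"
  by (auto simp: ok_def)

lemma casg_ok:
  assumes h: "ok h" and w: "prod_encode r + wt i + wt e \<le> \<omega>" and i: "ev y h i < Al" and e: "ev y h e < B0"
  shows "rex (casg r i e) (xs, conc h) (xs, conc (upd h r (ev y h i) (ev y h e)))"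
proof -
  have r: "prod_encode r \<le> \<omega>" using w by simp
  obtain M1 where M1: "rex (cexp i 0) (xs, conc h) (xs, M1)" "bounded M1" "agr h M1" "M1 (tmp 0) = ev y h i"
    using cexp_0[OF h, of i xs] w by auto
  have wi: "wt i \<le> \<omega> + 1" using w by simp
  obtain M2 where M2: "rex (addr 0 r) (xs, M1) (xs, M2)" "bounded M2" "agr h M2"
    "M2 (tmp 0) = ev y h i * stride + prod_encode r"
    using addr_ok[OF M1(2,3) _ M1(4) ev_le[OF h] wi r] by auto
  have "1 + wt e \<le> \<omega> + 2" using w by simp
  then obtain M3 where M3: "rex (cexp e 1) (xs, M2) (xs, M3)" "bounded M3" "agr h M3"
    "M3 (tmp 1) = ev y h e" "M3 (tmp 0) = M2 (tmp 0)"
    using cexp_ok[OF h, of xs e] M2 unfolding cexp_spec_def by (metis zero_less_one)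
  let ?a = "ev y h i * stride + prod_encode r"
  let ?M4 = "M3(?a := ev y h e)"
  let ?h = "upd h r (ev y h i) (ev y h e)"
  have "?a < AA"
  proof -
    have "?a < (ev y h i + 1) * stride" using r by (simp add: stride_def)
    also have "\<dots> \<le> Al * stride" using i by (intro mult_right_mono) auto
    finally show ?thesis by (simp add: AA_def mult.commute)
  qed
  moreover have "ev y h e < BB" using e by (intro le_B0_lt_BB) simp
  ultimately have b4: "bounded ?M4" using M3(2) by (intro bounded_upd)
  then have 4: "rex (Instr (Store (tmp 0) (tmp 1))) (xs, M3) (xs, ?M4)"
    using M2 M3 by (intro rex_instr) auto
  have "agr ?h ?M4"
    using M3(3) conc_upd[OF r, of h "ev y h i" "ev y h e"] by (auto simp: agr_def)
  from clean_ok[OF b4 this] show ?thesis unfolding casg_def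
    using M1(1) M2(1) M3(1) 4 by (blast intro: rex_seq)
qed

text \<open>As execution is deterministic, the existence of one run means total correctness. Having
  \<open>ok\<close> and the bound on the weight as premises keeps both out of the rules, and lets
  each rule assume that values read from registers are small.\<close>

definition wp :: "cmd \<Rightarrow> (state \<Rightarrow> bool) \<Rightarrow> state \<Rightarrow> bool" where
  "wp c Q s \<longleftrightarrow> (wtc c \<le> \<omega> \<longrightarrow> ok (snd s) \<longrightarrow>
     (\<exists>xs h. rex (comp c) (fst s, conc (snd s)) (xs, conc h) \<and> ok h \<and> Q (xs, h)))"

lemma wp_Nop: "Q s \<Longrightarrow> wp Nop Q s"
  unfolding wp_def using rex_skip bounded_conc by (cases s) fastforce

lemma wp_mono: "wp c Q s \<Longrightarrow> (\<And>xs h. ok h \<Longrightarrow> Q (xs, h) \<Longrightarrow> Q' (xs, h)) \<Longrightarrow> wp c Q' s"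
  unfolding wp_def by blast

lemma wp_Asg:
  assumes "ok h \<Longrightarrow> ev y h i < Al" "ok h \<Longrightarrow> ev y h e < B0" "Q (xs, upd h r (ev y h i) (ev y h e))"
  shows "wp (Asg r i e) Q (xs, h)"
  unfolding wp_def
proof (intro impI)
  assume w: "wtc (Asg r i e) \<le> \<omega>" and "ok (snd (xs, h))"
  then have h: "ok h" by simp
  have "rex (comp (Asg r i e)) (xs, conc h) (xs, conc (upd h r (ev y h i) (ev y h e)))"
    using casg_ok[OF h _ assms(1,2)[OF h], of r xs] w by simp
  moreover have "ok (upd h r (ev y h i) (ev y h e))" using ok_upd[OF h assms(1,2)[OF h]] .
  ultimately show "\<exists>xsa ha. rex (comp (Asg r i e)) (fst (xs, h), conc (snd (xs, h))) (xsa, conc ha) \<and> ok ha \<and> Q (xsa, ha)"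
    using assms(3) unfolding fst_conv snd_conv by blast
qed

lemma wp_Read:
  assumes "Q (tl xs, upd h r 0 (case xs of [] \<Rightarrow> 2 | b # _ \<Rightarrow> of_bool b))"
  shows "wp (Read r) Q (xs, h)"
  unfolding wp_def
proof (intro impI)
  let ?h = "upd h r 0 (case xs of [] \<Rightarrow> 2 | b # _ \<Rightarrow> of_bool b)"
  assume w: "wtc (Read r) \<le> \<omega>" and "ok (snd (xs, h))"
  then have h: "ok h" by simp
  then have "ok ?h" using Al B0 by (intro ok_upd) (auto split: list.split)
  moreover have "rex (comp (Read r)) (xs, conc h) (tl xs, conc ?h)"
    using bounded_conc[OF h] bounded_conc[OF \<open>ok ?h\<close>] conc_upd[of r h 0] w by (auto intro: rex_instr)
  ultimately show "\<exists>xsa ha. rex (comp (Read r)) (fst (xs, h), conc (snd (xs, h))) (xsa, conc ha) \<and> ok ha \<and> Q (xsa, ha)"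
    using assms unfolding fst_conv snd_conv by blast
qed

lemma wp_Then: assumes "wp a (\<lambda>s. wp b Q s) s" shows "wp (a \<triangleright> b) Q s"
  unfolding wp_def
proof (intro impI)
  assume w: "wtc (a \<triangleright> b) \<le> \<omega>" and s: "ok (snd s)"
  then obtain xs h where 1: "rex (comp a) (fst s, conc (snd s)) (xs, conc h)" "ok h" "wp b Q (xs, h)"
    using assms unfolding wp_def by auto
  then obtain xs' h' where 2: "rex (comp b) (xs, conc h) (xs', conc h')" "ok h'" "Q (xs', h')"
    using w unfolding wp_def by auto
  show "\<exists>xs h. rex (comp (a \<triangleright> b)) (fst s, conc (snd s)) (xs, conc h) \<and> ok h \<and> Q (xs, h)"
    using 2 rex_seq[OF 1(1) 2(1)] by auto
qed

lemma wp_Cond: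
  assumes "ok h \<Longrightarrow> ev y h e \<noteq> 0 \<Longrightarrow> wp a Q (xs, h)" "ok h \<Longrightarrow> ev y h e = 0 \<Longrightarrow> wp b Q (xs, h)"
  shows "wp (Cond e a b) Q (xs, h)"
  unfolding wp_def
proof (intro impI)
  assume w: "wtc (Cond e a b) \<le> \<omega>" and "ok (snd (xs, h))"
  then have h: "ok h" by simp
  obtain M1 where M1: "rex (cexp e 0) (xs, conc h) (xs, M1)" "bounded M1" "agr h M1" "M1 (tmp 0) = ev y h e"
    using cexp_0[OF h, of e xs] w by auto
  let ?c = "if ev y h e \<noteq> 0 then a else b"
  obtain xs' h' where 2: "rex (comp ?c) (xs, conc h) (xs', conc h')" "ok h'" "Q (xs', h')"
    using assms[OF h] h w unfolding wp_def by (cases "ev y h e = 0") auto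
  have "rex (Seq clean (comp ?c)) (xs, M1) (xs', conc h')"
    using rex_seq[OF clean_ok[OF M1(2,3)] 2(1)] .
  then have "rex (IfNZ (tmp 0) (Seq clean (comp a)) (Seq clean (comp b))) (xs, M1) (xs', conc h')"
    using M1(4) by (intro rex_if) (auto split: if_splits)
  then have "rex (comp (Cond e a b)) (xs, conc h) (xs', conc h')" using M1(1) by (auto intro: rex_seq)
  then show "\<exists>xsa ha. rex (comp (Cond e a b)) (fst (xs, h), conc (snd (xs, h))) (xsa, conc ha) \<and> ok ha \<and> Q (xsa, ha)"
    using 2 unfolding fst_conv snd_conv by blast
qed

text \<open>\<open>Inv i\<close> holds when the counter is \<open>i\<close>, that is, when
  \<open>i\<close> rounds remain. The counter is decremented before the body, which sees the index
  \<open>i\<close> and has to leave it unchanged.\<close>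

lemma wp_For:
  fixes Inv :: "nat \<Rightarrow> state \<Rightarrow> bool"
  assumes b: "ok h0 \<Longrightarrow> ev y h0 e < B0"
    and init: "ok h0 \<Longrightarrow> Inv (ev y h0 e) (xs0, upd h0 r 0 (ev y h0 e))"
    and step: "\<And>i xs h. i < ev y h0 e \<Longrightarrow> ok h \<Longrightarrow> Inv (Suc i) (xs, h) \<Longrightarrow> h r 0 = Suc i \<Longrightarrow>
      wp c (\<lambda>s'. snd s' r 0 = i \<and> Inv i s') (xs, upd h r 0 i)"
    and fin: "\<And>xs h. Inv 0 (xs, h) \<Longrightarrow> h r 0 = 0 \<Longrightarrow> ok h \<Longrightarrow> Q (xs, h)"
  shows "wp (For r e c) Q (xs0, h0)"
  unfolding wp_def
proof (intro impI)
  assume w: "wtc (For r e c) \<le> \<omega>" and "ok (snd (xs0, h0))"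
  then have h0: "ok h0" by simp
  note b = b[OF h0] and init = init[OF h0]
  let ?r = "prod_encode r"
  have r: "?r \<le> \<omega>" and wc: "wtc c \<le> \<omega>" using w by auto
  define body where "body = Seq (Instr (Const (tmp 0) 1)) (Seq (Instr (Sub ?r ?r (tmp 0))) (Seq clean (comp c)))"
  have cr: "conc h ?r = h r 0" for h using conc_addr[OF r, of h 0] by simp
  have loop: "\<exists>xs' h' t m. exec y (WhileNZ ?r body) (xs, conc h) t m (xs', conc h') \<and>
      t \<le> i * (tb B0 body + 1) + 1 \<and> m \<le> SP \<and> ok h' \<and> h' r 0 = 0 \<and> Inv 0 (xs', h')"
    if "ok h" "Inv i (xs, h)" "h r 0 = i" "i \<le> ev y h0 e" for i xs h
    using that
  proof (induction i arbitrary: xs h)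
    case 0
    have "exec y (WhileNZ ?r body) (xs, conc h) 1 (space_of (xs, conc h)) (xs, conc h)"
      by (rule exec.WhileFalse) (simp add: cr 0)
    moreover have "space_of (xs, conc h) \<le> SP" using 0 by (intro space_le bounded_conc)
    ultimately show ?case using 0 by (intro exI[of _ xs] exI[of _ h] exI[of _ 1]
      exI[of _ "space_of (xs, conc h)"]) auto
  next
    case (Suc i)
    let ?h = "upd h r 0 i"
    let ?M1 = "(conc h)(tmp 0 := 1)"
    let ?M2 = "?M1(?r := i)"
    have "1 < BB" using B0 by (intro le_B0_lt_BB) simp
    then have 1: "rex (Instr (Const (tmp 0) 1)) (xs, conc h) (xs, ?M1)" "agr h ?M1" "bounded ?M1"
      using rex_tmp[OF bounded_conc[OF Suc.prems(1)] agr_conc, of 0 "Const (tmp 0) 1" xs 1] by auto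
    have i: "i < B0" using Suc.prems b by simp
    have rAA: "?r < AA" using r stride_le_AA by (simp add: stride_def)
    have b2: "bounded ?M2" using i by (intro bounded_upd[OF 1(3) rAA] le_B0_lt_BB) simp
    have rt: "?r \<noteq> tmp 0" using r by (simp add: tmp_def)
    have 2: "rex (Instr (Sub ?r ?r (tmp 0))) (xs, ?M1) (xs, ?M2)"
      using b2 1(3) Suc.prems(3) rt cr[of h] by (intro rex_instr) auto
    have "agr ?h ?M2" using 1(2) conc_upd[OF r, of h 0 i] unfolding agr_def by auto
    then have 3: "rex clean (xs, ?M2) (xs, conc ?h)" using b2 by (intro clean_ok)
    have "ok ?h" using Suc.prems(1) i Al by (intro ok_upd) auto
    then obtain xs' h' where 4: "rex (comp c) (xs, conc ?h) (xs', conc h')" "ok h'" "h' r 0 = i" "Inv i (xs', h')"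
      using step[of i h xs] Suc.prems wc unfolding wp_def by auto
    have "rex body (xs, conc h) (xs', conc h')" unfolding body_def
      using 1(1) 2 3 4(1) by (blast intro: rex_seq)
    then obtain t m where tm: "exec y body (xs, conc h) t m (xs', conc h')" "t \<le> tb B0 body" "m \<le> SP"
      unfolding rex_def by blast
    obtain xs'' h'' t' m' where L: "exec y (WhileNZ ?r body) (xs', conc h') t' m' (xs'', conc h'')"
      "t' \<le> i * (tb B0 body + 1) + 1" "m' \<le> SP" "ok h''" "h'' r 0 = 0" "Inv 0 (xs'', h'')"
      using Suc.IH[OF 4(2,4,3)] Suc.prems(4) by (metis Suc_leD)
    have "exec y (WhileNZ ?r body) (xs, conc h) (t + t' + 1) (max m m') (xs'', conc h'')"
      using tm(1) L(1) cr Suc.prems(3) by (intro exec.WhileTrue) auto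
    moreover have "t + t' + 1 \<le> Suc i * (tb B0 body + 1) + 1" using tm(2) L(2) by simp
    ultimately show ?case using tm(3) L
      by (intro exI[of _ xs''] exI[of _ h''] exI[of _ "t + t' + 1"] exI[of _ "max m m'"]) auto
  qed
  let ?h = "upd h0 r 0 (ev y h0 e)"
  have "rex (casg r (K 0) e) (xs0, conc h0) (xs0, conc ?h)"
    using casg_ok[OF h0, of r "K 0" e xs0] w b Al by simp
  moreover have "ok ?h" using h0 b Al by (intro ok_upd) auto
  from loop[OF this init] obtain xs' h' t m where
    L: "exec y (WhileNZ ?r body) (xs0, conc ?h) t m (xs', conc h')"
      "t \<le> ev y h0 e * (tb B0 body + 1) + 1" "m \<le> SP" "ok h'" "h' r 0 = 0" "Inv 0 (xs', h')" by auto
  have "t \<le> tb B0 (WhileNZ ?r body)"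
    using L(2) b mult_right_mono[of "ev y h0 e" B0 "tb B0 body + 1"] by simp
  then have "rex (WhileNZ ?r body) (xs0, conc ?h) (xs', conc h')"
    unfolding rex_def using L bounded_conc by auto
  ultimately have "rex (comp (For r e c)) (xs0, conc h0) (xs', conc h')"
    by (auto intro: rex_seq simp: body_def)
  then show "\<exists>xs h. rex (comp (For r e c)) (fst (xs0, h0), conc (snd (xs0, h0))) (xs, conc h) \<and> ok h \<and> Q (xs, h)"
    using L fin by auto
qed

end

section \<open>The program\<close>

declare split_paired_All [simp del] split_paired_Ex [simp del] One_nat_def [simp del]

text \<open>Loops count down, so their invariants speak about final parts of an interval, which grow
  at the left end.\<close>

lemma ex_ge_split: "c < b \<Longrightarrow> (\<exists>z. c \<le> z \<and> z < b \<and> P z) \<longleftrightarrow> P c \<or> (\<exists>z. Suc c \<le> z \<and> z < b \<and> P z)"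
  for b c :: nat
proof -
  assume "c < b"
  have "c \<le> z \<longleftrightarrow> z = c \<or> Suc c \<le> z" for z by auto
  then show ?thesis using \<open>c < b\<close> by auto
qed

abbreviation S :: "reg \<Rightarrow> exp" where "S r \<equiv> Rd r (K 0)"
abbreviation Set :: "reg \<Rightarrow> exp \<Rightarrow> cmd" where "Set r e \<equiv> Asg r (K 0) e"

text \<open>Truncated subtraction expresses minimum, maximum and the test for inequality without
  branching. \<open>ne\<close> yields the absolute difference, which is exclusive or on bits and
  also serves as a distance.\<close>

definition mn :: "exp \<Rightarrow> exp \<Rightarrow> exp" where "mn a b = Mi a (Mi a b)"
definition mx :: "exp \<Rightarrow> exp \<Rightarrow> exp" where "mx a b = Pl a (Mi b a)"
definition ne :: "exp \<Rightarrow> exp \<Rightarrow> exp" where "ne a b = Pl (Mi a b) (Mi b a)"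

fun pw :: "exp \<Rightarrow> nat \<Rightarrow> exp" where
  "pw e 0 = K 1"
| "pw e (Suc d) = Ti e (pw e d)"

lemma ev_mn [simp]: "ev y h (mn a b) = min (ev y h a) (ev y h b)"
  and ev_mx [simp]: "ev y h (mx a b) = max (ev y h a) (ev y h b)"
  and ev_ne: "ev y h (ne a b) = (ev y h a - ev y h b) + (ev y h b - ev y h a)"
  and ev_pw [simp]: "ev y h (pw a d) = ev y h a ^ d"
     apply (simp_all add: mn_def mx_def ne_def)
  by (induction d) simp_all

lemma ev_ne_0 [simp]: "(ev y h (ne a b) = 0) = (ev y h a = ev y h b)"
  by (auto simp: ev_ne)

text \<open>
  Global registers: \<open>rn\<close> the length and finally the output, \<open>rm\<close> the number of minority symbols of
  \<open>y\<close>, \<open>rf\<close> whether the symbols are exchanged, \<open>rk\<close> the branching, \<open>roff\<close> the start in \<open>y\<close> of the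
  current block, \<open>rcnt\<close> the symbols of the block read so far, \<open>rE\<close> the accumulated error, \<open>rptr\<close> and
  \<open>rres\<close> the results of \<open>NODE\<close> and of a comparison, \<open>ru\<close> and \<open>rv\<close> the zeros and ones of the stream,
  \<open>rs\<close> and \<open>rw\<close> those of a prefix of \<open>y\<close>, \<open>rG\<close> whether a gainful cut was found, \<open>rL\<close> the error of the
  left block. Row \<open>l + 2\<close> belongs to level \<open>l + 1\<close> of the recursion; \<open>(l + 2, 4)\<close> holds the pointers to
  the pieces in reverse order.
\<close>

abbreviation "rn \<equiv> (0, 0) :: reg"
abbreviation "rm \<equiv> (0, 1) :: reg"
abbreviation "rf \<equiv> (0, 2) :: reg"
abbreviation "rk \<equiv> (0, 3) :: reg"
abbreviation "roff \<equiv> (0, 4) :: reg"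
abbreviation "rcnt \<equiv> (0, 5) :: reg"
abbreviation "rE \<equiv> (0, 6) :: reg"
abbreviation "rptr \<equiv> (0, 7) :: reg"
abbreviation "rres \<equiv> (0, 8) :: reg"
abbreviation "rb \<equiv> (0, 9) :: reg"
abbreviation "rsy \<equiv> (0, 10) :: reg"
abbreviation "rer \<equiv> (0, 11) :: reg"
abbreviation "ru \<equiv> (0, 12) :: reg"
abbreviation "rv \<equiv> (0, 13) :: reg"
abbreviation "rG \<equiv> (0, 14) :: reg"
abbreviation "rs \<equiv> (0, 15) :: reg"
abbreviation "rw \<equiv> (0, 16) :: reg"
abbreviation "rj \<equiv> (0, 17) :: reg"
abbreviation "rq \<equiv> (0, 18) :: reg"
abbreviation "ri \<equiv> (0, 19) :: reg"
abbreviation "rL \<equiv> (0, 20) :: reg"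
abbreviation "rt \<equiv> (0, 21) :: reg"

text \<open>Beyond position \<open>m\<close> the index is pushed past the end of \<open>y\<close>, where the input delivers the padding symbol 2.\<close>

definition Yo :: "exp \<Rightarrow> exp" where
  "Yo e = Inp (Pl (S roff) (Pl e (Ti (Mi (K 1) (Mi (S rm) e)) (S rn))))"

text \<open>The row \<open>(L, 5)\<close> of the dynamic program is updated in place from the right, because its new
  entry at \<open>t\<close> depends only on the old entries up to \<open>t\<close>.\<close>

definition CMP :: "nat \<Rightarrow> cmd \<Rightarrow> nat \<Rightarrow> cmd" where
  "CMP C A l = (let L = l + 2; T = Ti (S rk) (K C);
      gr = (\<lambda>t. Pl (S (L, 1)) (Dv (Ti (Mi (S (L, 2)) (S (L, 1))) t) T));
      cand = Pl (Rd (L, 5) (S (L, 8))) (S rres) in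
    For (L, 6) (Pl T (K 1)) (Asg (L, 5) (S (L, 6)) (K 0)) \<triangleright>
    For (L, 6) (S rk) (
      For (L, 7) (Pl T (K 1)) (
        Set (L, 9) (K 0) \<triangleright>
        For (L, 8) (Pl (S (L, 7)) (K 1)) (
          Set (l + 1, 0) (Rd (L, 4) (S (L, 6))) \<triangleright>
          Set (l + 1, 1) (gr (S (L, 8))) \<triangleright>
          Set (l + 1, 2) (gr (S (L, 7))) \<triangleright>
          A \<triangleright>
          Set (L, 9) (mx (S (L, 9)) cand)) \<triangleright>
        Asg (L, 5) (S (L, 7)) (S (L, 9)))) \<triangleright>
    Set rres (Rd (L, 5) T))"

text \<open>The recursion is unrolled while the program is generated: level \<open>l\<close>
  contains a copy of the code of all lower levels, each with registers of its own, so that no call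
  stack is needed.\<close>

fun AC :: "nat \<Rightarrow> nat \<Rightarrow> cmd" where
  "AC C 0 = Set rres (K 0) \<triangleright>
     For (1, 3) (Mi (S (1, 2)) (S (1, 1)))
       (Cond (ne (Yo (Pl (S (1, 1)) (S (1, 3)))) (Yo (S (1, 0)))) Nop (Set rres (K 1)))"
| "AC C (Suc l) = For (l + 2, 3) (S rk)
       (Asg (l + 2, 4) (S (l + 2, 3)) (S (l + 2, 0)) \<triangleright> Set (l + 2, 0) (Pl (S (l + 2, 0)) (pw (S rk) l))) \<triangleright>
     CMP C (AC C l) l"

section \<open>Frame conditions and correctness of the comparison\<close>

definition mods :: "store \<Rightarrow> store \<Rightarrow> reg set \<Rightarrow> bool" where
  "mods h h' R \<longleftrightarrow> (\<forall>r. r \<notin> R \<longrightarrow> h' r = h r)"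

lemma mods_refl [simp]: "mods h h R"
  by (simp add: mods_def)

lemma modsD: "mods h h' R \<Longrightarrow> r \<notin> R \<Longrightarrow> h' r = h r"
  by (simp add: mods_def)

lemma mods_upd: "mods h h' R \<Longrightarrow> r \<in> R \<Longrightarrow> mods h (h'(r := v)) R"
  by (simp add: mods_def)

lemma mods_trans: "mods h h' R \<Longrightarrow> mods h' h'' R' \<Longrightarrow> R' \<subseteq> R \<Longrightarrow> mods h h'' R"
  by (auto simp: mods_def subset_iff)

definition RA :: "nat \<Rightarrow> reg set" where "RA l = {r. 1 \<le> fst r \<and> fst r \<le> l + 1} \<union> {rres}"
text \<open>In row \<open>l + 2\<close>, columns below 5 are the input of the comparison and must
  survive its loops; columns from 10 on hold the state of \<open>NODE\<close> across
  comparisons.\<close>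

definition RC :: "nat \<Rightarrow> reg set" where "RC l = RA l \<union> {(l + 2, c) | c. 5 \<le> c \<and> c \<le> 9}"

context machine
begin

lemma wp_Set:
  "(ok h \<Longrightarrow> ev y h e < B0) \<Longrightarrow> Q (xs, upd h r 0 (ev y h e)) \<Longrightarrow> wp (Set r e) Q (xs, h)"
  using Al by (intro wp_Asg) auto

end

text \<open>Entries of the dynamic program never exceed the length of the interval, so they fit into
  registers.\<close>

lemma dpv_le:
  assumes "\<And>p a b. a \<le> b \<Longrightarrow> f p a b \<le> b - a" "\<And>s t. s \<le> t \<Longrightarrow> g s \<le> g t"
  shows "dpv f P g j t \<le> g t - g 0"
proof (induction j arbitrary: t)
  case (Suc j)
  have "dpv f P g j s + f (P j) (g s) (g t) \<le> g t - g 0" if "s \<le> t" for s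
    using Suc[of s] assms(1)[OF assms(2)[OF that], of "P j"] assms(2)[OF that] assms(2)[of 0 s] by simp
  then show ?case by (subst dpv.simps(2), subst Max_le_iff) auto
qed simp

locale params = machine \<omega> y Al B0 for \<omega> y Al B0 +
  fixes n m k D C N :: nat
  assumes k: "1 \<le> k" and C: "1 \<le> C" and D: "1 \<le> D" and N: "N = k ^ D" and n: "length y = n"
    and Al_gt: "k * C < Al" and B0_gt: "4 * (D + 2) * N + 2 * n + k * C + 10 < B0" and mn: "m \<le> n"
begin

definition Yf :: "nat \<Rightarrow> nat \<Rightarrow> nat" where "Yf off p = (if p < m then sym y (off + p) else 2)"

definition stat :: "nat \<Rightarrow> store \<Rightarrow> bool" where
  "stat off h \<longleftrightarrow> h rn 0 = n \<and> h rm 0 = m \<and> h rk 0 = k \<and> h roff 0 = off"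

lemma ev_Yo: "stat off h \<Longrightarrow> ev y h (Yo e) = Yf off (ev y h e)"
  unfolding stat_def Yo_def Yf_def using n by simp

lemma stat_mods: "stat off h \<Longrightarrow> mods h h' R \<Longrightarrow> rn \<notin> R \<Longrightarrow> rm \<notin> R \<Longrightarrow> rk \<notin> R \<Longrightarrow> roff \<notin> R \<Longrightarrow> stat off h'"
  by (simp add: stat_def mods_def)

lemma acf_le: "a \<le> b \<Longrightarrow> acf Y k C l p a b \<le> b - a"
  using acf_sound[of k C a b Y l p] lcs_le_right[of "seg Y p (k ^ l)" "map Y [a..<b]"] k C by simp

lemma kl_le: "l \<le> D \<Longrightarrow> k ^ l \<le> N"
  using k by (simp add: N power_increasing)

lemma N4: "4 * N \<le> 4 * (D + 2) * N"
  by simp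

lemma B0_ge: "v \<le> 4 * N + 2 * n + k * C + 10 \<Longrightarrow> v < B0"
  using B0_gt N4 by linarith

text \<open>Positions up to \<open>2 * N\<close> occur, because a pointer is at most
  \<open>N\<close> and the segment starting there has length at most \<open>N\<close>.\<close>

definition AC_spec :: "nat \<Rightarrow> nat \<Rightarrow> bool" where
  "AC_spec off l \<longleftrightarrow> (\<forall>p a b xs h. stat off h \<longrightarrow> h (l + 1, 0) 0 = p \<longrightarrow> h (l + 1, 1) 0 = a \<longrightarrow> h (l + 1, 2) 0 = b \<longrightarrow>
     a \<le> b \<longrightarrow> b \<le> 2 * N \<longrightarrow> p + k ^ l \<le> 2 * N \<longrightarrow>
     wp (AC C l) (\<lambda>(xs', h'). xs' = xs \<and> mods h h' (RA l) \<and> h' rres 0 = acf (Yf off) k C l p a b) (xs, h))"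

lemmas AC_specD = AC_spec_def[THEN iffD1, rule_format]

lemma AC_0: "AC_spec off 0"
  unfolding AC_spec_def AC.simps
proof (intro allI impI)
  fix p a b xs h
  assume st: "stat off h" and h: "h (0 + 1, 0) 0 = p" "h (0 + 1, 1) 0 = a" "h (0 + 1, 2) 0 = b"
    and ab: "a \<le> b" "b \<le> 2 * N" "p + k ^ 0 \<le> 2 * N"
  let ?h = "upd h rres 0 0"
  let ?R = "{(1, 3), rres}"
  define Inv :: "nat \<Rightarrow> state \<Rightarrow> bool" where "Inv = (\<lambda>i (xs', h'). xs' = xs \<and> mods ?h h' ?R \<and>
     h' rres 0 = of_bool (\<exists>z. a + i \<le> z \<and> z < b \<and> Yf off z = Yf off p))"
  show "wp (Set rres (K 0) \<triangleright> For (1, 3) (Mi (S (1, 2)) (S (1, 1)))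
       (Cond (ne (Yo (Pl (S (1, 1)) (S (1, 3)))) (Yo (S (1, 0)))) Nop (Set rres (K 1))))
     (\<lambda>(xs', h'). xs' = xs \<and> mods h h' (RA 0) \<and> h' rres 0 = acf (Yf off) k C 0 p a b) (xs, h)"
  proof (rule wp_Then, rule wp_Set)
    show "ev y h (K 0) < B0" using B0 by simp
    have e: "ev y ?h (Mi (S (1, 2)) (S (1, 1))) = b - a" using h by simp
    have "wp (For (1, 3) (Mi (S (1, 2)) (S (1, 1)))
       (Cond (ne (Yo (Pl (S (1, 1)) (S (1, 3)))) (Yo (S (1, 0)))) Nop (Set rres (K 1))))
     (\<lambda>(xs', h'). xs' = xs \<and> mods h h' (RA 0) \<and> h' rres 0 = acf (Yf off) k C 0 p a b) (xs, ?h)"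
    proof (rule wp_For[where Inv = Inv], goal_cases)
      case 1
      show ?case unfolding e using ab by (intro B0_ge) linarith
    next
      case 2
      show ?case unfolding e using ab by (auto simp: Inv_def mods_def)
    next
      case (3 i xs' h')
      then have I: "xs' = xs" "mods ?h h' ?R" "i < b - a"
        "h' rres 0 = of_bool (\<exists>z. a + Suc i \<le> z \<and> z < b \<and> Yf off z = Yf off p)"
        unfolding e by (auto simp: Inv_def)
      let ?h' = "upd h' (1, 3) 0 i"
      have st': "stat off ?h'" using st I(2) by (auto simp: stat_def mods_def)
      have r: "?h' (1, 0) 0 = p" "?h' (1, 1) 0 = a" "?h' (1, 3) 0 = i"
        using h modsD[OF I(2), of "(1, 0)"] modsD[OF I(2), of "(1, 1)"] by auto
      have ex: "(\<exists>z. a + i \<le> z \<and> z < b \<and> Yf off z = Yf off p) \<longleftrightarrow>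
         Yf off (a + i) = Yf off p \<or> (\<exists>z. a + Suc i \<le> z \<and> z < b \<and> Yf off z = Yf off p)"
        using ex_ge_split[of "a + i" b "\<lambda>z. Yf off z = Yf off p"] I(3) by simp
      show ?case
      proof (rule wp_Cond)
        assume "ev y ?h' (ne (Yo (Pl (S (1, 1)) (S (1, 3)))) (Yo (S (1, 0)))) \<noteq> 0"
        then have "Yf off (a + i) \<noteq> Yf off p" using r by (simp add: ev_Yo[OF st'])
        then show "wp Nop (\<lambda>s'. snd s' (1, 3) 0 = i \<and> Inv i s') (xs', ?h')"
          using I by (intro wp_Nop) (auto simp: Inv_def mods_def ex)
      next
        assume "ev y ?h' (ne (Yo (Pl (S (1, 1)) (S (1, 3)))) (Yo (S (1, 0)))) = 0"
        then have "Yf off (a + i) = Yf off p" using r by (simp add: ev_Yo[OF st'])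
        then show "wp (Set rres (K 1)) (\<lambda>s'. snd s' (1, 3) 0 = i \<and> Inv i s') (xs', ?h')"
          using I B0 by (intro wp_Set) (auto simp: Inv_def mods_def ex)
      qed
    next
      case (4 xs' h')
      then show ?case by (auto simp: Inv_def mods_def RA_def)
    qed
    then show "wp (For (1, 3) (Mi (S (1, 2)) (S (1, 1)))
       (Cond (ne (Yo (Pl (S (1, 1)) (S (1, 3)))) (Yo (S (1, 0)))) Nop (Set rres (K 1))))
     (\<lambda>(xs', h'). xs' = xs \<and> mods h h' (RA 0) \<and> h' rres 0 = acf (Yf off) k C 0 p a b) (xs, upd h rres 0 (ev y h (K 0)))"
      by simp
  qed
qed

text \<open>Piece \<open>j\<close> is stored at index \<open>k - 1 - j\<close>: the loops that fill
  and scan the array count down while the pieces advance.\<close>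

definition CMP_spec :: "nat \<Rightarrow> nat \<Rightarrow> bool" where
  "CMP_spec off l \<longleftrightarrow> (\<forall>P a b xs h. stat off h \<longrightarrow> h (l + 2, 1) 0 = a \<longrightarrow> h (l + 2, 2) 0 = b \<longrightarrow>
     a \<le> b \<longrightarrow> b \<le> 2 * N \<longrightarrow> (\<forall>j<k. h (l + 2, 4) (k - 1 - j) = P j \<and> P j + k ^ l \<le> 2 * N) \<longrightarrow>
     wp (CMP C (AC C l) l) (\<lambda>(xs', h'). xs' = xs \<and> mods h h' (RC l) \<and>
       h' rres 0 = cmpf (acf (Yf off) k C l) P k C a b) (xs, h))"

lemmas CMP_specD = CMP_spec_def[THEN iffD1, rule_format]

lemma stat_RC: "stat off h \<Longrightarrow> mods h h' (RC l) \<Longrightarrow> stat off h'"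
  by (auto simp: stat_def mods_def RC_def RA_def)

lemma Max_insert_image_atLeast:
  "s \<le> t \<Longrightarrow> Max (insert 0 (F ` {s..t})) = max (Max (insert 0 (F ` {Suc s..t}))) (F s)"
  for F :: "nat \<Rightarrow> nat"
proof -
  assume "s \<le> t"
  then have "{s..t} = insert s {Suc s..t}" by auto
  then have "insert 0 (F ` {s..t}) = insert (F s) (insert 0 (F ` {Suc s..t}))" by auto
  then show ?thesis by (simp add: max.commute)
qed

lemma CMP_ok: assumes A: "AC_spec off l" shows "CMP_spec off l"
  unfolding CMP_spec_def
proof (intro allI impI)
  fix P a b xs h
  assume st: "stat off h" and h: "h (l + 2, 1) 0 = a" "h (l + 2, 2) 0 = b"
    and ab: "a \<le> b" "b \<le> 2 * N"
    and P: "\<forall>j<k. h (l + 2, 4) (k - 1 - j) = P j \<and> P j + k ^ l \<le> 2 * N"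
  define L where "L = l + 2"
  have Lne: "L \<noteq> l + 1" "l + 1 \<noteq> L" by (simp_all add: L_def)
  have hL: "h (L, 1) 0 = a" "h (L, 2) 0 = b" using h by (simp_all only: L_def)
  define Kk where "Kk = k * C"
  define g where "g = grid a b Kk"
  define f where "f = acf (Yf off) k C l"
  define d where "d = dpv f P g"
  let ?T = "Ti (S rk) (K C)"
  let ?gr = "\<lambda>t. Pl (S (L, 1)) (Dv (Ti (Mi (S (L, 2)) (S (L, 1))) t) ?T)"
  let ?cand = "Pl (Rd (L, 5) (S (L, 8))) (S rres)"
  define fr where "fr xs' h' \<longleftrightarrow> xs' = xs \<and> mods h h' (RC l)" for xs' :: "bool list" and h'
  have in_RC: "(L, c) \<in> RC l" if "5 \<le> c" "c \<le> 9" for c using that by (auto simp: RC_def L_def)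
  have in_RC': "(l + 1, c) \<in> RC l" "rres \<in> RC l" for c by (auto simp: RC_def RA_def)
  have not_RC: "(L, c) \<notin> RC l" if "c < 5" for c using that by (auto simp: RC_def RA_def L_def)
  have fr_upd: "fr xs' (h'(r := v))" if "fr xs' h'" "r \<in> RC l" for xs' h' r v
    using that mods_upd by (auto simp: fr_def)
  have fr_L: "h' (L, c) = h (L, c)" if "fr xs' h'" "c < 5" for xs' h' c
    using that not_RC modsD by (auto simp: fr_def)
  have fr_st: "stat off h'" if "fr xs' h'" for xs' h'
    using that st stat_RC by (auto simp: fr_def)
  have ev_T: "ev y h' ?T = Kk" if "fr xs' h'" for xs' h'
    using fr_st[OF that] by (simp add: stat_def Kk_def)
  have ev_gr: "ev y h' (?gr t) = g (ev y h' t)" if "fr xs' h'" for xs' h' t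
    using fr_L[OF that, of 1] fr_L[OF that, of 2] ev_T[OF that] hL by (simp add: g_def grid_def)
  have gm: "g s \<le> g t" if "s \<le> t" for s t using that grid_mono by (simp add: g_def)
  have Kpos: "0 < Kk" using k C by (simp add: Kk_def)
  have gb: "g t \<le> b" if "t \<le> Kk" for t
    using gm[OF that] grid_K[OF ab(1) Kpos] by (simp add: g_def)
  have g0: "g 0 = a" by (simp add: g_def)
  have cand_le: "d j s + f (P j) (g s) (g t) \<le> b - a" if "s \<le> t" "t \<le> Kk" for j s t
  proof -
    have "d j s \<le> g s - g 0" unfolding d_def by (rule dpv_le) (auto simp: f_def acf_le gm)
    moreover have "f (P j) (g s) (g t) \<le> g t - g s" unfolding f_def by (rule acf_le) (rule gm[OF that(1)])
    ultimately show ?thesis using gm[of 0 s] gm[OF that(1)] gb[OF that(2)] g0 by linarith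
  qed
  have KB: "Kk + 1 < B0" unfolding Kk_def by (intro B0_ge) simp
  have AlK: "t \<le> Kk \<Longrightarrow> t < Al" for t using Al_gt by (simp add: Kk_def)
  have bB: "v \<le> b \<Longrightarrow> v < B0" for v using ab by (intro B0_ge) linarith
  \<comment> \<open>State of the row during its update from the right: columns below
    \<open>t'\<close> still belong to row \<open>j\<close>, the others already to row
    \<open>Suc j\<close>.\<close>
  define V3 where "V3 j t' h' \<longleftrightarrow> (\<forall>t\<le>Kk. h' (L, 5) t = (if t < t' then d j t else d (Suc j) t))" for j t' and h' :: store
  \<comment> \<open>The maximum is accumulated for \<open>s\<close> descending from
    \<open>t'\<close> to \<open>t\<close>. The inserted 0 is the initial value of the register and
    covers the empty range.\<close>
  define Inv4 :: "nat \<Rightarrow> nat \<Rightarrow> nat \<Rightarrow> state \<Rightarrow> bool" where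
    "Inv4 i t' = (\<lambda>t (xs', h'). fr xs' h' \<and> h' (L, 6) 0 = i \<and> h' (L, 7) 0 = t' \<and> V3 (k - Suc i) (Suc t') h' \<and>
      h' (L, 9) 0 = Max (insert 0 ((\<lambda>s. d (k - Suc i) s + f (P (k - Suc i)) (g s) (g t')) ` {t..t'})))" for i t'
  have inner: "wp (Set (l + 1, 0) (Rd (L, 4) (S (L, 6))) \<triangleright>
          Set (l + 1, 1) (?gr (S (L, 8))) \<triangleright>
          Set (l + 1, 2) (?gr (S (L, 7))) \<triangleright>
          AC C l \<triangleright>
          Set (L, 9) (mx (S (L, 9)) ?cand))
      (\<lambda>s'. snd s' (L, 8) 0 = t \<and> Inv4 i t' t s') (xs', upd h' (L, 8) 0 t)"
    if I: "Inv4 i t' (Suc t) (xs', h')" and lt: "t \<le> t'" "t' \<le> Kk" "i < k" for i t' t xs' h'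
  proof -
    let ?j = "k - Suc i"
    let ?h0 = "upd h' (L, 8) 0 t"
    let ?h1 = "upd ?h0 (l + 1, 0) 0 (P ?j)"
    let ?h2 = "upd ?h1 (l + 1, 1) 0 (g t)"
    let ?h3 = "upd ?h2 (l + 1, 2) 0 (g t')"
    have f0: "fr xs' ?h0" using I in_RC[of 8] by (auto simp: Inv4_def intro: fr_upd)
    have f1: "fr xs' ?h1" using f0 in_RC' by (auto intro: fr_upd)
    have f2: "fr xs' ?h2" using f1 in_RC' by (auto intro: fr_upd)
    have f3: "fr xs' ?h3" using f2 in_RC' by (auto intro: fr_upd)
    have r6: "h' (L, 6) 0 = i" "h' (L, 7) 0 = t'" using I by (auto simp: Inv4_def)
    have Pj: "h (L, 4) i = P ?j" "P ?j + k ^ l \<le> 2 * N"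
      using P[rule_format, of ?j] lt(3) k by (auto simp: L_def)
    have e1: "ev y ?h0 (Rd (L, 4) (S (L, 6))) = P ?j"
      using fr_L[OF f0, of 4] r6 Pj by simp
    have e2: "ev y ?h1 (?gr (S (L, 8))) = g t" unfolding ev_gr[OF f1] by (simp add: L_def)
    have e3: "ev y ?h2 (?gr (S (L, 7))) = g t'" unfolding ev_gr[OF f2] using r6 by (simp add: L_def)
    have "stat off ?h3" using fr_st[OF f3] .
    then have call: "wp (AC C l) (\<lambda>(xs'', h''). xs'' = xs' \<and> mods ?h3 h'' (RA l) \<and> h'' rres 0 = f (P ?j) (g t) (g t')) (xs', ?h3)"
      unfolding f_def using gm[OF lt(1)] gb[OF lt(2)] ab Pj(2) by (intro AC_specD[OF A]) simp_all
    have fin: "wp (Set (L, 9) (mx (S (L, 9)) ?cand)) (\<lambda>s'. snd s' (L, 8) 0 = t \<and> Inv4 i t' t s') (xs'', h'')"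
      if o: "ok h''" and m: "mods ?h3 h'' (RA l)" and res: "h'' rres 0 = f (P ?j) (g t) (g t')" and x: "xs'' = xs'" for xs'' h''
    proof -
      have rL: "h'' (L, c) = ?h3 (L, c)" for c using modsD[OF m, of "(L, c)"] by (simp add: RA_def L_def)
      have rL': "h'' (L, c) = h' (L, c)" if "c \<noteq> 8" for c using that by (simp add: rL Lne)
      have f4: "fr xs'' h''" using f3 m x mods_trans[of h ?h3 "RC l" h'' "RA l"] by (auto simp: fr_def RC_def)
      have "h'' (L, 8) 0 = t" by (simp add: rL Lne)
      moreover have "h' (L, 5) t = d ?j t" using I lt by (auto simp: Inv4_def V3_def)
      ultimately have ec: "ev y h'' ?cand = d ?j t + f (P ?j) (g t) (g t')" using res rL'[of 5] by simp
      let ?h5 = "upd h'' (L, 9) 0 (max (h'' (L, 9) 0) (d ?j t + f (P ?j) (g t) (g t')))"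
      have f5: "fr xs'' ?h5" using f4 in_RC[of 9] by (auto intro: fr_upd)
      have "Inv4 i t' t (xs'', ?h5)"
        using f5 rL'[of 5] rL'[of 6] rL'[of 7] rL'[of 9] I Max_insert_image_atLeast[OF lt(1), of "\<lambda>s. d ?j s + f (P ?j) (g s) (g t')"]
        unfolding Inv4_def V3_def by simp
      moreover have "?h5 (L, 8) 0 = t" by (simp add: rL Lne)
      moreover have "max (h'' (L, 9) 0) (d ?j t + f (P ?j) (g t) (g t')) < B0"
        using ok_lt[OF o] bB cand_le[OF lt(1,2), of ?j] by (simp add: max_def)
      ultimately show ?thesis using ec by (intro wp_Set) simp_all
    qed
    show ?thesis
      using bB[OF gb[OF lt(2)]] bB[OF order_trans[OF gm[OF lt(1)] gb[OF lt(2)]]] Pj(2)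
      apply -
      apply (rule wp_Then, rule wp_Set, unfold e1, rule B0_ge, linarith)
      apply (rule wp_Then, rule wp_Set, unfold e2, assumption)
      apply (rule wp_Then, rule wp_Set, unfold e3, assumption)
      apply (rule wp_Then)
      apply (rule wp_mono[OF call])
      using fin by auto
  qed
  define Inv3 :: "nat \<Rightarrow> nat \<Rightarrow> state \<Rightarrow> bool" where
    "Inv3 i = (\<lambda>t (xs', h'). fr xs' h' \<and> h' (L, 6) 0 = i \<and> V3 (k - Suc i) t h')" for i
  have mid: "wp (Set (L, 9) (K 0) \<triangleright>
        For (L, 8) (Pl (S (L, 7)) (K 1)) (
          Set (l + 1, 0) (Rd (L, 4) (S (L, 6))) \<triangleright>
          Set (l + 1, 1) (?gr (S (L, 8))) \<triangleright>
          Set (l + 1, 2) (?gr (S (L, 7))) \<triangleright>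
          AC C l \<triangleright>
          Set (L, 9) (mx (S (L, 9)) ?cand)) \<triangleright>
        Asg (L, 5) (S (L, 7)) (S (L, 9)))
      (\<lambda>s'. snd s' (L, 7) 0 = t' \<and> Inv3 i t' s') (xs', upd h' (L, 7) 0 t')"
    if I: "Inv3 i (Suc t') (xs', h')" and lt: "t' \<le> Kk" "i < k" for i t' xs' h'
  proof -
    let ?j = "k - Suc i"
    let ?h1 = "upd (upd h' (L, 7) 0 t') (L, 9) 0 0"
    have f1: "fr xs' ?h1" using I in_RC[of 7] in_RC[of 9] by (auto simp: Inv3_def intro!: fr_upd)
    have e: "ev y ?h1 (Pl (S (L, 7)) (K 1)) = Suc t'" by simp
    show ?thesis
      apply (rule wp_Then, rule wp_Set, use B0 in simp)
      unfolding ev.simps(1)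
    proof (rule wp_Then, rule wp_For[where Inv = "Inv4 i t'"], goal_cases)
      case 1
      show ?case unfolding e using KB lt by simp
    next
      case 2
      have "fr xs' (upd ?h1 (L, 8) 0 (Suc t'))" using f1 in_RC[of 8] by (auto intro: fr_upd)
      then show ?case unfolding e using I by (simp add: Inv4_def Inv3_def V3_def)
    next
      case (3 t xs'' h'')
      then show ?case unfolding e using lt by (intro inner) auto
    next
      case (4 xs'' h'')
      have Mx: "h'' (L, 9) 0 = d (Suc ?j) t'"
      proof -
        have "h'' (L, 9) 0 = Max (insert 0 ((\<lambda>s. d ?j s + f (P ?j) (g s) (g t')) ` {..t'}))"
          using 4 by (simp add: Inv4_def atLeast0AtMost)
        also have "\<dots> = d (Suc ?j) t'" unfolding d_def by (subst Max_insert) auto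
        finally show ?thesis .
      qed
      have "Inv3 i t' (xs'', upd h'' (L, 5) t' (d (Suc ?j) t'))"
        using 4 fr_upd[of xs'' h'' "(L, 5)"] in_RC[of 5]
        unfolding Inv3_def Inv4_def V3_def by (auto simp: less_Suc_eq)
      moreover have e7: "ev y h'' (S (L, 7)) = t'" "ev y h'' (S (L, 9)) = d (Suc ?j) t'"
        using 4 Mx by (simp_all add: Inv4_def)
      moreover have "h'' (L, 7) 0 = t'" "d (Suc ?j) t' < B0"
        using 4 Mx ok_lt[of h'' "(L, 9)" 0] by (simp_all add: Inv4_def)
      ultimately show ?case using AlK[OF lt(1)] by (intro wp_Asg, unfold e7) simp_all
    qed
  qed
  define Inv2 :: "nat \<Rightarrow> state \<Rightarrow> bool" where
    "Inv2 = (\<lambda>i (xs', h'). fr xs' h' \<and> (\<forall>t\<le>Kk. h' (L, 5) t = d (k - i) t))"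
  define Inv1 :: "nat \<Rightarrow> state \<Rightarrow> bool" where
    "Inv1 = (\<lambda>i (xs', h'). fr xs' h' \<and> (\<forall>t\<le>Kk. i \<le> t \<longrightarrow> h' (L, 5) t = 0))"
  have fr0: "fr xs h" by (simp add: fr_def)
  show "wp (CMP C (AC C l) l) (\<lambda>(xs', h'). xs' = xs \<and> mods h h' (RC l) \<and>
       h' rres 0 = cmpf (acf (Yf off) k C l) P k C a b) (xs, h)"
    unfolding CMP_def Let_def L_def[symmetric]
  proof (intro wp_Then, rule wp_For[where Inv = Inv1], goal_cases)
    case 1
    then show ?case using ev_T[OF fr0] KB by simp
  next
    case 2
    then show ?case using ev_T[OF fr0] fr_upd[OF fr0 in_RC[of 6]] by (simp add: Inv1_def)
  next
    case (3 i xs1 h1)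
    then have i: "i \<le> Kk" using ev_T[OF fr0] by simp
    let ?h = "upd (upd h1 (L, 6) 0 i) (L, 5) i 0"
    have "fr xs1 ?h" using 3 in_RC[of 5] in_RC[of 6] by (auto simp: Inv1_def intro!: fr_upd)
    then have "Inv1 i (xs1, ?h)" using 3 by (auto simp: Inv1_def)
    then show ?case using AlK[OF i] B0 by (intro wp_Asg) auto
  next
    case (4 xs1 h1)
    then have f1: "fr xs1 h1" and V: "\<forall>t\<le>Kk. h1 (L, 5) t = 0" by (auto simp: Inv1_def)
    have ek: "ev y h1 (S rk) = k" using fr_st[OF f1] by (simp add: stat_def)
    have kK: "k \<le> Kk" using C by (simp add: Kk_def)
    show ?case
    proof (rule wp_Then, rule wp_For[where Inv = Inv2], goal_cases)
      case 1
      then show ?case unfolding ek using kK KB by simp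
    next
      case 2
      then show ?case unfolding ek using V fr_upd[OF f1 in_RC[of 6]] by (simp add: Inv2_def d_def)
    next
      case (3 i xs2 h2)
      then have i: "i < k" and f2: "fr xs2 h2" unfolding ek by (auto simp: Inv2_def)
      let ?h2 = "upd h2 (L, 6) 0 i"
      have f2': "fr xs2 ?h2" using f2 in_RC[of 6] by (auto intro: fr_upd)
      have eT: "ev y ?h2 (Pl ?T (K 1)) = Suc Kk" using ev_T[OF f2'] by simp
      have j: "k - i = Suc (k - Suc i)" using i by simp
      show ?case
      proof (rule wp_For[where Inv = "Inv3 i"], goal_cases)
        case 1
        then show ?case unfolding eT using KB by simp
      next
        case 2
        have "fr xs2 (upd ?h2 (L, 7) 0 (Suc Kk))" using f2' in_RC[of 7] by (auto intro: fr_upd)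
        then show ?case unfolding eT using 3 by (simp add: Inv3_def Inv2_def V3_def)
      next
        case (3 t' xs3 h3)
        then show ?case unfolding eT using i by (intro mid) auto
      next
        case (4 xs3 h3)
        then show ?case by (simp add: Inv3_def Inv2_def V3_def j)
      qed
    next
      case (4 xs2 h2)
      then have f2: "fr xs2 h2" and V: "\<forall>t\<le>Kk. h2 (L, 5) t = d k t" by (auto simp: Inv2_def)
      have e: "ev y h2 (Rd (L, 5) ?T) = cmpf (acf (Yf off) k C l) P k C a b"
        unfolding ev.simps(2) ev_T[OF f2] using V by (simp add: d_def f_def g_def Kk_def cmpf_def)
      have "fr xs2 (upd h2 rres 0 (cmpf (acf (Yf off) k C l) P k C a b))"
        using f2 in_RC' by (auto intro: fr_upd)
      moreover have "cmpf (acf (Yf off) k C l) P k C a b < B0"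
        using ok_lt[OF 4(3), of "(L, 5)" "ev y h2 ?T"] unfolding e[symmetric] by simp
      ultimately show ?case by (intro wp_Set, unfold e) (simp_all add: fr_def)
    qed
  qed
qed

lemma AC_ok: "AC_spec off l"
proof (induction l)
  case 0
  show ?case by (rule AC_0)
next
  case (Suc l)
  define L where "L = l + 2"
  show ?case
    unfolding AC_spec_def AC.simps
  proof (intro allI impI)
    fix p a b xs h
    assume st: "stat off h" and h: "h (Suc l + 1, 0) 0 = p" "h (Suc l + 1, 1) 0 = a" "h (Suc l + 1, 2) 0 = b"
      and ab: "a \<le> b" "b \<le> 2 * N" "p + k ^ Suc l \<le> 2 * N"
    have L: "Suc l + 1 = L" by (simp add: L_def)
    define R :: "reg set" where "R = {(L, 3), (L, 4), (L, 0)}"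
    define P where "P j = p + j * k ^ l" for j
    have P: "P = (\<lambda>i. p + i * k ^ l)" by (auto simp: P_def)
    define Inv :: "nat \<Rightarrow> state \<Rightarrow> bool" where
      "Inv = (\<lambda>i (xs', h'). xs' = xs \<and> mods h h' R \<and> h' (L, 0) 0 = P (k - i) \<and>
        (\<forall>j<k - i. h' (L, 4) (k - 1 - j) = P j))"
    have ek: "ev y h (S rk) = k" using st by (simp add: stat_def)
    have kK: "k < Al" using mult_le_mono2[OF C, of k] Al_gt by linarith
    have kB: "k < B0" using mult_le_mono2[OF C, of k] by (intro B0_ge) linarith
    show "wp (For (l + 2, 3) (S rk)
       (Asg (l + 2, 4) (S (l + 2, 3)) (S (l + 2, 0)) \<triangleright> Set (l + 2, 0) (Pl (S (l + 2, 0)) (pw (S rk) l))) \<triangleright>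
     CMP C (AC C l) l) (\<lambda>(xs', h'). xs' = xs \<and> mods h h' (RA (Suc l)) \<and>
       h' rres 0 = acf (Yf off) k C (Suc l) p a b) (xs, h)"
      unfolding L_def[symmetric]
    proof (intro wp_Then, rule wp_For[where Inv = Inv], goal_cases)
      case 1
      show ?case unfolding ek by (rule kB)
    next
      case 2
      show ?case unfolding ek using h L by (auto simp: Inv_def R_def mods_def P_def)
    next
      case (3 i xs1 h1)
      then have i: "i < k" unfolding ek by simp
      let ?h1 = "upd h1 (L, 3) 0 i"
      let ?j = "k - Suc i"
      have I: "xs1 = xs" "mods h h1 R" "h1 (L, 0) 0 = P ?j" "\<forall>j<?j. h1 (L, 4) (k - 1 - j) = P j"
        using 3 by (auto simp: Inv_def)
      have rk: "h1 rk 0 = k" using modsD[OF I(2), of rk] st by (simp add: R_def stat_def L_def)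
      have kj: "k - i = Suc ?j" "k - 1 - ?j = i" using i by auto
      have "Suc ?j * k ^ l \<le> k * k ^ l" using i by (intro mult_right_mono) auto
      then have "P ?j + k ^ l \<le> 2 * N" using ab(3) by (simp add: P_def)
      then have PB: "P ?j + k ^ l < B0" by (intro B0_ge) linarith
      have PS: "P ?j + k ^ l = P (k - i)" unfolding kj by (simp add: P_def)
      have V: "h2 (L, 4) (k - 1 - j) = P j" if "j < k - i" "h2 (L, 4) = (h1 (L, 4))(i := P ?j)" for j h2
        using that I(4) i by (cases "j = ?j") auto
      show ?case
        apply (rule wp_Then, rule wp_Asg)
        subgoal using i kK by simp
        subgoal using PB I(3) by simp
        apply (rule wp_Set)
        subgoal using PB I(3) rk by (simp add: L_def)
        using I PS rk V by (auto simp: Inv_def R_def mods_def L_def)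
    next
      case (4 xs1 h1)
      then have I: "xs1 = xs" "mods h h1 R" "\<forall>j<k. h1 (L, 4) (k - 1 - j) = P j"
        by (auto simp: Inv_def)
      have st1: "stat off h1" using st I(2) by (auto simp: stat_def mods_def R_def L_def)
      have r: "h1 (L, 1) 0 = a" "h1 (L, 2) 0 = b"
        using h L modsD[OF I(2), of "(L, 1)"] modsD[OF I(2), of "(L, 2)"] by (auto simp: R_def)
      have PB: "P j + k ^ l \<le> 2 * N" if "j < k" for j
      proof -
        have "Suc j * k ^ l \<le> k * k ^ l" using that by (intro mult_right_mono) auto
        then show ?thesis using ab(3) by (simp add: P_def)
      qed
      have "wp (CMP C (AC C l) l) (\<lambda>(xs', h'). xs' = xs1 \<and> mods h1 h' (RC l) \<and>
        h' rres 0 = cmpf (acf (Yf off) k C l) P k C a b) (xs1, h1)"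
        using st1 r ab PB I(3) by (intro CMP_specD[OF CMP_ok[OF Suc.IH]]) (simp_all add: L_def)
      moreover have "mods h h' (RA (Suc l))" if "mods h1 h' (RC l)" for h'
        using that I(2) by (auto simp: mods_def RA_def RC_def R_def L_def)
      ultimately show ?case
        using P by (elim wp_mono) (auto simp: I(1))
    qed
  qed
qed

end

section \<open>Reading the stream and building the tree\<close>

definition READ :: "nat \<Rightarrow> cmd" where
  "READ Q = (let thr = Ti (K (Q + 2)) (S rm); nm = Mi (S rn) (S rm) in
    Read rb \<triangleright>
    Set rt (ne (S rb) (S rf)) \<triangleright>
    Set ru (Pl (S ru) (Mi (K 1) (S rt))) \<triangleright>
    Set rv (Pl (S rv) (S rt)) \<triangleright>
    Set rs (K 0) \<triangleright>
    Set rw (K 0) \<triangleright>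
    For rj (Pl (S rn) (K 1)) (
      Cond (Mi (Ti (K Q) (Pl (mn (S ru) (S rs)) (mn (Mi nm (S rv)) (Mi (S rm) (S rw))))) thr)
        (Set rG (K 1)) Nop \<triangleright>
      Cond (Mi (Ti (K Q) (Pl (mn (S rv) (S rw)) (mn (Mi (S rm) (S ru)) (Mi nm (S rs))))) thr)
        (Set rG (K 1)) Nop \<triangleright>
      Set rt (ne (Inp (Mi (S rn) (S rj))) (S rf)) \<triangleright>
      Set rs (Pl (S rs) (Mi (K 1) (S rt))) \<triangleright>
      Set rw (Pl (S rw) (S rt))))"

fun NODE :: "nat \<Rightarrow> nat \<Rightarrow> nat \<Rightarrow> nat \<Rightarrow> cmd" where
  "NODE Q C D 0 =
    Cond (Mi (S rm) (S rcnt)) (READ Q \<triangleright> Set rsy (S rb) \<triangleright> Set rcnt (Pl (S rcnt) (K 1))) (Set rsy (K 2)) \<triangleright>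
    Set rer (K 1) \<triangleright>
    Set rptr (K 0) \<triangleright>
    For rq (Pl (pw (S rk) D) (K 1))
      (Cond (ne (Yo (S rq)) (S rsy)) Nop (Set rptr (S rq) \<triangleright> Set rer (K 0))) \<triangleright>
    Set rE (Pl (S rE) (S rer))"
| "NODE Q C D (Suc l) =
    For (l + 2, 10) (S rk) (NODE Q C D l \<triangleright> Asg (l + 2, 4) (S (l + 2, 10)) (S rptr)) \<triangleright>
    Set (l + 2, 12) (K 0) \<triangleright>
    Set (l + 2, 13) (K 0) \<triangleright>
    For (l + 2, 11) (Pl (pw (S rk) D) (K 1)) (
      Set (l + 2, 1) (S (l + 2, 11)) \<triangleright>
      Set (l + 2, 2) (Pl (S (l + 2, 11)) (pw (S rk) (Suc l))) \<triangleright>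
      CMP C (AC C l) l \<triangleright>
      Cond (Mi (S rres) (S (l + 2, 12))) (Set (l + 2, 12) (S rres) \<triangleright> Set (l + 2, 13) (S (l + 2, 11))) Nop) \<triangleright>
    Set rptr (S (l + 2, 13)) \<triangleright>
    Set rE (Pl (S rE) (Mi (pw (S rk) (Suc l)) (S (l + 2, 12))))"

lemma zeros_take_Suc: "c < length l \<Longrightarrow> zeros (take (Suc c) l) = zeros (take c l) + of_bool (\<not> l ! c)"
  and ones_take_Suc: "c < length l \<Longrightarrow> ones (take (Suc c) l) = ones (take c l) + of_bool (l ! c)"
  by (simp_all add: take_Suc_conv_app_nth)

definition RR :: "reg set" where "RR = {rb, ru, rv, rG, rs, rw, rj, rt}"
text \<open>The parameters in columns 0 to 4 and \<open>rL\<close> stay outside, so that the error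
  of the left block survives the processing of the right one.\<close>

definition RN :: "nat \<Rightarrow> reg set" where
  "RN l = {r. 1 \<le> fst r \<and> fst r \<le> l + 1} \<union> {(0, c) | c. 5 \<le> c \<and> c \<le> 18} \<union> {rt}"

lemma mem_RN [simp]: "(a, c) \<in> RN l \<longleftrightarrow> 1 \<le> a \<and> a \<le> l + 1 \<or> a = 0 \<and> (5 \<le> c \<and> c \<le> 18 \<or> c = 21)"
  by (auto simp: RN_def)

lemma mods_mono: "mods h h' R \<Longrightarrow> R \<subseteq> R' \<Longrightarrow> mods h h' R'"
  by (auto simp: mods_def)

locale run = params \<omega> y Al B0 n m k D C N for \<omega> y Al B0 n m k D C N +
  fixes x :: "bool list" and F :: bool and Q :: nat
  assumes lx: "length x = n"
begin

text \<open>The strings after the exchange of the symbols that makes 1 the minority symbol of \<open>y\<close>.\<close>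

definition xf :: "bool list" where "xf = map (\<lambda>b. b \<noteq> F) x"
definition yf :: "bool list" where "yf = map (\<lambda>b. b \<noteq> F) y"

text \<open>A cut value computable while streaming: the symbols of \<open>x\<close> still to come
  are estimated by taking \<open>m\<close> for its zeros and \<open>n - m\<close> for its ones. The
  estimate is off by at most the difference between \<open>m\<close> and the true number of
  zeros.\<close>

definition cand01 :: "nat \<Rightarrow> nat \<Rightarrow> nat" where
  "cand01 i j = min (zeros (take i xf)) (zeros (take j yf)) + min (n - m - ones (take i xf)) (m - ones (take j yf))"
definition cand10 :: "nat \<Rightarrow> nat \<Rightarrow> nat" where
  "cand10 i j = min (ones (take i xf)) (ones (take j yf)) + min (m - zeros (take i xf)) (n - m - zeros (take j yf))"
text \<open>The excess demanded is 2m/Q. In the balanced case the estimate is off by at most m/Q, so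
  a reported cut truly gains m/Q, and unreported ones gain at most 3m/Q.\<close>

definition gain :: "nat \<Rightarrow> nat \<Rightarrow> bool" where
  "gain i j \<longleftrightarrow> (Q + 2) * m < Q * cand01 i j \<or> (Q + 2) * m < Q * cand10 i j"

definition RD :: "nat \<Rightarrow> bool list \<Rightarrow> store \<Rightarrow> bool" where
  "RD c xs h \<longleftrightarrow> xs = drop c x \<and> h ru 0 = zeros (take c xf) \<and> h rv 0 = ones (take c xf) \<and>
     (h rG 0 \<noteq> 0 \<longleftrightarrow> (\<exists>i\<le>c. 1 \<le> i \<and> (\<exists>j\<le>n. gain i j))) \<and> h rf 0 = of_bool F"

lemma RD_mods: "RD c xs h \<Longrightarrow> mods h h' R \<Longrightarrow> ru \<notin> R \<Longrightarrow> rv \<notin> R \<Longrightarrow> rG \<notin> R \<Longrightarrow> rf \<notin> R \<Longrightarrow> RD c xs h'"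
  by (simp add: RD_def mods_def)

lemma len_xf [simp]: "length xf = n" and len_yf [simp]: "length yf = n"
  using lx n by (simp_all add: xf_def yf_def)

lemma cnt_le: "zeros (take c xf) \<le> n" "ones (take c xf) \<le> n" "zeros (take c yf) \<le> n" "ones (take c yf) \<le> n"
  using length_filter_le[of _ "take c xf"] length_filter_le[of _ "take c yf"]
  by (metis len_xf len_yf le_trans length_take min.cobounded1)+

lemma wp_flag:
  "wp (Cond e (Set rG (K 1)) Nop)
     (\<lambda>(xs', h'). xs' = xs \<and> mods h h' {rG} \<and> (h' rG 0 \<noteq> 0 \<longleftrightarrow> h rG 0 \<noteq> 0 \<or> ev y h e \<noteq> 0)) (xs, h)"
proof (rule wp_Cond)
  show "wp (Set rG (K 1)) (\<lambda>(xs', h'). xs' = xs \<and> mods h h' {rG} \<and> (h' rG 0 \<noteq> 0 \<longleftrightarrow> h rG 0 \<noteq> 0 \<or> ev y h e \<noteq> 0)) (xs, h)"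
    if "ev y h e \<noteq> 0" using that B0 by (intro wp_Set) (auto simp: mods_def)
  show "wp Nop (\<lambda>(xs', h'). xs' = xs \<and> mods h h' {rG} \<and> (h' rG 0 \<noteq> 0 \<longleftrightarrow> h rG 0 \<noteq> 0 \<or> ev y h e \<noteq> 0)) (xs, h)"
    if "ev y h e = 0" using that by (intro wp_Nop) auto
qed

lemma ne_sym: "(of_bool a - of_bool F) + (of_bool F - of_bool a) = (of_bool (a \<noteq> F) :: nat)"
  by (cases a; cases F) auto

lemma READ_ok:
  assumes st: "stat off h" and R: "RD c xs h" and c: "c < n"
  shows "wp (READ Q) (\<lambda>(xs', h'). mods h h' RR \<and> RD (Suc c) xs' h' \<and> h' rb 0 = of_bool (x ! c)) (xs, h)"
proof -
  let ?b = "of_bool (x ! c) :: nat"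
  let ?t = "of_bool (x ! c \<noteq> F) :: nat"
  have xs: "xs = x ! c # drop (Suc c) x" using R c lx by (simp add: RD_def Cons_nth_drop_Suc)
  have rf: "h rf 0 = of_bool F" using R by (simp add: RD_def)
  have rst: "h rn 0 = n" "h rm 0 = m" using st by (simp_all add: stat_def)
  have xfc: "xf ! c = (x ! c \<noteq> F)" using c lx by (simp add: xf_def)
  have zc: "h ru 0 + (1 - ?t) = zeros (take (Suc c) xf)"
    using R c xfc zeros_take_Suc[of c xf] by (simp add: RD_def)
  have oc: "h rv 0 + ?t = ones (take (Suc c) xf)"
    using R c xfc ones_take_Suc[of c xf] by (simp add: RD_def)
  let ?h1 = "upd h rb 0 ?b"
  let ?h2 = "upd ?h1 rt 0 ?t"
  let ?h3 = "upd ?h2 ru 0 (zeros (take (Suc c) xf))"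
  let ?h4 = "upd ?h3 rv 0 (ones (take (Suc c) xf))"
  let ?h6 = "upd (upd ?h4 rs 0 0) rw 0 0"
  define R6 where "R6 = {rG, rs, rw, rj, rt}"
  \<comment> \<open>The scan visits the prefixes of \<open>y\<close> of length \<open>n - i\<close>.
    In the last round the query lies past the end of \<open>y\<close> and spoils the counters, hence
    the guard \<open>i \<noteq> 0\<close>.\<close>
  define Inv :: "nat \<Rightarrow> state \<Rightarrow> bool" where "Inv = (\<lambda>i (xs', h'). xs' = drop (Suc c) x \<and> mods ?h6 h' R6 \<and>
    (h' rG 0 \<noteq> 0 \<longleftrightarrow> h rG 0 \<noteq> 0 \<or> (\<exists>j<n + 1 - i. gain (Suc c) j)) \<and>
    (i \<noteq> 0 \<longrightarrow> h' rs 0 = zeros (take (n + 1 - i) yf) \<and> h' rw 0 = ones (take (n + 1 - i) yf)))"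
  let ?thr = "Ti (K (Q + 2)) (S rm)"
  let ?nm = "Mi (S rn) (S rm)"
  let ?e1 = "Mi (Ti (K Q) (Pl (mn (S ru) (S rs)) (mn (Mi ?nm (S rv)) (Mi (S rm) (S rw))))) ?thr"
  let ?e2 = "Mi (Ti (K Q) (Pl (mn (S rv) (S rw)) (mn (Mi (S rm) (S ru)) (Mi ?nm (S rs))))) ?thr"
  have body: "wp (Cond ?e1 (Set rG (K 1)) Nop \<triangleright> Cond ?e2 (Set rG (K 1)) Nop \<triangleright>
      Set rt (ne (Inp (Mi (S rn) (S rj))) (S rf)) \<triangleright>
      Set rs (Pl (S rs) (Mi (K 1) (S rt))) \<triangleright> Set rw (Pl (S rw) (S rt)))
    (\<lambda>s'. snd s' rj 0 = i \<and> Inv i s') (xs1, upd h1 rj 0 i)"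
    if I: "Inv (Suc i) (xs1, h1)" and i: "i \<le> n" for i xs1 h1
  proof -
    let ?j = "n - i"
    have ij: "n + 1 - Suc i = ?j" "n + 1 - i = Suc ?j" using i by auto
    have m1: "mods ?h6 h1 R6" and x1: "xs1 = drop (Suc c) x"
      and G1: "h1 rG 0 \<noteq> 0 \<longleftrightarrow> h rG 0 \<noteq> 0 \<or> (\<exists>j<?j. gain (Suc c) j)"
      and s1: "h1 rs 0 = zeros (take ?j yf)" "h1 rw 0 = ones (take ?j yf)"
      using I unfolding Inv_def ij by auto
    define g where "g = upd h1 rj 0 i"
    have gr: "g rn 0 = n" "g rm 0 = m" "g ru 0 = zeros (take (Suc c) xf)" "g rv 0 = ones (take (Suc c) xf)"
      "g rf 0 = of_bool F" "g rs 0 = zeros (take ?j yf)" "g rw 0 = ones (take ?j yf)" "g rj 0 = i"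
      "g rG 0 = h1 rG 0"
      using m1 s1 rst rf by (simp_all add: g_def mods_def R6_def)
    have gm: "mods ?h6 g R6" using m1 by (simp add: g_def mods_def R6_def)
    have E1: "ev y h' ?e1 = Q * cand01 (Suc c) ?j - (Q + 2) * m"
      and E2: "ev y h' ?e2 = Q * cand10 (Suc c) ?j - (Q + 2) * m"
      if "mods g h' {rG}" for h'
      using that gr by (simp_all add: mods_def cand01_def cand10_def)
    let ?v = "ev y g (ne (Inp (Mi (S rn) (S rj))) (S rf))"
    have v2: "?v \<le> 2" using gr by (simp add: ev_ne)
    have vj: "?v = of_bool (yf ! ?j)" if "i \<noteq> 0"
      using that gr i n ne_sym[of "y ! ?j"] by (simp add: ev_ne yf_def)
    have fin: "wp (Set rt (ne (Inp (Mi (S rn) (S rj))) (S rf)) \<triangleright>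
      Set rs (Pl (S rs) (Mi (K 1) (S rt))) \<triangleright> Set rw (Pl (S rw) (S rt)))
      (\<lambda>s'. snd s' rj 0 = i \<and> Inv i s') (xs1, h3)"
      if m3: "mods g h3 {rG}" and G3: "h3 rG 0 \<noteq> 0 \<longleftrightarrow> h1 rG 0 \<noteq> 0 \<or> gain (Suc c) ?j" for h3
    proof -
      have r3: "h3 r = g r" if "r \<noteq> rG" for r using m3 that by (simp add: mods_def)
      have e: "ev y h3 (ne (Inp (Mi (S rn) (S rj))) (S rf)) = ?v" by (simp add: ev_ne r3)
      have Gn: "(\<exists>j<Suc ?j. gain (Suc c) j) \<longleftrightarrow> (\<exists>j<?j. gain (Suc c) j) \<or> gain (Suc c) ?j"
        by (auto simp: less_Suc_eq)
      let ?h' = "upd (upd (upd h3 rt 0 ?v) rs 0 (zeros (take ?j yf) + (1 - ?v))) rw 0 (ones (take ?j yf) + ?v)"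
      have "mods ?h6 ?h' R6" using gm m3 by (auto simp: mods_def R6_def)
      moreover have "i \<noteq> 0 \<Longrightarrow> zeros (take ?j yf) + (1 - ?v) = zeros (take (Suc ?j) yf) \<and>
          ones (take ?j yf) + ?v = ones (take (Suc ?j) yf)"
        using vj zeros_take_Suc[of ?j yf] ones_take_Suc[of ?j yf] i by auto
      ultimately have "Inv i (xs1, ?h')" "?h' rj 0 = i"
        unfolding Inv_def ij using x1 G3 G1 Gn gr(8) r3 by auto
      moreover have "?v < B0" "zeros (take ?j yf) + (1 - ?v) < B0" "ones (take ?j yf) + ?v < B0"
        using v2 cnt_le[of ?j] by (auto intro!: B0_ge)
      moreover have "ev y (upd h3 rt 0 ?v) (Pl (S rs) (Mi (K 1) (S rt))) = zeros (take ?j yf) + (1 - ?v)"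
        "ev y (upd (upd h3 rt 0 ?v) rs 0 (zeros (take ?j yf) + (1 - ?v))) (Pl (S rw) (S rt)) = ones (take ?j yf) + ?v"
        using gr r3 by simp_all
      ultimately show ?thesis
        apply -
        apply (rule wp_Then, rule wp_Set, unfold e, assumption)
        apply (rule wp_Then, rule wp_Set)
         apply (simp only:)
        apply (rule wp_Set)
         apply (simp only:)
        apply (simp only: snd_conv)
        done
    qed
    have ne0: "(a - b \<noteq> 0) = (b < a)" for a b :: nat by auto
    have F1: "wp (Cond ?e1 (Set rG (K 1)) Nop) (\<lambda>(xs', h'). xs' = xs1 \<and> mods g h' {rG} \<and>
        (h' rG 0 \<noteq> 0 \<longleftrightarrow> h1 rG 0 \<noteq> 0 \<or> (Q + 2) * m < Q * cand01 (Suc c) ?j)) (xs1, g)"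
      using wp_flag[of ?e1 xs1 g] unfolding E1[OF mods_refl] ne0 gr(9) .
    have F2: "wp (Cond ?e2 (Set rG (K 1)) Nop) (\<lambda>(xs', h'). xs' = xs1 \<and> mods h2 h' {rG} \<and>
        (h' rG 0 \<noteq> 0 \<longleftrightarrow> h2 rG 0 \<noteq> 0 \<or> (Q + 2) * m < Q * cand10 (Suc c) ?j)) (xs1, h2)"
      if "mods g h2 {rG}" for h2
      using wp_flag[of ?e2 xs1 h2] unfolding E2[OF that] ne0 .
    show ?thesis
      unfolding g_def[symmetric]
    proof (rule wp_Then, rule wp_mono[OF F1], simp only: prod.case, elim conjE, hypsubst, rule wp_Then)
      fix h2 assume m2: "mods g h2 {rG}"
        and G2: "h2 rG 0 \<noteq> 0 \<longleftrightarrow> h1 rG 0 \<noteq> 0 \<or> (Q + 2) * m < Q * cand01 (Suc c) ?j"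
      show "wp (Cond ?e2 (Set rG (K 1)) Nop) (\<lambda>s. wp (Set rt (ne (Inp (Mi (S rn) (S rj))) (S rf)) \<triangleright>
        Set rs (Pl (S rs) (Mi (K 1) (S rt))) \<triangleright> Set rw (Pl (S rw) (S rt)))
        (\<lambda>s'. snd s' rj 0 = i \<and> Inv i s') s) (xs1, h2)"
      proof (rule wp_mono[OF F2[OF m2]], simp only: prod.case, elim conjE, hypsubst, rule fin)
        fix h3 assume m3: "mods h2 h3 {rG}"
          and G3: "h3 rG 0 \<noteq> 0 \<longleftrightarrow> h2 rG 0 \<noteq> 0 \<or> (Q + 2) * m < Q * cand10 (Suc c) ?j"
        show "mods g h3 {rG}" using mods_trans[OF m2 m3] by simp
        show "h3 rG 0 \<noteq> 0 \<longleftrightarrow> h1 rG 0 \<noteq> 0 \<or> gain (Suc c) ?j"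
          using G2 G3 unfolding gain_def by blast
      qed
    qed
  qed
  have loop: "wp (For rj (Pl (S rn) (K 1)) (Cond ?e1 (Set rG (K 1)) Nop \<triangleright> Cond ?e2 (Set rG (K 1)) Nop \<triangleright>
      Set rt (ne (Inp (Mi (S rn) (S rj))) (S rf)) \<triangleright>
      Set rs (Pl (S rs) (Mi (K 1) (S rt))) \<triangleright> Set rw (Pl (S rw) (S rt))))
    (\<lambda>(xs', h'). mods h h' RR \<and> RD (Suc c) xs' h' \<and> h' rb 0 = ?b) (drop (Suc c) x, ?h6)"
  proof (rule wp_For[where Inv = Inv], goal_cases)
    case 1
    show ?case using rst by (auto intro: B0_ge)
  next
    case 2
    show ?case using rst by (auto simp: Inv_def mods_def R6_def)
  next
    case (3 i xs1 h1)
    then show ?case using rst by (intro body) auto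
  next
    case (4 xs1 h1)
    then have I: "xs1 = drop (Suc c) x" "mods ?h6 h1 R6"
      "h1 rG 0 \<noteq> 0 \<longleftrightarrow> h rG 0 \<noteq> 0 \<or> (\<exists>j\<le>n. gain (Suc c) j)"
      by (auto simp: Inv_def less_Suc_eq_le)
    have r1: "h1 r = ?h6 r" if "r \<notin> R6" for r using I(2) that by (simp add: mods_def)
    have "mods h h1 RR" unfolding mods_def RR_def using r1 by (auto simp: R6_def)
    moreover have s1: "1 \<le> Suc c" by (simp add: One_nat_def)
    have "(\<exists>i\<le>Suc c. 1 \<le> i \<and> (\<exists>j\<le>n. gain i j)) \<longleftrightarrow>
        (\<exists>i\<le>c. 1 \<le> i \<and> (\<exists>j\<le>n. gain i j)) \<or> (\<exists>j\<le>n. gain (Suc c) j)"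
      using s1 by (metis le_Suc_eq)
    then have "RD (Suc c) xs1 h1" unfolding RD_def using I(1,3) R rf by (auto simp: r1 R6_def RD_def)
    ultimately show ?case by (simp add: r1 R6_def)
  qed
  have e3: "ev y ?h2 (Pl (S ru) (Mi (K 1) (S rt))) = zeros (take (Suc c) xf)" using zc by simp
  have e4: "ev y ?h3 (Pl (S rv) (S rt)) = ones (take (Suc c) xf)" using oc by simp
  have E: "ev y ?h1 (ne (S rb) (S rf)) = ?t" using rf ne_sym[of "x ! c"] by (simp add: ev_ne)
  show ?thesis
    unfolding READ_def Let_def
    apply (rule wp_Then, rule wp_Read)
    apply (unfold xs list.sel list.case)
    apply (rule wp_Then, rule wp_Set, unfold E)
    subgoal using B0 by simp
    apply (rule wp_Then, rule wp_Set, unfold e3)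
    subgoal using cnt_le[of "Suc c"] by (auto intro!: B0_ge)
    apply (rule wp_Then, rule wp_Set, unfold e4)
    subgoal using cnt_le[of "Suc c"] by (auto intro!: B0_ge)
    apply (rule wp_Then, rule wp_Set)
    subgoal using B0 by simp
    apply (rule wp_Then, rule wp_Set)
    subgoal using B0 by simp
    apply (unfold ev.simps(1))
    apply (rule loop)
    done
qed

definition Xf :: "nat \<Rightarrow> nat \<Rightarrow> nat" where
  "Xf c0 p = (if p < m then of_bool (x ! (c0 + p)) else 2)"

text \<open>Only the first \<open>m\<close> leaves consume the stream; the remaining ones up to
  \<open>k ^ D\<close> receive the padding symbol, whence the minima. The bound on \<open>e0\<close>
  reserves room in the error counter for this subtree.\<close>

definition NODE_spec :: "nat \<Rightarrow> nat \<Rightarrow> nat \<Rightarrow> bool" where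
  "NODE_spec off c0 l \<longleftrightarrow> (\<forall>p e0 xs h. stat off h \<longrightarrow> RD (c0 + min p m) xs h \<longrightarrow> h rcnt 0 = min p m \<longrightarrow>
     h rE 0 = e0 \<longrightarrow> e0 + Suc l * k ^ l \<le> 2 * (D + 2) * N \<longrightarrow>
     wp (NODE Q C D l) (\<lambda>(xs', h'). mods h h' (RN l) \<and> RD (c0 + min (p + k ^ l) m) xs' h' \<and>
       h' rcnt 0 = min (p + k ^ l) m \<and>
       (\<exists>e. node (Xf c0) (Yf off) k C N l p (h' rptr 0) e \<and> h' rE 0 = e0 + e)) (xs, h))"

lemmas NODE_specD = NODE_spec_def[THEN iffD1, rule_format]

lemma stat_RN: "stat off h \<Longrightarrow> mods h h' (RN l) \<Longrightarrow> stat off h'"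
  by (simp add: stat_def mods_def)

lemma E_lt: "v \<le> 2 * (D + 2) * N \<Longrightarrow> v < B0"
proof -
  assume "v \<le> 2 * (D + 2) * N"
  moreover have "2 * (D + 2) * N \<le> 4 * (D + 2) * N" by (intro mult_right_mono) auto
  ultimately show ?thesis using B0_gt by linarith
qed

lemma NODE_leaf_ok:
  assumes c0: "c0 + m \<le> n"
  shows "NODE_spec off c0 0"
  unfolding NODE_spec_def NODE.simps
proof (intro allI impI)
  fix p e0 xs h
  assume st: "stat off h" and R: "RD (c0 + min p m) xs h" and cnt: "h rcnt 0 = min p m" and E: "h rE 0 = e0"
    and e0: "e0 + Suc 0 * k ^ 0 \<le> 2 * (D + 2) * N"
  define c where "c = c0 + min (p + 1) m"
  define P1 where "P1 = (\<lambda>(xs', h'). mods h h' (RR \<union> {rsy, rcnt}) \<and> RD c xs' h' \<and>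
      h' rsy 0 = Xf c0 p \<and> h' rcnt 0 = min (p + 1) m)"
  have first: "wp (Cond (Mi (S rm) (S rcnt)) (READ Q \<triangleright> Set rsy (S rb) \<triangleright> Set rcnt (Pl (S rcnt) (K 1))) (Set rsy (K 2))) P1 (xs, h)"
  proof (rule wp_Cond)
    assume "ev y h (Mi (S rm) (S rcnt)) \<noteq> 0"
    then have pm: "p < m" using st cnt by (auto simp: stat_def)
    have c: "c = Suc (c0 + p)" using pm by (simp add: c_def One_nat_def)
    have R': "RD (c0 + p) xs h" using R pm by simp
    have cn: "c0 + p < n" using c0 pm by simp
    show "wp (READ Q \<triangleright> Set rsy (S rb) \<triangleright> Set rcnt (Pl (S rcnt) (K 1))) P1 (xs, h)"
    proof (rule wp_Then, rule wp_mono[OF READ_ok[OF st R' cn]], simp only: prod.case, elim conjE)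
      fix xs1 h1
      assume o: "ok h1" and m1: "mods h h1 RR" and R1: "RD (Suc (c0 + p)) xs1 h1" and b1: "h1 rb 0 = of_bool (x ! (c0 + p))"
      let ?h2 = "upd h1 rsy 0 (of_bool (x ! (c0 + p)))"
      let ?h3 = "upd ?h2 rcnt 0 (p + 1)"
      have cn1: "h1 rcnt 0 = p" using modsD[OF m1, of rcnt] cnt pm by (simp add: RR_def)
      have "mods h ?h3 (RR \<union> {rsy, rcnt})" using m1 by (simp add: mods_def)
      moreover have "RD c xs1 ?h3" unfolding c by (rule RD_mods[OF R1, of _ "{rsy, rcnt}"]) (simp_all add: mods_def)
      ultimately have "P1 (xs1, ?h3)" using pm by (simp add: P1_def Xf_def min_def One_nat_def)
      moreover have "p + 1 < B0" using pm mn by (intro B0_ge) simp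
      moreover have "of_bool (x ! (c0 + p)) < B0" using B0 by simp
      ultimately show "wp (Set rsy (S rb) \<triangleright> Set rcnt (Pl (S rcnt) (K 1))) P1 (xs1, h1)"
        using cn1 b1 by (intro wp_Then wp_Set) simp_all
    qed
  next
    assume "ev y h (Mi (S rm) (S rcnt)) = 0"
    then have pm: "\<not> p < m" using st cnt by (auto simp: stat_def)
    then have c: "c = c0 + min p m" by (simp add: c_def)
    let ?h = "upd h rsy 0 2"
    have "RD c xs ?h" using R unfolding c by (rule RD_mods[of _ _ _ _ "{rsy}"]) (simp_all add: mods_def)
    then have "P1 (xs, ?h)" using pm cnt by (simp add: P1_def mods_def Xf_def)
    then show "wp (Set rsy (K 2)) P1 (xs, h)" using B0 by (intro wp_Set) simp_all
  qed
  have sub: "RR \<union> {rsy, rcnt} \<subseteq> RN 0" by (auto simp: RR_def)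
  define Inv :: "nat \<Rightarrow> state \<Rightarrow> bool" where "Inv = (\<lambda>i (xs', h'). mods h h' (RN 0) \<and> RD c xs' h' \<and>
     h' rsy 0 = Xf c0 p \<and> h' rcnt 0 = min (p + 1) m \<and> h' rE 0 = e0 \<and> h' rptr 0 \<le> N \<and>
     h' rer 0 = of_bool (\<forall>z\<le>N. i \<le> z \<longrightarrow> Yf off z \<noteq> Xf c0 p) \<and> (h' rer 0 = 0 \<longrightarrow> Yf off (h' rptr 0) = Xf c0 p))"
  have InvI: "Inv i (xs', h')" if "mods h1 h' {rq, rptr, rer}" "Inv i0 (xs', h1)" "h' rptr 0 \<le> N"
    "h' rer 0 = of_bool (\<forall>z\<le>N. i \<le> z \<longrightarrow> Yf off z \<noteq> Xf c0 p)" "h' rer 0 = 0 \<longrightarrow> Yf off (h' rptr 0) = Xf c0 p"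
    for i i0 xs' h' h1
  proof -
    have "mods h h' (RN 0)" using that(1,2) unfolding Inv_def by (auto intro: mods_trans)
    moreover have "RD c xs' h'" using that(1,2) unfolding Inv_def by (auto intro: RD_mods)
    moreover have "h' rsy = h1 rsy" "h' rcnt = h1 rcnt" "h' rE = h1 rE" using that(1) by (simp_all add: mods_def)
    ultimately show ?thesis using that unfolding Inv_def by auto
  qed
  let ?cond = "Cond (ne (Yo (S rq)) (S rsy)) Nop (Set rptr (S rq) \<triangleright> Set rer (K 0))"
  let ?post = "\<lambda>(xs', h'). mods h h' (RN 0) \<and> RD (c0 + min (p + k ^ 0) m) xs' h' \<and> h' rcnt 0 = min (p + k ^ 0) m \<and>
       (\<exists>e. node (Xf c0) (Yf off) k C N 0 p (h' rptr 0) e \<and> h' rE 0 = e0 + e)"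
  have rest: "wp (Set rer (K 1) \<triangleright> Set rptr (K 0) \<triangleright> For rq (Pl (pw (S rk) D) (K 1)) ?cond \<triangleright> Set rE (Pl (S rE) (S rer))) ?post (xs1, h1)"
    if P: "P1 (xs1, h1)" for xs1 h1
  proof -
    have m1: "mods h h1 (RR \<union> {rsy, rcnt})" and R1: "RD c xs1 h1" and sy1: "h1 rsy 0 = Xf c0 p" and cn1: "h1 rcnt 0 = min (p + 1) m"
      using P by (auto simp: P1_def)
    let ?h2 = "upd (upd h1 rer 0 1) rptr 0 0"
    have m2: "mods h ?h2 (RN 0)"
      by (intro mods_upd mods_mono[OF m1 sub]) simp_all
    have R2: "RD c xs1 ?h2" by (rule RD_mods[OF R1, of _ "{rer, rptr}"]) (simp_all add: mods_def)
    have E2: "?h2 rE 0 = e0" using modsD[OF m1, of rE] E by (simp add: RR_def)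
    have rk: "?h2 rk 0 = k" using stat_RN[OF st m2] by (simp add: stat_def)
    have eN: "ev y ?h2 (Pl (pw (S rk) D) (K 1)) = Suc N" using rk by (simp add: N One_nat_def)
    show ?thesis
    proof (rule wp_Then, rule wp_Set, use B0 in simp, rule wp_Then, rule wp_Set, use B0 in simp, rule wp_Then,
        unfold ev.simps(1), rule wp_For[where Inv = Inv], goal_cases)
      case 1
      show ?case unfolding eN by (rule B0_ge) simp
    next
      case 2
      have "mods h (upd ?h2 rq 0 (Suc N)) (RN 0)" by (intro mods_upd[OF m2]) simp
      moreover have "RD c xs1 (upd ?h2 rq 0 (Suc N))" by (rule RD_mods[OF R2, of _ "{rq}"]) (simp_all add: mods_def)
      ultimately show ?case unfolding eN Inv_def using sy1 cn1 E2 by simp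
    next
      case (3 i xs2 h2)
      then have i: "i \<le> N" unfolding eN by simp
      let ?g = "upd h2 rq 0 i"
      have I: "Inv (Suc i) (xs2, h2)" using 3 by simp
      have sg: "stat off ?g" using I st unfolding Inv_def by (auto intro!: stat_RN[OF st] mods_upd)
      have all: "(\<forall>z\<le>N. i \<le> z \<longrightarrow> Yf off z \<noteq> Xf c0 p) \<longleftrightarrow> Yf off i \<noteq> Xf c0 p \<and> (\<forall>z\<le>N. Suc i \<le> z \<longrightarrow> Yf off z \<noteq> Xf c0 p)"
      proof -
        have "i \<le> z \<longleftrightarrow> z = i \<or> Suc i \<le> z" for z by auto
        then show ?thesis using i by auto
      qed
      have I2: "h2 rptr 0 \<le> N" "h2 rer 0 = of_bool (\<forall>z\<le>N. Suc i \<le> z \<longrightarrow> Yf off z \<noteq> Xf c0 p)"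
        "h2 rer 0 = 0 \<longrightarrow> Yf off (h2 rptr 0) = Xf c0 p"
        using I unfolding Inv_def prod.case by blast+
      have g: "?g rsy 0 = Xf c0 p" "?g rq 0 = i" using I by (simp_all add: Inv_def)
      show ?case
      proof (rule wp_Cond, unfold ev_ne_0 ev_Yo[OF sg])
        assume "Yf off (ev y ?g (S rq)) \<noteq> ev y ?g (S rsy)"
        then have "Yf off i \<noteq> Xf c0 p" using g by simp
        then have "(\<forall>z\<le>N. i \<le> z \<longrightarrow> Yf off z \<noteq> Xf c0 p) = (\<forall>z\<le>N. Suc i \<le> z \<longrightarrow> Yf off z \<noteq> Xf c0 p)"
          using all by blast
        then have "Inv i (xs2, ?g)" using I2 by (intro InvI[OF _ I]) (simp_all add: mods_def)
        then show "wp Nop (\<lambda>s'. snd s' rq 0 = i \<and> Inv i s') (xs2, ?g)" by (intro wp_Nop) simp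
      next
        assume "Yf off (ev y ?g (S rq)) = ev y ?g (S rsy)"
        then have y: "Yf off i = Xf c0 p" using g by simp
        let ?g' = "upd (upd ?g rptr 0 i) rer 0 0"
        have "\<not> (\<forall>z\<le>N. i \<le> z \<longrightarrow> Yf off z \<noteq> Xf c0 p)" using all y by blast
        then have "Inv i (xs2, ?g')" using y i by (intro InvI[OF _ I]) (simp_all add: mods_def)
        moreover have "i < B0" using i by (intro B0_ge) simp
        ultimately show "wp (Set rptr (S rq) \<triangleright> Set rer (K 0)) (\<lambda>s'. snd s' rq 0 = i \<and> Inv i s') (xs2, ?g)"
          using B0 by (intro wp_Then wp_Set) simp_all
      qed
    next
      case (4 xs2 h2)
      then have I: "Inv 0 (xs2, h2)" by simp
      let ?e = "h2 rer 0"
      let ?g = "upd h2 rE 0 (e0 + ?e)"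
      have I0: "mods h h2 (RN 0)" "RD c xs2 h2" "h2 rcnt 0 = min (p + 1) m" "h2 rE 0 = e0" "h2 rptr 0 \<le> N"
        "h2 rer 0 = of_bool (\<forall>z\<le>N. 0 \<le> z \<longrightarrow> Yf off z \<noteq> Xf c0 p)"
        "h2 rer 0 = 0 \<longrightarrow> Yf off (h2 rptr 0) = Xf c0 p"
        using I unfolding Inv_def prod.case by blast+
      have e1: "?e \<le> 1" unfolding I0(6) by simp
      have "node (Xf c0) (Yf off) k C N 0 p (h2 rptr 0) ?e"
        unfolding node.simps using I0(5-7) by simp
      moreover have "mods h ?g (RN 0)" by (intro mods_upd I0) simp
      moreover have "RD c xs2 ?g" by (rule RD_mods[OF I0(2), of _ "{rE}"]) (simp_all add: mods_def)
      ultimately have post: "?post (xs2, ?g)" using I0(3) by (auto simp: c_def)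
      have bnd: "e0 + ?e < B0" using e0 e1 by (intro E_lt) (simp add: One_nat_def)
      have ee: "ev y h2 (Pl (S rE) (S rer)) = e0 + ?e" using I0(4) by simp
      show ?case by (rule wp_Set, unfold ee, rule bnd, rule post)
    qed
  qed
  show "wp (Cond (Mi (S rm) (S rcnt)) (READ Q \<triangleright> Set rsy (S rb) \<triangleright> Set rcnt (Pl (S rcnt) (K 1))) (Set rsy (K 2)) \<triangleright>
    Set rer (K 1) \<triangleright> Set rptr (K 0) \<triangleright> For rq (Pl (pw (S rk) D) (K 1)) ?cond \<triangleright> Set rE (Pl (S rE) (S rer))) ?post (xs, h)"
    by (rule wp_Then, rule wp_mono[OF first]) (rule rest)
qed

end

text \<open>The pointer of the root may lead to any segment, so the distance of that segment to the
  block of \<open>y\<close> itself is added to the errors collected in the tree.\<close>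

definition EDIT :: "nat \<Rightarrow> nat \<Rightarrow> nat \<Rightarrow> cmd" where
  "EDIT Q C D = Set rcnt (K 0) \<triangleright> Set rE (K 0) \<triangleright> NODE Q C D D \<triangleright>
    Set (D + 1, 0) (S rptr) \<triangleright> Set (D + 1, 1) (K 0) \<triangleright> Set (D + 1, 2) (pw (S rk) D) \<triangleright>
    AC C D \<triangleright> Set rE (Pl (S rE) (Mi (pw (S rk) D) (S rres)))"

context run
begin

lemma NODE_step_ok:
  assumes IH: "NODE_spec off c0 l" and lD: "Suc l \<le> D"
  shows "NODE_spec off c0 (Suc l)"
  unfolding NODE_spec_def NODE.simps
proof (intro allI impI)
  fix p e0 xs h
  assume st: "stat off h" and R: "RD (c0 + min p m) xs h" and cnt: "h rcnt 0 = min p m" and E: "h rE 0 = e0"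
    and e0: "e0 + Suc (Suc l) * k ^ Suc l \<le> 2 * (D + 2) * N"
  define L where "L = l + 2"
  let ?X = "Xf c0" and ?Y = "Yf off"
  let ?kl = "k ^ Suc l"
  define cm where "cm P z = cmpf (acf ?Y k C l) P k C z (z + ?kl)" for P z
  define c' where "c' = c0 + min (p + ?kl) m"
  have kl: "k ^ l \<le> N" "?kl \<le> N" using kl_le[of l] kl_le[OF lD] lD by linarith+
  have Ln: "L \<noteq> 0" "l + 1 < L" "L \<le> Suc l + 1" by (simp_all add: L_def)
  let ?post = "\<lambda>(xs', h'). mods h h' (RN (Suc l)) \<and> RD (c0 + min (p + k ^ Suc l) m) xs' h' \<and>
       h' rcnt 0 = min (p + k ^ Suc l) m \<and>
       (\<exists>e. node ?X ?Y k C N (Suc l) p (h' rptr 0) e \<and> h' rE 0 = e0 + e)"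
  define Inv1 :: "nat \<Rightarrow> state \<Rightarrow> bool" where
    "Inv1 = (\<lambda>i (xs', h'). mods h h' (RN (Suc l)) \<and> RD (c0 + min (p + (k - i) * k ^ l) m) xs' h' \<and>
      h' rcnt 0 = min (p + (k - i) * k ^ l) m \<and>
      (\<exists>P E. (\<forall>j<k - i. node ?X ?Y k C N l (p + j * k ^ l) (P j) (E j) \<and> h' (L, 4) (k - 1 - j) = P j) \<and>
        h' rE 0 = e0 + (\<Sum>j<k - i. E j)))"
  have rk: "h' rk 0 = k" if "mods h h' (RN (Suc l))" for h'
    using stat_RN[OF st that] by (simp add: stat_def)
  have kAl: "k < Al" using mult_le_mono2[OF C, of k] Al_gt by linarith
  have kB: "k < B0" using mult_le_mono2[OF C, of k] by (intro B0_ge) linarith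
  have step1: "wp (NODE Q C D l \<triangleright> Asg (L, 4) (S (L, 10)) (S rptr)) (\<lambda>s'. snd s' (L, 10) 0 = i \<and> Inv1 i s') (xs1, upd h1 (L, 10) 0 i)"
    if I: "Inv1 (Suc i) (xs1, h1)" and i: "i < k" for i xs1 h1
  proof -
    let ?j = "k - Suc i"
    let ?g = "upd h1 (L, 10) 0 i"
    have kj: "k - i = Suc ?j" using i by simp
    obtain P E where PE: "\<forall>j<?j. node ?X ?Y k C N l (p + j * k ^ l) (P j) (E j) \<and> h1 (L, 4) (k - 1 - j) = P j"
      "h1 rE 0 = e0 + (\<Sum>j<?j. E j)" using I unfolding Inv1_def prod.case by blast
    have m1: "mods h h1 (RN (Suc l))" and R1: "RD (c0 + min (p + ?j * k ^ l) m) xs1 h1" and cn1: "h1 rcnt 0 = min (p + ?j * k ^ l) m"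
      using I unfolding Inv1_def prod.case by blast+
    have mg: "mods h ?g (RN (Suc l))" by (intro mods_upd[OF m1]) (simp add: Ln L_def)
    have "(\<Sum>j<?j. E j) \<le> (\<Sum>j<?j. Suc l * k ^ l)"
      using PE(1) node_err_le by (intro sum_mono) blast
    then have "(\<Sum>j<?j. E j) + Suc l * k ^ l \<le> Suc ?j * (Suc l * k ^ l)" by simp
    also have "\<dots> \<le> k * (Suc l * k ^ l)" using i by (intro mult_right_mono) auto
    also have "\<dots> \<le> Suc (Suc l) * ?kl" by (simp add: algebra_simps)
    finally have eb: "e0 + (\<Sum>j<?j. E j) + Suc l * k ^ l \<le> 2 * (D + 2) * N" using e0 by linarith
    have "wp (NODE Q C D l) (\<lambda>(xs', h'). mods ?g h' (RN l) \<and> RD (c0 + min (p + ?j * k ^ l + k ^ l) m) xs' h' \<and>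
       h' rcnt 0 = min (p + ?j * k ^ l + k ^ l) m \<and>
       (\<exists>e. node ?X ?Y k C N l (p + ?j * k ^ l) (h' rptr 0) e \<and> h' rE 0 = (e0 + (\<Sum>j<?j. E j)) + e)) (xs1, ?g)"
    proof (rule NODE_specD[OF IH])
      show "stat off ?g" by (rule stat_RN[OF st mg])
      show "RD (c0 + min (p + ?j * k ^ l) m) xs1 ?g" by (rule RD_mods[OF R1, of _ "{(L, 10)}"]) (simp_all add: mods_def Ln)
      show "?g rcnt 0 = min (p + ?j * k ^ l) m" using cn1 Ln by simp
      show "?g rE 0 = e0 + (\<Sum>j<?j. E j)" using PE(2) Ln by simp
    qed (rule eb)
    then show ?thesis
    proof (rule wp_Then[OF wp_mono], simp only: prod.case, elim conjE exE)
      fix xs2 h2 e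
      assume o: "ok h2" and m2: "mods ?g h2 (RN l)" and R2: "RD (c0 + min (p + ?j * k ^ l + k ^ l) m) xs2 h2"
        and cn2: "h2 rcnt 0 = min (p + ?j * k ^ l + k ^ l) m"
        and nd: "node ?X ?Y k C N l (p + ?j * k ^ l) (h2 rptr 0) e" and E2: "h2 rE 0 = e0 + (\<Sum>j<?j. E j) + e"
      have L2: "h2 (L, c) = ?g (L, c)" for c using Ln by (intro modsD[OF m2]) simp
      have l10: "h2 (L, 10) 0 = i" by (simp add: L2)
      let ?g2 = "upd h2 (L, 4) i (h2 rptr 0)"
      let ?P = "P(?j := h2 rptr 0)" and ?E = "E(?j := e)"
      have "mods h h2 (RN (Suc l))" by (rule mods_trans[OF mg m2]) (auto simp: RN_def)
      then have a1: "mods h ?g2 (RN (Suc l))" by (intro mods_upd) (simp_all add: L_def)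
      have pj: "p + (k - i) * k ^ l = p + ?j * k ^ l + k ^ l" unfolding kj by simp
      have a2: "RD (c0 + min (p + (k - i) * k ^ l) m) xs2 ?g2"
        unfolding pj by (rule RD_mods[OF R2, of _ "{(L, 4)}"]) (simp_all add: mods_def Ln)
      have a3: "?g2 rcnt 0 = min (p + (k - i) * k ^ l) m" unfolding pj using cn2 Ln by simp
      have a4: "node ?X ?Y k C N l (p + j * k ^ l) (?P j) (?E j) \<and> ?g2 (L, 4) (k - 1 - j) = ?P j" if "j < k - i" for j
      proof (cases "j = ?j")
        case True
        have "k - 1 - j = i" using True i by simp
        then show ?thesis using True nd by simp
      next
        case False
        then have "j < ?j" using that kj by simp
        moreover have "k - 1 - j \<noteq> i" using False that i by auto
        ultimately show ?thesis using PE(1) L2[of 4] False by simp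
      qed
      have "(\<Sum>j<?j. ?E j) = (\<Sum>j<?j. E j)" by (intro sum.cong) auto
      then have a5: "?g2 rE 0 = e0 + (\<Sum>j<k - i. ?E j)" unfolding kj using E2 Ln by simp
      have fin: "snd (xs2, ?g2) (L, 10) 0 = i \<and> Inv1 i (xs2, ?g2)"
      proof -
        have l10': "?g2 (L, 10) 0 = i" using l10 by simp
        have ex: "\<exists>P E. (\<forall>j<k - i. node ?X ?Y k C N l (p + j * k ^ l) (P j) (E j) \<and> ?g2 (L, 4) (k - 1 - j) = P j) \<and>
          ?g2 rE 0 = e0 + (\<Sum>j<k - i. E j)"
          by (rule exI[of _ ?P], rule exI[of _ ?E], rule conjI[OF _ a5], intro allI impI, rule a4, assumption)
        show ?thesis unfolding Inv1_def prod.case snd_conv by (intro conjI l10' a1 a2 a3 ex)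
      qed
      show "wp (Asg (L, 4) (S (L, 10)) (S rptr)) (\<lambda>s'. snd s' (L, 10) 0 = i \<and> Inv1 i s') (xs2, h2)"
        by (rule wp_Asg) (use l10 i kAl ok_lt[OF o] fin in \<open>simp_all\<close>)
    qed
  qed
  define R2 where "R2 = RC l \<union> {(L, c) | c. c \<in> {1, 2, 11, 12, 13}}"
  have R2_RN: "R2 \<subseteq> RN (Suc l)" by (auto simp: R2_def RC_def RA_def L_def RN_def)
  \<comment> \<open>The second alternative describes the initial zeros, before any candidate scores.
    After the last round candidate 0 has been tried as well, so even then the recorded score belongs
    to the recorded pointer.\<close>
  define Inv2 :: "(nat \<Rightarrow> nat) \<Rightarrow> bool list \<Rightarrow> store \<Rightarrow> nat \<Rightarrow> state \<Rightarrow> bool" where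
    "Inv2 P xs3 h3 = (\<lambda>i (xs', h'). xs' = xs3 \<and> mods h3 h' R2 \<and> h' (L, 13) 0 \<le> N \<and>
      (\<forall>z\<le>N. i \<le> z \<longrightarrow> cm P z \<le> h' (L, 12) 0) \<and>
      (h' (L, 12) 0 = cm P (h' (L, 13) 0) \<or> h' (L, 12) 0 = 0 \<and> h' (L, 13) 0 = 0))" for P xs3 h3
  have step2: "wp (Set (L, 1) (S (L, 11)) \<triangleright> Set (L, 2) (Pl (S (L, 11)) (pw (S rk) (Suc l))) \<triangleright>
      CMP C (AC C l) l \<triangleright>
      Cond (Mi (S rres) (S (L, 12))) (Set (L, 12) (S rres) \<triangleright> Set (L, 13) (S (L, 11))) Nop)
      (\<lambda>s'. snd s' (L, 11) 0 = i \<and> Inv2 P xs3 h3 i s') (xs1, upd h1 (L, 11) 0 i)"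
    if I: "Inv2 P xs3 h3 (Suc i) (xs1, h1)" and i: "i \<le> N" and st3: "stat off h3"
      and P: "\<And>j. j < k \<Longrightarrow> h3 (L, 4) (k - 1 - j) = P j \<and> P j \<le> N" for P xs3 h3 i xs1 h1
  proof -
    have I2: "xs1 = xs3" "mods h3 h1 R2" "h1 (L, 13) 0 \<le> N" "\<forall>z\<le>N. Suc i \<le> z \<longrightarrow> cm P z \<le> h1 (L, 12) 0"
      "h1 (L, 12) 0 = cm P (h1 (L, 13) 0) \<or> h1 (L, 12) 0 = 0 \<and> h1 (L, 13) 0 = 0"
      using I unfolding Inv2_def prod.case by blast+
    let ?g0 = "upd h1 (L, 11) 0 i"
    let ?g1 = "upd ?g0 (L, 1) 0 i"
    let ?g2 = "upd ?g1 (L, 2) 0 (i + ?kl)"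
    have m0: "mods h3 ?g2 R2" by (intro mods_upd I2(2)) (auto simp: R2_def)
    have m01: "mods h3 ?g1 R2" by (intro mods_upd I2(2)) (auto simp: R2_def)
    have nR2: "rn \<notin> R2" "rm \<notin> R2" "rk \<notin> R2" "roff \<notin> R2" by (auto simp: R2_def RC_def RA_def L_def)
    have st2: "stat off ?g2" by (rule stat_mods[OF st3 m0 nR2])
    have st1: "stat off ?g1" by (rule stat_mods[OF st3 m01 nR2])
    have e1: "ev y ?g0 (S (L, 11)) = i" by simp
    have e2: "ev y ?g1 (Pl (S (L, 11)) (pw (S rk) (Suc l))) = i + ?kl"
      using st1 by (simp add: stat_def)
    have call: "wp (CMP C (AC C l) l) (\<lambda>(xs', h'). xs' = xs1 \<and> mods ?g2 h' (RC l) \<and> h' rres 0 = cm P i) (xs1, ?g2)"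
      unfolding cm_def
    proof (rule CMP_specD[OF CMP_ok[OF AC_ok] st2])
      show "?g2 (l + 2, 1) 0 = i" "?g2 (l + 2, 2) 0 = i + ?kl" by (simp_all add: L_def)
      show "i + ?kl \<le> 2 * N" using i kl by linarith
      have "(L, 4) \<notin> R2" by (auto simp: R2_def RC_def RA_def L_def)
      then have "?g2 (L, 4) = h3 (L, 4)" by (rule modsD[OF m0])
      then show "?g2 (l + 2, 4) (k - 1 - j) = P j \<and> P j + k ^ l \<le> 2 * N" if "j < k" for j
        using P[OF that] kl(1) unfolding L_def[symmetric] by simp
    qed simp
    have B: "i < B0" "i + ?kl < B0" using i kl by (auto intro!: B0_ge)
    have last: "wp (Cond (Mi (S rres) (S (L, 12))) (Set (L, 12) (S rres) \<triangleright> Set (L, 13) (S (L, 11))) Nop)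
      (\<lambda>s'. snd s' (L, 11) 0 = i \<and> Inv2 P xs3 h3 i s') (xs1, h2)"
      if o: "ok h2" and m2: "mods ?g2 h2 (RC l)" and res: "h2 rres 0 = cm P i" for h2
    proof -
      have nRC: "(L, c) \<notin> RC l" if "10 \<le> c" for c using that by (auto simp: RC_def RA_def L_def)
      have r: "h2 (L, 11) 0 = i" "h2 (L, 12) = h1 (L, 12)" "h2 (L, 13) = h1 (L, 13)"
        using modsD[OF m2 nRC[of 11]] modsD[OF m2 nRC[of 12]] modsD[OF m2 nRC[of 13]] by simp_all
      have m3: "mods h3 h2 R2" by (rule mods_trans[OF m0 m2]) (auto simp: R2_def)
      have all: "(\<forall>z\<le>N. i \<le> z \<longrightarrow> cm P z \<le> b) \<longleftrightarrow> cm P i \<le> b \<and> (\<forall>z\<le>N. Suc i \<le> z \<longrightarrow> cm P z \<le> b)" for b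
      proof -
        have "i \<le> z \<longleftrightarrow> z = i \<or> Suc i \<le> z" for z by auto
        then show ?thesis using i by auto
      qed
      show ?thesis
      proof (rule wp_Cond)
        assume "ev y h2 (Mi (S rres) (S (L, 12))) \<noteq> 0"
        then have gt: "h1 (L, 12) 0 < cm P i" using res r by simp
        let ?h = "upd (upd h2 (L, 12) 0 (cm P i)) (L, 13) 0 i"
        have "mods h3 ?h R2" by (intro mods_upd m3) (auto simp: R2_def)
        moreover have "\<forall>z\<le>N. i \<le> z \<longrightarrow> cm P z \<le> cm P i" unfolding all using I2(4) gt by (meson less_imp_le order_trans order_refl)
        ultimately have "Inv2 P xs3 h3 i (xs1, ?h)" unfolding Inv2_def prod.case using I2(1) i \<open>mods h3 ?h R2\<close> by simp
        moreover have "cm P i < B0" using ok_lt[OF o, of rres 0] res by simp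
        ultimately show "wp (Set (L, 12) (S rres) \<triangleright> Set (L, 13) (S (L, 11))) (\<lambda>s'. snd s' (L, 11) 0 = i \<and> Inv2 P xs3 h3 i s') (xs1, h2)"
          using res r B by (intro wp_Then wp_Set) simp_all
      next
        assume "ev y h2 (Mi (S rres) (S (L, 12))) = 0"
        then have le: "cm P i \<le> h1 (L, 12) 0" using res r by simp
        have "Inv2 P xs3 h3 i (xs1, h2)" unfolding Inv2_def prod.case r all using I2 m3 le by simp
        then show "wp Nop (\<lambda>s'. snd s' (L, 11) 0 = i \<and> Inv2 P xs3 h3 i s') (xs1, h2)"
          using r by (intro wp_Nop) simp
      qed
    qed
    show ?thesis
      apply (rule wp_Then, rule wp_Set, unfold e1, rule B)
      apply (rule wp_Then, rule wp_Set, unfold e2, rule B)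
      apply (rule wp_Then, rule wp_mono[OF call], simp only: prod.case, elim conjE)
      apply (rule last, assumption+)
      done
  qed
  have rest: "wp (Set (L, 12) (K 0) \<triangleright> Set (L, 13) (K 0) \<triangleright>
    For (L, 11) (Pl (pw (S rk) D) (K 1)) (
      Set (L, 1) (S (L, 11)) \<triangleright> Set (L, 2) (Pl (S (L, 11)) (pw (S rk) (Suc l))) \<triangleright>
      CMP C (AC C l) l \<triangleright>
      Cond (Mi (S rres) (S (L, 12))) (Set (L, 12) (S rres) \<triangleright> Set (L, 13) (S (L, 11))) Nop) \<triangleright>
    Set rptr (S (L, 13)) \<triangleright> Set rE (Pl (S rE) (Mi (pw (S rk) (Suc l)) (S (L, 12))))) ?post (xs2, h2)"
    if I: "Inv1 0 (xs2, h2)" for xs2 h2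
  proof -
    obtain P E where PE: "\<forall>j<k. node ?X ?Y k C N l (p + j * k ^ l) (P j) (E j) \<and> h2 (L, 4) (k - 1 - j) = P j"
      "h2 rE 0 = e0 + (\<Sum>j<k. E j)" using I unfolding Inv1_def prod.case diff_zero by blast
    have I1: "mods h h2 (RN (Suc l))" "RD c' xs2 h2" "h2 rcnt 0 = min (p + ?kl) m"
      using I unfolding Inv1_def prod.case c'_def by simp_all
    let ?h3 = "upd (upd h2 (L, 12) 0 0) (L, 13) 0 0"
    have m3: "mods h ?h3 (RN (Suc l))" by (intro mods_upd I1) (simp_all add: L_def)
    have st3: "stat off ?h3" by (rule stat_RN[OF st m3])
    have P3: "?h3 (L, 4) (k - 1 - j) = P j \<and> P j \<le> N" if "j < k" for j
      using PE(1) that node_ptr_le by (auto simp: L_def)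
    have eN: "ev y ?h3 (Pl (pw (S rk) D) (K 1)) = Suc N" using rk[OF m3] by (simp add: N One_nat_def)
    show ?thesis
    proof (rule wp_Then, rule wp_Set, use B0 in simp, rule wp_Then, rule wp_Set, use B0 in simp, rule wp_Then,
        unfold ev.simps(1), rule wp_For[where Inv = "Inv2 P xs2 ?h3"], goal_cases)
      case 1
      show ?case unfolding eN by (rule B0_ge) simp
    next
      case 2
      have "mods ?h3 (upd ?h3 (L, 11) 0 (Suc N)) R2" by (rule mods_upd[OF mods_refl]) (auto simp: R2_def)
      then show ?case unfolding eN Inv2_def prod.case by simp
    next
      case (3 i xs4 h4)
      then show ?case unfolding eN using P3 st3 by (intro step2) simp_all
    next
      case (4 xs4 h4)
      then have o: "ok h4" and I4: "xs4 = xs2" "mods ?h3 h4 R2" "h4 (L, 13) 0 \<le> N" "\<forall>z\<le>N. 0 \<le> z \<longrightarrow> cm P z \<le> h4 (L, 12) 0"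
        "h4 (L, 12) 0 = cm P (h4 (L, 13) 0) \<or> h4 (L, 12) 0 = 0 \<and> h4 (L, 13) 0 = 0"
        unfolding Inv2_def prod.case by blast+
      let ?q = "h4 (L, 13) 0"
      have best: "h4 (L, 12) 0 = cm P ?q"
      proof (rule disjE[OF I4(5)])
        assume z: "h4 (L, 12) 0 = 0 \<and> ?q = 0"
        have "cm P 0 \<le> h4 (L, 12) 0" using I4(4) by simp
        then show ?thesis using z by simp
      qed
      let ?e = "(\<Sum>j<k. E j) + (?kl - cm P ?q)"
      have nd: "node ?X ?Y k C N (Suc l) p ?q ?e"
        unfolding node.simps using PE(1) I4(3,4) best unfolding cm_def by (intro exI[of _ P] exI[of _ E]) simp
      have m4: "mods h h4 (RN (Suc l))" by (rule mods_trans[OF m3 I4(2) R2_RN])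
      let ?h6 = "upd (upd h4 rptr 0 ?q) rE 0 (e0 + ?e)"
      have nR: "rE \<notin> R2" "rcnt \<notin> R2" "ru \<notin> R2" "rv \<notin> R2" "rG \<notin> R2" "rf \<notin> R2"
        by (auto simp: R2_def RC_def RA_def L_def)
      have E4: "h4 rE 0 = e0 + (\<Sum>j<k. E j)" using modsD[OF I4(2) nR(1)] PE(2) Ln by simp
      have "RD c' xs2 ?h3" by (rule RD_mods[OF I1(2), of _ "{(L, 12), (L, 13)}"]) (simp_all add: mods_def Ln)
      then have "RD c' xs2 h4" by (rule RD_mods[OF _ I4(2) nR(3-6)])
      then have "RD c' xs4 ?h6" unfolding I4(1) by (rule RD_mods[of _ _ _ _ "{rptr, rE}"]) (simp_all add: mods_def)
      moreover have "mods h ?h6 (RN (Suc l))" by (intro mods_upd m4) simp_all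
      moreover have "?h6 rcnt 0 = min (p + ?kl) m" using modsD[OF I4(2) nR(2)] I1(3) Ln by simp
      ultimately have post: "?post (xs4, ?h6)" using nd unfolding c'_def prod.case
        by (intro conjI exI[of _ ?e]) simp_all
      have eb: "e0 + ?e < B0" using node_err_le[OF nd] e0 by (intro E_lt) linarith
      have e5: "ev y h4 (S (L, 13)) = ?q" by simp
      have e6: "ev y (upd h4 rptr 0 ?q) (Pl (S rE) (Mi (pw (S rk) (Suc l)) (S (L, 12)))) = e0 + ?e"
        using E4 rk[OF m4] best Ln by simp
      show ?case
        by (rule wp_Then, rule wp_Set, unfold e5, rule ok_lt[OF o], rule wp_Set, unfold e6, rule eb, rule post)
    qed
  qed
  have ek: "ev y h (S rk) = k" using rk[OF mods_refl] by simp
  have ini: "Inv1 k (xs, upd h (L, 10) 0 k)"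
  proof -
    have "mods h (upd h (L, 10) 0 k) (RN (Suc l))" by (intro mods_upd) (simp_all add: L_def)
    moreover have "RD (c0 + min p m) xs (upd h (L, 10) 0 k)" by (rule RD_mods[OF R, of _ "{(L, 10)}"]) (simp_all add: mods_def Ln)
    ultimately show ?thesis unfolding Inv1_def prod.case using cnt E Ln by simp
  qed
  show "wp (For (l + 2, 10) (S rk) (NODE Q C D l \<triangleright> Asg (l + 2, 4) (S (l + 2, 10)) (S rptr)) \<triangleright>
    Set (l + 2, 12) (K 0) \<triangleright> Set (l + 2, 13) (K 0) \<triangleright>
    For (l + 2, 11) (Pl (pw (S rk) D) (K 1)) (
      Set (l + 2, 1) (S (l + 2, 11)) \<triangleright> Set (l + 2, 2) (Pl (S (l + 2, 11)) (pw (S rk) (Suc l))) \<triangleright>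
      CMP C (AC C l) l \<triangleright>
      Cond (Mi (S rres) (S (l + 2, 12))) (Set (l + 2, 12) (S rres) \<triangleright> Set (l + 2, 13) (S (l + 2, 11))) Nop) \<triangleright>
    Set rptr (S (l + 2, 13)) \<triangleright> Set rE (Pl (S rE) (Mi (pw (S rk) (Suc l)) (S (l + 2, 12))))) ?post (xs, h)"
    unfolding L_def[symmetric]
  proof (rule wp_Then, rule wp_For[where Inv = Inv1], goal_cases)
    case 1
    show ?case unfolding ek by (rule kB)
  next
    case 2
    show ?case unfolding ek by (rule ini)
  next
    case (3 i xs1 h1)
    then show ?case unfolding ek by (intro step1)
  next
    case (4 xs1 h1)
    then show ?case by (intro rest)
  qed
qed

lemma NODE_ok: "c0 + m \<le> n \<Longrightarrow> l \<le> D \<Longrightarrow> NODE_spec off c0 l"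
  by (induction l) (auto intro: NODE_leaf_ok NODE_step_ok)

definition edit_error :: "nat \<Rightarrow> nat \<Rightarrow> nat \<Rightarrow> bool" where
  "edit_error c0 off E \<longleftrightarrow> (\<exists>q e. node (Xf c0) (Yf off) k C N D 0 q e \<and> E = e + (N - acf (Yf off) k C D q 0 N))"

lemma EDIT_ok:
  assumes st: "stat off h" and R: "RD c0 xs h" and c0: "c0 + m \<le> n" and mN: "m \<le> N"
  shows "wp (EDIT Q C D) (\<lambda>(xs', h'). mods h h' (RN D) \<and> RD (c0 + m) xs' h' \<and> edit_error c0 off (h' rE 0)) (xs, h)"
    (is "wp _ ?post _")
proof -
  let ?h1 = "upd (upd h rcnt 0 0) rE 0 0"
  have m1: "mods h ?h1 (RN D)" by (intro mods_upd) simp_all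
  have "RD c0 xs ?h1" by (rule RD_mods[OF R, of _ "{rcnt, rE}"]) (simp_all add: mods_def)
  then have nd: "wp (NODE Q C D D) (\<lambda>(xs', h'). mods ?h1 h' (RN D) \<and> RD (c0 + min (0 + k ^ D) m) xs' h' \<and>
       h' rcnt 0 = min (0 + k ^ D) m \<and>
       (\<exists>e. node (Xf c0) (Yf off) k C N D 0 (h' rptr 0) e \<and> h' rE 0 = 0 + e)) (xs, ?h1)"
    by (intro NODE_specD[OF NODE_ok[OF c0 order_refl]] stat_RN[OF st m1]) (simp_all add: N)
  have rest: "wp (Set (D + 1, 0) (S rptr) \<triangleright> Set (D + 1, 1) (K 0) \<triangleright> Set (D + 1, 2) (pw (S rk) D) \<triangleright>
    AC C D \<triangleright> Set rE (Pl (S rE) (Mi (pw (S rk) D) (S rres)))) ?post (xs2, h2)"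
    if o: "ok h2" and m2: "mods ?h1 h2 (RN D)" and R2: "RD (c0 + min (0 + k ^ D) m) xs2 h2"
      and nd: "node (Xf c0) (Yf off) k C N D 0 (h2 rptr 0) e" and E: "h2 rE 0 = 0 + e" for xs2 h2 e
  proof -
    have mh2: "mods h h2 (RN D)" by (rule mods_trans[OF m1 m2 order_refl])
    let ?q = "h2 rptr 0"
    let ?g2 = "upd (upd h2 (D + 1, 0) 0 ?q) (D + 1, 1) 0 0"
    let ?g3 = "upd ?g2 (D + 1, 2) 0 N"
    have mg2: "mods h ?g2 (RN D)" by (intro mods_upd mh2) simp_all
    have mg3: "mods h ?g3 (RN D)" by (intro mods_upd mh2) simp_all
    have rk: "h' rk 0 = k" if "mods h h' (RN D)" for h' using stat_RN[OF st that] by (simp add: stat_def)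
    have e2: "ev y ?g2 (pw (S rk) D) = N" using rk[OF mg2] by (simp add: N)
    have e1: "ev y h2 (S rptr) = ?q" by simp
    have q: "?q \<le> N" using node_ptr_le[OF nd] .
    have call: "wp (AC C D) (\<lambda>(xs', h'). xs' = xs2 \<and> mods ?g3 h' (RA D) \<and> h' rres 0 = acf (Yf off) k C D ?q 0 N) (xs2, ?g3)"
      using q by (intro AC_specD[OF AC_ok stat_RN[OF st mg3]]) (simp_all add: N)
    have last: "wp (Set rE (Pl (S rE) (Mi (pw (S rk) D) (S rres)))) ?post (xs2, h4)"
      if m4: "mods ?g3 h4 (RA D)" and res: "h4 rres 0 = acf (Yf off) k C D ?q 0 N" for h4
    proof -
      have mh4: "mods h h4 (RN D)" by (rule mods_trans[OF mg3 m4]) (auto simp: RA_def)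
      let ?v = "e + (N - acf (Yf off) k C D ?q 0 N)"
      have "h4 rE = h2 rE" using modsD[OF m4, of rE] by (simp add: RA_def)
      then have ee: "ev y h4 (Pl (S rE) (Mi (pw (S rk) D) (S rres))) = ?v" using E res rk[OF mh4] by (simp add: N)
      have "e \<le> (D + 1) * N" using node_err_le[OF nd] by (simp add: N algebra_simps)
      moreover have "(D + 2) * N = (D + 1) * N + N" by (simp add: algebra_simps)
      ultimately have "?v \<le> (D + 2) * N" by linarith
      moreover have "(D + 2) * N \<le> 2 * (D + 2) * N" by (intro mult_right_mono) auto
      ultimately have b: "?v < B0" by (intro E_lt) linarith
      let ?h5 = "upd h4 rE 0 ?v"
      have mm: "min (0 + k ^ D) m = m" using mN by (simp add: N)
      have "RD (c0 + m) xs2 ?g3"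
        by (rule RD_mods[OF R2[unfolded mm], of _ "{(D + 1, 0), (D + 1, 1), (D + 1, 2)}"]) (simp_all add: mods_def)
      then have "RD (c0 + m) xs2 h4" by (rule RD_mods[OF _ m4]) (simp_all add: RA_def)
      then have "RD (c0 + m) xs2 ?h5" by (rule RD_mods[of _ _ _ _ "{rE}"]) (simp_all add: mods_def)
      moreover have "mods h ?h5 (RN D)" by (intro mods_upd mh4) simp
      moreover have "edit_error c0 off ?v" unfolding edit_error_def using nd by blast
      ultimately have post: "?post (xs2, ?h5)" by simp
      show ?thesis by (rule wp_Set, unfold ee, rule b, rule post)
    qed
    have NB: "N < B0" by (rule B0_ge) simp
    show ?thesis
      apply (rule wp_Then, rule wp_Set, unfold e1, rule ok_lt[OF o])
      apply (rule wp_Then, rule wp_Set, use B0 in simp, unfold ev.simps(1))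
      apply (rule wp_Then, rule wp_Set, unfold e2, rule NB)
      apply (rule wp_Then, rule wp_mono[OF call], simp only: prod.case, elim conjE)
      apply (rule last, assumption+)
      done
  qed
  show ?thesis
    unfolding EDIT_def
    apply (rule wp_Then, rule wp_Set, use B0 in simp, unfold ev.simps(1))
    apply (rule wp_Then, rule wp_Set, use B0 in simp, unfold ev.simps(1))
    apply (rule wp_Then, rule wp_mono[OF nd], simp only: prod.case, elim conjE exE)
    apply (rule rest, assumption+)
    done
qed

end

section \<open>Preprocessing, output and the main program\<close>

definition PRE :: "nat \<Rightarrow> cmd" where
  "PRE D = For ri (S rn) (Set rm (Pl (S rm) (Inp (S ri)))) \<triangleright>
    Cond (Mi (Pl (S rn) (K 1)) (Ti (K 2) (S rm))) Nop (Set rf (K 1) \<triangleright> Set rm (Mi (S rn) (S rm))) \<triangleright>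
    For ri (Pl (S rm) (K 1))
      (Cond (Mi (Pl (pw (Pl (S ri) (K 1)) D) (K 1)) (S rm)) (Set rk (Pl (S ri) (K 1))) Nop)"

text \<open>Products act as conjunctions, sums as disjunctions, and \<open>m + 1 - e\<close> is
  nonzero exactly if \<open>e\<close> is at most \<open>m\<close>. The first factor is the balance
  test, without which neither the flag nor the errors of the ends are conclusive.\<close>

definition OUT :: "nat \<Rightarrow> nat \<Rightarrow> nat \<Rightarrow> cmd" where
  "OUT Q q Z = (let nm = Mi (S rn) (S rm); a = mn (S ru) nm; b = mn (Mi (S rn) (S ru)) (S rm);
      m1 = Pl (S rm) (K 1) in
    Cond (Ti (Mi m1 (Ti (K Q) (ne (S ru) (S rm))))
        (Pl (S rG) (Pl (Mi m1 (Ti (K q) (S rL))) (Mi m1 (Ti (K q) (S rE))))))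
      (Set rn (Pl a b))
      (Set rn (Dv (Ti (K (2 * Z - 1)) (mx a b)) (K Z))))"

text \<open>As \<open>2 * m\<close> is at most \<open>n\<close>, the two end blocks are disjoint;
  the symbols between them are read merely to test the cuts.\<close>

definition BODY :: "nat \<Rightarrow> nat \<Rightarrow> nat \<Rightarrow> nat \<Rightarrow> nat \<Rightarrow> cmd" where
  "BODY Q q Z C D = EDIT Q C D \<triangleright> Set rL (S rE) \<triangleright> For ri (Mi (S rn) (Ti (K 2) (S rm))) (READ Q) \<triangleright>
    Set roff (Mi (S rn) (S rm)) \<triangleright> EDIT Q C D \<triangleright> OUT Q q Z"

definition flipped :: "bool list \<Rightarrow> bool" where "flipped y \<longleftrightarrow> length y < 2 * ones y"
definition minority :: "bool list \<Rightarrow> nat" where "minority y = (if flipped y then zeros y else ones y)"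
definition kval :: "nat \<Rightarrow> nat \<Rightarrow> nat" where "kval D m = (LEAST k. 1 \<le> k \<and> m \<le> k ^ D)"

lemma (in machine) PRE_ok:
  assumes D: "1 \<le> D" and B: "2 * length y + 10 \<le> B0"
    and h: "h rn 0 = length y" "h rm 0 = 0" "h rf 0 = 0"
  shows "wp (PRE D) (\<lambda>(xs', h'). xs' = xs \<and> mods h h' {ri, rm, rf, rk} \<and> h' rm 0 = minority y \<and>
    h' rf 0 = of_bool (flipped y) \<and> h' rk 0 = kval D (minority y)) (xs, h)" (is "wp _ ?post _")
proof -
  let ?n = "length y"
  define Inv1 :: "nat \<Rightarrow> state \<Rightarrow> bool" where
    "Inv1 = (\<lambda>i (xs', h'). xs' = xs \<and> mods h h' {ri, rm} \<and> h' rm 0 = ones (drop i y))"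
  define R3 where "R3 = {ri, rm, rf}"
  define P where "P = (\<lambda>(xs', h'). xs' = xs \<and> mods h h' R3 \<and> h' rm 0 = minority y \<and> h' rf 0 = of_bool (flipped y))"
  let ?m = "minority y"
  have on: "ones y \<le> ?n" "zeros y \<le> ?n" "?m \<le> ?n"
    using length_filter_le[of id y] length_filter_le[of Not y] by (auto simp: minority_def)
  have zo: "?n - ones y = zeros y" using zeros_ones[of y] by simp
  have sec: "wp (Cond (Mi (Pl (S rn) (K 1)) (Ti (K 2) (S rm))) Nop (Set rf (K 1) \<triangleright> Set rm (Mi (S rn) (S rm)))) P (xs, h1)"
    if m1: "mods h h1 {ri, rm}" and o: "h1 rm 0 = ones y" for h1
  proof (rule wp_Cond)
    have n1: "h1 rn 0 = ?n" "h1 rf 0 = 0" using m1 h by (simp_all add: mods_def)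
    have m3: "mods h h1 R3" by (rule mods_mono[OF m1]) (auto simp: R3_def)
    {
      assume "ev y h1 (Mi (Pl (S rn) (K 1)) (Ti (K 2) (S rm))) \<noteq> 0"
      then have "\<not> flipped y" using n1 o by (simp add: flipped_def)
      then have "P (xs, h1)" using m3 n1 o by (simp add: P_def minority_def)
      then show "wp Nop P (xs, h1)" by (rule wp_Nop)
    next
      assume "ev y h1 (Mi (Pl (S rn) (K 1)) (Ti (K 2) (S rm))) = 0"
      then have fl: "flipped y" using n1 o by (simp add: flipped_def)
      let ?h = "upd (upd h1 rf 0 1) rm 0 (zeros y)"
      have "mods h ?h R3" by (intro mods_upd m3) (simp_all add: R3_def)
      then have "P (xs, ?h)" using fl by (simp add: P_def minority_def)
      then show "wp (Set rf (K 1) \<triangleright> Set rm (Mi (S rn) (S rm))) P (xs, h1)"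
        using n1 o zo B on by (intro wp_Then wp_Set) simp_all
    }
  qed
  \<comment> \<open>The search runs downwards and overwrites \<open>rk\<close> at each success, so
    the least admissible value among those tried remains.\<close>
  define Inv2 :: "nat \<Rightarrow> state \<Rightarrow> bool" where
    "Inv2 = (\<lambda>i (xs', h'). xs' = xs \<and> mods h h' {ri, rm, rf, rk} \<and> h' rm 0 = ?m \<and> h' rf 0 = of_bool (flipped y) \<and>
      (i \<le> ?m \<longrightarrow> h' rk 0 = (LEAST k. Suc i \<le> k \<and> ?m \<le> k ^ D)))"
  have third: "wp (For ri (Pl (S rm) (K 1))
      (Cond (Mi (Pl (pw (Pl (S ri) (K 1)) D) (K 1)) (S rm)) (Set rk (Pl (S ri) (K 1))) Nop)) ?post (xs2, h2)"
    if P2: "P (xs2, h2)" for xs2 h2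
  proof -
    have I: "xs2 = xs" "mods h h2 R3" "h2 rm 0 = ?m" "h2 rf 0 = of_bool (flipped y)" using P2 by (auto simp: P_def)
    have e: "ev y h2 (Pl (S rm) (K 1)) = Suc ?m" using I by (simp add: One_nat_def)
    show ?thesis
    proof (rule wp_For[where Inv = Inv2], goal_cases)
      case 1
      show ?case unfolding e using on B by simp
    next
      case 2
      have "mods h (upd h2 ri 0 (Suc ?m)) {ri, rm, rf, rk}"
        by (intro mods_upd mods_mono[OF I(2)]) (auto simp: R3_def)
      then show ?case unfolding e Inv2_def prod.case using I by simp
    next
      case (3 i xs3 h3)
      then have i: "i \<le> ?m" unfolding e by simp
      have J: "xs3 = xs" "mods h h3 {ri, rm, rf, rk}" "h3 rm 0 = ?m" "h3 rf 0 = of_bool (flipped y)"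
        "Suc i \<le> ?m \<longrightarrow> h3 rk 0 = (LEAST k. Suc (Suc i) \<le> k \<and> ?m \<le> k ^ D)"
        using 3(3) unfolding Inv2_def prod.case by blast+
      let ?g = "upd h3 ri 0 i"
      have mg: "mods h ?g {ri, rm, rf, rk}" by (intro mods_upd J) simp
      show ?case
      proof (rule wp_Cond)
        assume "ev y ?g (Mi (Pl (pw (Pl (S ri) (K 1)) D) (K 1)) (S rm)) \<noteq> 0"
        then have ge: "?m \<le> Suc i ^ D" using J(3) by (simp add: One_nat_def)
        have L: "(LEAST k. Suc i \<le> k \<and> ?m \<le> k ^ D) = Suc i" using ge by (intro Least_equality) auto
        let ?g' = "upd ?g rk 0 (Suc i)"
        have "mods h ?g' {ri, rm, rf, rk}" by (intro mods_upd J) simp_all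
        then have "Inv2 i (xs3, ?g')" unfolding Inv2_def prod.case using J L by simp
        then show "wp (Set rk (Pl (S ri) (K 1))) (\<lambda>s'. snd s' ri 0 = i \<and> Inv2 i s') (xs3, ?g)"
          using i on B by (intro wp_Set) (simp_all add: One_nat_def)
      next
        assume "ev y ?g (Mi (Pl (pw (Pl (S ri) (K 1)) D) (K 1)) (S rm)) = 0"
        then have lt: "\<not> ?m \<le> Suc i ^ D" using J(3) by (simp add: One_nat_def)
        \<comment> \<open>The first value tried, \<open>Suc ?m\<close>, always succeeds, so a
          failure can only occur later, when \<open>rk\<close> has been set.\<close>
        have "Suc i \<le> ?m"
        proof (rule ccontr)
          assume "\<not> ?thesis"
          then have "?m \<le> Suc i" by simp
          also have "\<dots> \<le> Suc i ^ D" using D by (intro self_le_power) auto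
          finally show False using lt by simp
        qed
        moreover have "(Suc i \<le> k \<and> ?m \<le> k ^ D) = (Suc (Suc i) \<le> k \<and> ?m \<le> k ^ D)" for k
          using lt by (cases "k = Suc i") auto
        ultimately have "h3 rk 0 = (LEAST k. Suc i \<le> k \<and> ?m \<le> k ^ D)" using J(5) by simp
        then have "Inv2 i (xs3, ?g)" unfolding Inv2_def prod.case using J mg by simp
        then show "wp Nop (\<lambda>s'. snd s' ri 0 = i \<and> Inv2 i s') (xs3, ?g)" by (intro wp_Nop) simp
      qed
    next
      case (4 xs3 h3)
      then show ?case unfolding Inv2_def prod.case kval_def by (simp add: One_nat_def)
    qed
  qed
  have e: "ev y h (S rn) = ?n" using h by simp
  show ?thesis
    unfolding PRE_def
  proof (rule wp_Then, rule wp_For[where Inv = Inv1], goal_cases)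
    case 1
    show ?case unfolding e using B by simp
  next
    case 2
    show ?case unfolding e Inv1_def using h by (simp add: mods_def)
  next
    case (3 i xs1 h1)
    then have i: "i < ?n" unfolding e by simp
    have J: "xs1 = xs" "mods h h1 {ri, rm}" "h1 rm 0 = ones (drop (Suc i) y)"
      using 3(3) unfolding Inv1_def prod.case by blast+
    have d: "ones (drop i y) = of_bool (y ! i) + ones (drop (Suc i) y)"
      by (subst Cons_nth_drop_Suc[OF i, symmetric]) simp
    let ?g = "upd (upd h1 ri 0 i) rm 0 (ones (drop i y))"
    have "mods h ?g {ri, rm}" by (intro mods_upd J) simp_all
    then have I: "snd (xs1, ?g) ri 0 = i \<and> Inv1 i (xs1, ?g)" unfolding Inv1_def prod.case using J by simp
    have ee: "ev y (upd h1 ri 0 i) (Pl (S rm) (Inp (S ri))) = ones (drop i y)" using J i d by simp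
    have "ones (drop i y) \<le> ?n" using length_filter_le[of id "drop i y"] by simp
    then have b: "ones (drop i y) < B0" using B by linarith
    show ?case by (rule wp_Set, unfold ee, rule b, rule I)
  next
    case (4 xs1 h1)
    then have J: "xs1 = xs" "mods h h1 {ri, rm}" "h1 rm 0 = ones y" by (simp_all add: Inv1_def)
    show ?case unfolding J(1) by (rule wp_Then, rule wp_mono[OF sec[OF J(2,3)]], rule third)
  qed
qed

context run
begin

definition outv :: "nat \<Rightarrow> nat \<Rightarrow> nat \<Rightarrow> nat \<Rightarrow> nat" where
  "outv q Z EL ER = (let U = zeros xf; a = min U (n - m); b = min (n - U) m in
    if Q * ((U - m) + (m - U)) \<le> m \<and> ((\<exists>i\<le>n. 1 \<le> i \<and> (\<exists>j\<le>n. gain i j)) \<or> q * EL \<le> m \<or> q * ER \<le> m)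
    then a + b else (2 * Z - 1) * max a b div Z)"

lemma BODY_ok:
  assumes st: "stat 0 h" and R: "RD 0 xs h" and mN: "m \<le> N" and m2: "2 * m \<le> n" and Z: "1 \<le> Z"
  shows "wp (BODY Q q Z C D) (\<lambda>(xs', h'). \<exists>EL ER. edit_error 0 0 EL \<and> edit_error (n - m) (n - m) ER \<and>
    h' rn 0 = outv q Z EL ER) (xs, h)" (is "wp _ ?post _")
proof -
  have nRN: "rn \<notin> RN D" "rm \<notin> RN D" "rk \<notin> RN D" "rL \<notin> RN D" "rf \<notin> RN D" by simp_all
  have out: "wp (OUT Q q Z) ?post (xs5, h5)"
    if st5: "stat off h5" and R5: "RD (n - m + m) xs5 h5" and EL: "edit_error 0 0 (h5 rL 0)" and ER: "edit_error (n - m) (n - m) (h5 rE 0)"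
    for off xs5 h5
  proof -
    let ?U = "zeros xf" and ?nm = "Mi (S rn) (S rm)" and ?m1 = "Pl (S rm) (K 1)"
    let ?a = "min ?U (n - m)" and ?b = "min (n - ?U) m"
    have nn: "n - m + m = n" using mn by simp
    have v: "h5 rn 0 = n" "h5 rm 0 = m" "h5 ru 0 = ?U" "h5 rG 0 \<noteq> 0 \<longleftrightarrow> (\<exists>i\<le>n. 1 \<le> i \<and> (\<exists>j\<le>n. gain i j))"
      using st5 R5[unfolded nn] by (simp_all add: stat_def RD_def)
    have ea: "ev y h5 (mn (S ru) ?nm) = ?a" "ev y h5 (mn (Mi (S rn) (S ru)) (S rm)) = ?b" using v by simp_all
    have ez: "(Suc a - b \<noteq> 0) = (b \<le> a)" for a b :: nat by auto
    let ?c = "Ti (Mi ?m1 (Ti (K Q) (ne (S ru) (S rm)))) (Pl (S rG) (Pl (Mi ?m1 (Ti (K q) (S rL))) (Mi ?m1 (Ti (K q) (S rE)))))"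
    have ec: "ev y h5 ?c \<noteq> 0 \<longleftrightarrow> Q * ((?U - m) + (m - ?U)) \<le> m \<and>
      ((\<exists>i\<le>n. 1 \<le> i \<and> (\<exists>j\<le>n. gain i j)) \<or> q * h5 rL 0 \<le> m \<or> q * h5 rE 0 \<le> m)"
      unfolding v(4)[symmetric] using v(1-3) by (simp add: ev_ne One_nat_def) auto
    show ?thesis unfolding OUT_def Let_def
    proof (rule wp_Cond)
      assume "ev y h5 ?c \<noteq> 0"
      then have ov: "outv q Z (h5 rL 0) (h5 rE 0) = ?a + ?b" unfolding ec outv_def Let_def by (rule if_P)
      have b: "?a + ?b < B0" using mn by (intro B0_ge) simp
      have post: "?post (xs5, upd h5 rn 0 (?a + ?b))" unfolding prod.case by (rule exI[of _ "h5 rL 0"], rule exI[of _ "h5 rE 0"]) (simp add: EL ER ov)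
      have ee: "ev y h5 (Pl (mn (S ru) ?nm) (mn (Mi (S rn) (S ru)) (S rm))) = ?a + ?b" using ea by (simp only: ev.simps)
      show "wp (Set rn (Pl (mn (S ru) ?nm) (mn (Mi (S rn) (S ru)) (S rm)))) ?post (xs5, h5)"
        by (rule wp_Set, unfold ee, rule b, rule post)
    next
      assume "ev y h5 ?c = 0"
      then have ov: "outv q Z (h5 rL 0) (h5 rE 0) = (2 * Z - 1) * max ?a ?b div Z"
        using ec unfolding outv_def Let_def by (intro if_not_P) blast
      have "(2 * Z - 1) * max ?a ?b div Z \<le> (2 * Z) * n div Z" using mn by (intro div_le_mono mult_le_mono) auto
      also have "\<dots> = 2 * n" using Z by simp
      finally have b: "(2 * Z - 1) * max ?a ?b div Z < B0" by (intro B0_ge) simp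
      have post: "?post (xs5, upd h5 rn 0 ((2 * Z - 1) * max ?a ?b div Z))" unfolding prod.case by (rule exI[of _ "h5 rL 0"], rule exI[of _ "h5 rE 0"]) (simp add: EL ER ov)
      have ee: "ev y h5 (Dv (Ti (K (2 * Z - 1)) (mx (mn (S ru) ?nm) (mn (Mi (S rn) (S ru)) (S rm)))) (K Z)) = (2 * Z - 1) * max ?a ?b div Z"
        using ea by (simp only: ev.simps ev_mx)
      show "wp (Set rn (Dv (Ti (K (2 * Z - 1)) (mx (mn (S ru) ?nm) (mn (Mi (S rn) (S ru)) (S rm)))) (K Z))) ?post (xs5, h5)"
        by (rule wp_Set, unfold ee, rule b, rule post)
    qed
  qed
  have part2: "wp (Set roff (Mi (S rn) (S rm)) \<triangleright> EDIT Q C D \<triangleright> OUT Q q Z) ?post (xs3, h3)"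
    if st3: "stat 0 h3" and R3: "RD (n - m) xs3 h3" and EL: "edit_error 0 0 (h3 rL 0)" for xs3 h3
  proof -
    let ?h4 = "upd h3 roff 0 (n - m)"
    have e: "ev y h3 (Mi (S rn) (S rm)) = n - m" using st3 by (simp add: stat_def)
    have st4: "stat (n - m) ?h4" using st3 by (simp add: stat_def)
    have R4: "RD (n - m) xs3 ?h4" by (rule RD_mods[OF R3, of _ "{roff}"]) (simp_all add: mods_def)
    have c0: "n - m + m \<le> n" using mn by simp
    have b: "n - m < B0" by (intro B0_ge) simp
    show ?thesis
      apply (rule wp_Then, rule wp_Set, unfold e, rule b)
      apply (rule wp_Then, rule wp_mono[OF EDIT_ok[OF st4 R4 c0 mN]], simp only: prod.case, elim conjE)
      apply (rule out[of "n - m"])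
      subgoal for xs h by (rule stat_RN[OF st4])
      subgoal by assumption
      subgoal for xs h using EL modsD[OF _ nRN(4), of ?h4 h] by simp
      subgoal by assumption
      done
  qed
  define Inv :: "store \<Rightarrow> nat \<Rightarrow> state \<Rightarrow> bool" where
    "Inv h2 = (\<lambda>i (xs', h'). mods h2 h' (RR \<union> {ri}) \<and> RD (n - m - i) xs' h')" for h2
  have part1: "wp (Set rL (S rE) \<triangleright> For ri (Mi (S rn) (Ti (K 2) (S rm))) (READ Q) \<triangleright>
    Set roff (Mi (S rn) (S rm)) \<triangleright> EDIT Q C D \<triangleright> OUT Q q Z) ?post (xs1, h1)"
    if o: "ok h1" and m1: "mods h h1 (RN D)" and R1: "RD (0 + m) xs1 h1" and E: "edit_error 0 0 (h1 rE 0)" for xs1 h1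
  proof -
    let ?h2 = "upd h1 rL 0 (h1 rE 0)"
    have st2: "stat 0 ?h2" using stat_RN[OF st m1] by (simp add: stat_def)
    have R2: "RD m xs1 ?h2" by (rule RD_mods[OF R1[simplified], of _ "{rL}"]) (simp_all add: mods_def)
    have e: "ev y ?h2 (Mi (S rn) (Ti (K 2) (S rm))) = n - 2 * m" using st2 by (simp add: stat_def)
    have e1: "ev y h1 (S rE) = h1 rE 0" by simp
    have stI: "stat 0 h'" if "mods ?h2 h' (RR \<union> {ri})" for h'
      by (rule stat_mods[OF st2 that]) (simp_all add: RR_def)
    show ?thesis
    proof (rule wp_Then, rule wp_Set, unfold e1, rule ok_lt[OF o], rule wp_Then, rule wp_For[where Inv = "Inv ?h2"], goal_cases)
      case 1
      show ?case unfolding e by (rule B0_ge) simp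
    next
      case 2
      have "n - m - (n - 2 * m) = m" using m2 by simp
      moreover have "RD m xs1 (upd ?h2 ri 0 (n - 2 * m))" by (rule RD_mods[OF R2, of _ "{ri}"]) (simp_all add: mods_def)
      moreover have "mods ?h2 (upd ?h2 ri 0 (n - 2 * m)) (RR \<union> {ri})" by (rule mods_upd[OF mods_refl]) simp
      ultimately show ?case unfolding e Inv_def prod.case by simp
    next
      case (3 i xs3 h3)
      then have i: "Suc i \<le> n - 2 * m" unfolding e by simp
      let ?c = "n - m - Suc i"
      have I: "mods ?h2 h3 (RR \<union> {ri})" "RD ?c xs3 h3" using 3(3) unfolding Inv_def by simp_all
      let ?g = "upd h3 ri 0 i"
      have mg: "mods ?h2 ?g (RR \<union> {ri})" by (intro mods_upd I) simp
      have Rg: "RD ?c xs3 ?g" by (rule RD_mods[OF I(2), of _ "{ri}"]) (simp_all add: mods_def)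
      have cn: "?c < n" and Sc: "Suc ?c = n - m - i" using i by auto
      show ?case
      proof (rule wp_mono[OF READ_ok[OF stI[OF mg] Rg cn]], simp only: prod.case, elim conjE, intro conjI)
        fix xs4 h4 assume m4: "mods ?g h4 RR" and R4: "RD (Suc ?c) xs4 h4"
        show "snd (xs4, h4) ri 0 = i" using modsD[OF m4, of ri] by (simp add: RR_def)
        show "Inv ?h2 i (xs4, h4)" unfolding Inv_def prod.case using mods_trans[OF mg m4 Un_upper1] R4 unfolding Sc by (rule conjI)
      qed
    next
      case (4 xs3 h3)
      then have I: "mods ?h2 h3 (RR \<union> {ri})" "RD (n - m) xs3 h3" unfolding Inv_def by simp_all
      have "h3 rL = ?h2 rL" by (rule modsD[OF I(1)]) (simp add: RR_def)
      then have "edit_error 0 0 (h3 rL 0)" using E by simp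
      then show ?case by (intro part2 stI I)
    qed
  qed
  have "0 + m \<le> n" using mn by simp
  show ?thesis
    unfolding BODY_def
    apply (rule wp_Then, rule wp_mono[OF EDIT_ok[OF st R \<open>0 + m \<le> n\<close> mN]], simp only: prod.case, elim conjE)
    apply (rule part1, assumption+)
    done
qed

end

section \<open>Correctness of the output\<close>

lemma zeros_rev [simp]: "zeros (rev x) = zeros x" and ones_rev [simp]: "ones (rev x) = ones x"
  by (simp_all add: rev_filter[symmetric])

text \<open>After the nearly equal prefixes, either zeros or ones can be matched in the rest, about
  m - u or m - w of them, where u and w count the zeros and the ones in the prefixes of
  \<open>x\<close> and \<open>y\<close>. The average of the two totals is m + (2m - u - w)/2, about
  3m/2 at least, since u + w can hardly exceed m. The factor 13/10 leaves room for the
  errors.\<close>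

lemma prefix_gain:
  assumes len: "length x = n" "length y = n" and o: "ones y = m" and mn: "2 * m \<le> n"
    and U: "1000 * (zeros x - m) \<le> m" "1000 * (m - zeros x) \<le> m"
    and E: "m \<le> lcs (take m x) (take m y) + E" "20 * E \<le> m"
  shows "13 * m \<le> 10 * lcs x y"
proof -
  let ?t = "lcs (take m x) (take m y)" and ?u = "zeros (take m x)" and ?w = "ones (take m y)"
  let ?v = "ones (take m x)" and ?s = "zeros (take m y)"
  let ?zr = "min (zeros (drop m x)) (zeros (drop m y))" and ?or = "min (ones (drop m x)) (ones (drop m y))"
  have l: "?u + ?v = m" "?w + ?s = m"
    using zeros_ones[of "take m x"] zeros_ones[of "take m y"] len mn by auto
  have d: "?u + zeros (drop m x) = zeros x" "?v + ones (drop m x) = ones x"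
     "?s + zeros (drop m y) = zeros y" "?w + ones (drop m y) = m"
    using zeros_take_drop[of m x] ones_take_drop[of m x] zeros_take_drop[of m y] ones_take_drop[of m y] o by auto
  have tot: "zeros x + ones x = n" "zeros y + m = n" using zeros_ones[of x] zeros_ones[of y] len o by auto
  have t: "?t \<le> min ?u ?s + min ?v ?w" by (rule lcs_le_zeros_ones)
  have t1: "?t \<le> ?u + ?w" "?t \<le> ?s + ?v" using t by linarith+
  have big1: "?t + ?zr \<le> lcs x y"
    using lcs_append_ge[of "take m x" "take m y" "drop m x" "drop m y"] lcs_ge_zeros[of "drop m x" "drop m y"] by simp
  have big2: "?t + ?or \<le> lcs x y"
    using lcs_append_ge[of "take m x" "take m y" "drop m x" "drop m y"] lcs_ge_ones[of "drop m x" "drop m y"] by simp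
  define dl where "dl = (zeros x - m) + (m - zeros x)"
  have dl: "1000 * dl \<le> m" "zeros x \<le> m + dl" "m \<le> zeros x + dl" using U unfolding dl_def by auto
  have z: "m \<le> ?u + ?zr + E + dl"
  proof -
    have "m \<le> ?u + zeros (drop m x) + E + dl" using d(1) dl by linarith
    moreover have "?w \<le> zeros (drop m y)" using d(3) tot(2) l(2) mn by linarith
    then have "m \<le> ?u + zeros (drop m y) + E + dl" using t1(1) E(1) by linarith
    ultimately show ?thesis by (simp add: min_def)
  qed
  have or: "m \<le> ?w + ?or + E + dl"
  proof -
    have "m \<le> ?w + ones (drop m y) + E + dl" using d(4) by linarith
    moreover have "?u \<le> ones (drop m x) + dl" using d(2) tot(1) l(1) mn dl(2) by linarith
    then have "m \<le> ?w + ones (drop m x) + E + dl" using t1(1) E(1) by linarith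
    ultimately show ?thesis by (simp add: min_def)
  qed
  \<comment> \<open>The matches within the prefixes are also limited by the zeros of
    \<open>y\<close> and the ones of \<open>x\<close>, which number
    \<open>2 * m - ?u - ?w\<close>.\<close>
  have "?u + ?w \<le> m + E" using t1(2) E(1) l by linarith
  then have "2 * m \<le> m + E + ?zr + ?or + 2 * E + 2 * dl" using z or by linarith
  then have "3 * m \<le> 2 * lcs x y + 5 * E + 2 * dl" using big1 big2 E(1) by linarith
  then show ?thesis using E(2) dl(1) by linarith
qed

lemma suffix_gain:
  assumes len: "length x = n" "length y = n" and o: "ones y = m" and mn: "2 * m \<le> n"
    and U: "1000 * (zeros x - m) \<le> m" "1000 * (m - zeros x) \<le> m"
    and E: "m \<le> lcs (drop (n - m) x) (drop (n - m) y) + E" "20 * E \<le> m"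
  shows "13 * m \<le> 10 * lcs x y"
proof -
  have "take m (rev x) = rev (drop (n - m) x)" "take m (rev y) = rev (drop (n - m) y)"
    using len mn by (simp_all add: rev_drop)
  then have "13 * m \<le> 10 * lcs (rev x) (rev y)"
    using assms by (intro prefix_gain[of _ n _ _ E]) (simp_all add: lcs_rev)
  then show ?thesis by (simp add: lcs_rev)
qed

text \<open>Minimality makes the power of \<open>kval D m - 1\<close> too small. Since
  \<open>kval D m\<close> is at most twice that base, padding to length \<open>kval D m ^ D\<close>
  enlarges a block by a constant factor only.\<close>

lemma kval_props:
  assumes D: "1 \<le> D"
  shows "1 \<le> kval D m" "m \<le> kval D m ^ D" "1 \<le> m \<Longrightarrow> kval D m ^ D \<le> 2 ^ D * m" "1 < kval D m \<Longrightarrow> (kval D m - 1) ^ D < m"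
proof -
  let ?P = "\<lambda>k. 1 \<le> k \<and> m \<le> k ^ D"
  have "Suc m \<le> Suc m ^ D" using D by (intro self_le_power) auto
  then have "?P (Suc m)" by simp
  from LeastI[of ?P, OF this] show k: "1 \<le> kval D m" "m \<le> kval D m ^ D" unfolding kval_def by auto
  show lt: "(kval D m - 1) ^ D < m" if "1 < kval D m"
  proof (rule ccontr)
    assume "\<not> ?thesis"
    then have "?P (kval D m - 1)" using that by simp
    from Least_le[of ?P, OF this] have "kval D m \<le> kval D m - 1" unfolding kval_def .
    then show False using that by simp
  qed
  show "kval D m ^ D \<le> 2 ^ D * m" if m: "1 \<le> m"
  proof (cases "1 < kval D m")
    case True
    have "kval D m ^ D \<le> (2 * (kval D m - 1)) ^ D" using True by (intro power_mono) auto
    also have "\<dots> = 2 ^ D * (kval D m - 1) ^ D" by (simp add: power_mult_distrib)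
    also have "\<dots> \<le> 2 ^ D * m" using lt[OF True] by simp
    finally show ?thesis .
  next
    case False
    then have "kval D m = 1" using k(1) by simp
    then show ?thesis using mult_le_mono[OF one_le_power[of "2::nat" D] m] by simp
  qed
qed

text \<open>
  With \<open>8160 = 40 * 2 * 34 * 3\<close> and \<open>34 * (3 * m div Q)\<close> as indel bound, each of the two terms in
  \<open>root_complete\<close> contributes at most \<open>m / 40\<close>.
\<close>

locale tuned_run = run \<omega> y Al B0 n m k D C N x F Q for \<omega> y Al B0 n m k D C N x F Q +
  assumes m_def: "m = minority y" and F_def: "F = flipped y" and k_def: "k = kval D m"
    and C_def: "C = 40 * 2 ^ (D + 2) * D * 2 ^ D" and Q_def: "Q = 8160 * 2 ^ (D + 2)"
begin

lemma ones_yf: "ones yf = m" and m2: "2 * m \<le> n"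
proof -
  have "ones (map (\<lambda>b. b \<noteq> F) y) = (if F then zeros y else ones y)"
    by (induction y) auto
  then show "ones yf = m" unfolding yf_def m_def minority_def F_def[symmetric] .
  show "2 * m \<le> n" using zeros_ones[of y] n by (auto simp: m_def minority_def flipped_def)
qed

lemma lcs_flip: "lcs (map (\<lambda>b. b \<noteq> F) a) (map (\<lambda>b. b \<noteq> F) b) = lcs a b"
  by (rule lcs_map_inj) (auto simp: inj_def)

lemma mN: "m \<le> N"
  using kval_props(2)[OF D] by (simp add: N k_def)

lemma seg_padded:
  assumes "\<And>p. f p = (if p < m then of_bool (z ! (c + p)) else 2)" "c + m \<le> length z"
  shows "seg f 0 N = map of_bool (take m (drop c z)) @ replicate (N - m) 2"
proof (rule nth_equalityI)
  show "length (seg f 0 N) = length (map of_bool (take m (drop c z)) @ replicate (N - m) (2::nat))"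
    using assms(2) mN by simp
  show "seg f 0 N ! i = (map of_bool (take m (drop c z)) @ replicate (N - m) 2) ! i" if "i < length (seg f 0 N)" for i
    using that assms mN by (auto simp: seg_def nth_append min_def)
qed

text \<open>Equal padding on both sides adds its full length to the LCS, so the number of unmatched
  symbols is that of the original blocks.\<close>

lemma lcs_padded:
  assumes "c + m \<le> n"
  shows "lcs (seg (Xf c) 0 N) (seg (Yf c) 0 N) = lcs (take m (drop c x)) (take m (drop c y)) + (N - m)"
proof -
  have 1: "seg (Xf c) 0 N = map of_bool (take m (drop c x)) @ replicate (N - m) 2"
    using assms lx by (intro seg_padded) (auto simp: Xf_def)
  have 2: "seg (Yf c) 0 N = map of_bool (take m (drop c y)) @ replicate (N - m) 2"
    using assms n by (intro seg_padded) (auto simp: Yf_def)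
  have "inj (of_bool :: bool \<Rightarrow> nat)" by (auto simp: inj_def)
  from lcs_map_inj[OF this] show ?thesis unfolding 1 2 lcs_append_same by simp
qed

lemma edit_error_sound:
  assumes "edit_error c c E" "c + m \<le> n"
  shows "m \<le> lcs (take m (drop c x)) (take m (drop c y)) + E"
proof -
  obtain q e where "node (Xf c) (Yf c) k C N D 0 q e" "E = e + (N - acf (Yf c) k C D q 0 N)"
    using assms(1) unfolding edit_error_def by blast
  then have "N \<le> lcs (seg (Xf c) 0 N) (seg (Yf c) 0 N) + E"
    using root_sound[of k C "Xf c" "Yf c" N D q e] k C N by simp
  then show ?thesis unfolding lcs_padded[OF assms(2)] using mN by linarith
qed

lemma edit_error_complete:
  assumes E: "edit_error c c E" and c: "c + m \<le> n" and m1: "1 \<le> m"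
    and e: "m \<le> lcs (take m (drop c x)) (take m (drop c y)) + 34 * (3 * m div Q)"
  shows "20 * E \<le> m"
proof -
  let ?W = "2 ^ (D + 2) :: nat" and ?lam = "lcs (take m (drop c x)) (take m (drop c y))"
  obtain q e where "node (Xf c) (Yf c) k C N D 0 q e" "E = e + (N - acf (Yf c) k C D q 0 N)"
    using E unfolding edit_error_def by blast
  then have CE: "C * E \<le> ?W * (2 * C * (N - lcs (seg (Xf c) 0 N) (seg (Yf c) 0 N)) + D * N)"
    using root_complete[of k C "Xf c" "Yf c" N D q e] k C N by simp
  have "?lam \<le> m" using lcs_le_left[of "take m (drop c x)"] by (simp add: le_trans)
  then have "N - lcs (seg (Xf c) 0 N) (seg (Yf c) 0 N) = m - ?lam"
    unfolding lcs_padded[OF c] using mN by linarith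
  then have nd: "N - lcs (seg (Xf c) 0 N) (seg (Yf c) 0 N) \<le> 34 * (3 * m div Q)" using e by linarith
  have N2: "N \<le> 2 ^ D * m" using kval_props(3)[OF D m1] by (simp add: N k_def)
  have "C * E \<le> ?W * (2 * C * (34 * (3 * m div Q)) + D * (2 ^ D * m))"
    using CE nd N2 by (meson add_mono le_trans mult_le_mono2)
  also have "\<dots> = C * (?W * (68 * (3 * m div Q))) + ?W * D * 2 ^ D * m" by (simp add: algebra_simps)
  finally have 1: "40 * (C * E) \<le> C * (?W * (2720 * (3 * m div Q))) + C * m"
    by (simp add: C_def algebra_simps)
  have "Q * (3 * m div Q) \<le> 3 * m" by simp
  \<comment> \<open>2720 is 40 * 68 and also a third of 8160, which cancels the 3 in
    \<open>3 * m div Q\<close>.\<close>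
  then have "?W * (2720 * (3 * m div Q)) \<le> m" unfolding Q_def by simp
  then have "C * (?W * (2720 * (3 * m div Q))) \<le> C * m" by (rule mult_left_mono) simp
  with 1 have "40 * (C * E) \<le> 2 * (C * m)" by linarith
  moreover have "C * (40 * E) = 40 * (C * E)" "C * (2 * m) = 2 * (C * m)" by simp_all
  ultimately have "C * (40 * E) \<le> C * (2 * m)" by linarith
  then have "40 * E \<le> 2 * m" using C by simp
  then show ?thesis by simp
qed

text \<open>If \<open>a + b\<close> is output, only the ratio is at stake, and the event found makes
  the LCS large. Otherwise only the upper bound on the LCS is at stake; it follows from the
  imbalance of the counts or, in the balanced case, from the absence of all events.\<close>

lemma outv_correct:
  assumes EL: "edit_error 0 0 EL" and ER: "edit_error (n - m) (n - m) ER"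
  shows "lcs x y \<le> outv 20 (2 * Q) EL ER" "2 * Q * outv 20 (2 * Q) EL ER \<le> (2 * (2 * Q) - 1) * lcs x y"
proof -
  let ?U = "zeros xf" and ?Lam = "lcs xf yf"
  define a b M where "a = min ?U (n - m)" and "b = min (n - ?U) m" and "M = max a b"
  define G where "G \<longleftrightarrow> (\<exists>i\<le>n. 1 \<le> i \<and> (\<exists>j\<le>n. gain i j))"
  define bal where "bal \<longleftrightarrow> Q * ((?U - m) + (m - ?U)) \<le> m"
  have Q1: "1000 \<le> Q" unfolding Q_def using one_le_power[of "2::nat" "D + 2"] by linarith
  have lam: "?Lam = lcs x y" unfolding xf_def yf_def by (rule lcs_flip)
  have mle: "m \<le> n" by (rule mn)
  have ux: "?U + ones xf = n" "zeros yf + m = n" using zeros_ones[of xf] zeros_ones[of yf] ones_yf by auto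
  have onx: "ones xf = n - ?U" "zeros yf = n - m" using ux by auto
  have up: "?Lam \<le> a + b" using lcs_le_zeros_ones[of xf yf] ones_yf onx unfolding a_def b_def by simp
  have lo: "a \<le> ?Lam" "b \<le> ?Lam" using lcs_ge_zeros[of xf yf] lcs_ge_ones[of xf yf] ones_yf onx unfolding a_def b_def by simp_all
  have M: "M \<le> ?Lam" using lo by (simp add: M_def)
  have ov: "outv 20 (2 * Q) EL ER = (if bal \<and> (G \<or> 20 * EL \<le> m \<or> 20 * ER \<le> m) then a + b else (2 * (2 * Q) - 1) * M div (2 * Q))"
    unfolding outv_def Let_def a_def b_def M_def G_def bal_def by simp
  have cnm: "n - m + m \<le> n" "0 + m \<le> n" using mle by auto
  have tkL: "lcs (take m xf) (take m yf) = lcs (take m (drop 0 x)) (take m (drop 0 y))"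
    unfolding xf_def yf_def take_map drop_0 by (rule lcs_flip)
  have tkR: "lcs (drop (n - m) xf) (drop (n - m) yf) = lcs (take m (drop (n - m) x)) (take m (drop (n - m) y))"
  proof -
    have "take m (drop (n - m) x) = drop (n - m) x" "take m (drop (n - m) y) = drop (n - m) y" using lx n mle by simp_all
    then show ?thesis unfolding xf_def yf_def drop_map by (simp only: lcs_flip)
  qed
  have cut01_min: "cut01 xf yf i j = cut01 xf yf (min i n) (min j n)" for i j
    unfolding cut01_def by (simp add: min_def)
  have cut10_min: "cut10 xf yf i j = cut10 xf yf (min i n) (min j n)" for i j
    unfolding cut10_def by (simp add: min_def)
  have drops: "zeros (drop i xf) = ?U - zeros (take i xf)" "ones (drop i xf) = n - ?U - ones (take i xf)"
     "zeros (drop j yf) = n - m - zeros (take j yf)" "ones (drop j yf) = m - ones (take j yf)" for i j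
    using zeros_take_drop[of i xf] ones_take_drop[of i xf] zeros_take_drop[of j yf] ones_take_drop[of j yf] ones_yf onx by auto
  define dl where "dl = (?U - m) + (m - ?U)"
  \<comment> \<open>Exchanging a total for one at most \<open>dl\<close> smaller changes such a
    minimum by at most \<open>dl\<close>; applied in both directions, this compares estimated and
    true cuts.\<close>
  have sh: "min (a - c) b \<le> min (a' - c) b + dl" if "a \<le> a' + dl" for a a' b c
    using that by linarith
  have near: "n - m \<le> (n - ?U) + dl" "n - ?U \<le> (n - m) + dl" "m \<le> ?U + dl" "?U \<le> m + dl"
    unfolding dl_def by linarith+
  have c1: "cand01 i j \<le> cut01 xf yf i j + dl" "cut01 xf yf i j \<le> cand01 i j + dl" for i j
    unfolding cand01_def cut01_def drops using sh[OF near(1)] sh[OF near(2)] by (simp_all add: add.assoc)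
  have c2: "cand10 i j \<le> cut10 xf yf i j + dl" "cut10 xf yf i j \<le> cand10 i j + dl" for i j
    unfolding cand10_def cut10_def drops using sh[OF near(3)] sh[OF near(4)] by (simp_all add: add.assoc)
  have "?Lam \<le> outv 20 (2 * Q) EL ER \<and> 2 * Q * outv 20 (2 * Q) EL ER \<le> (2 * (2 * Q) - 1) * ?Lam"
  proof (cases "bal \<and> (G \<or> 20 * EL \<le> m \<or> 20 * ER \<le> m)")
    case True
    then have o: "outv 20 (2 * Q) EL ER = a + b" using ov by simp
    have Qdl: "Q * dl \<le> m" using True by (simp add: bal_def dl_def)
    have dl1000: "1000 * dl \<le> m" using mult_right_mono[OF Q1, of dl] Qdl by linarith
    have U1: "1000 * (?U - m) \<le> m" "1000 * (m - ?U) \<le> m" using dl1000 unfolding dl_def add_mult_distrib2 by linarith+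
    have "a + b \<le> 2 * m + dl" unfolding a_def b_def dl_def by linarith
    then have "Q * (a + b) \<le> Q * (2 * m + dl)" by (rule mult_left_mono) simp
    then have ab: "Q * (a + b) \<le> (2 * Q + 1) * m" using Qdl by (simp add: algebra_simps)
    \<comment> \<open>The output is at most (2 + 1/Q) m. An LCS of (1 + 1/Q) m suffices, as (2Q +
      1)/(Q + 1) = 2 - 1/(Q + 1), which is at most 2 - 1/(2Q); nearly equal ends give even 13/10
      m.\<close>
    have key: "(2 * Q + 1) * m * 2 \<le> (4 * Q - 1) * ?Lam"
    proof (cases G)
      case True
      then obtain i j where "gain i j" unfolding G_def by blast
      then have "(Q + 2) * m < Q * (?Lam + dl)"
      proof -
        have "cand01 i j \<le> ?Lam + dl" "cand10 i j \<le> ?Lam + dl"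
          using c1(1)[of i j] c2(1)[of i j] cut01_le_lcs[of xf yf i j] cut10_le_lcs[of xf yf i j] by linarith+
        then have "Q * cand01 i j \<le> Q * (?Lam + dl)" "Q * cand10 i j \<le> Q * (?Lam + dl)" by simp_all
        then show ?thesis using \<open>gain i j\<close> unfolding gain_def by linarith
      qed
      then have g: "(Q + 1) * m \<le> Q * ?Lam" using Qdl by (simp add: algebra_simps)
      have "Q * ((2 * Q + 1) * m * 2) \<le> (4 * Q - 1) * ((Q + 1) * m)"
      proof -
        have "Q * ((2 * Q + 1) * 2) \<le> (4 * Q - 1) * (Q + 1)" using Q1 by (cases Q) (simp_all add: algebra_simps)
        then have "Q * ((2 * Q + 1) * 2) * m \<le> (4 * Q - 1) * (Q + 1) * m" by (rule mult_right_mono) simp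
        then show ?thesis by (simp only: ac_simps)
      qed
      also have "\<dots> \<le> (4 * Q - 1) * (Q * ?Lam)" using g by (rule mult_left_mono) simp
      also have "\<dots> = Q * ((4 * Q - 1) * ?Lam)" by simp
      finally show ?thesis using Q1 by simp
    next
      case False
      have g: "13 * m \<le> 10 * ?Lam"
      proof (cases "20 * EL \<le> m")
        case True
        have "m \<le> lcs (take m xf) (take m yf) + EL" unfolding tkL by (rule edit_error_sound[OF EL cnm(2)])
        then show ?thesis by (intro prefix_gain[OF len_xf len_yf ones_yf m2 U1 _ True])
      next
        case F2: False
        then have E: "20 * ER \<le> m" using True False by simp
        have "m \<le> lcs (drop (n - m) xf) (drop (n - m) yf) + ER" unfolding tkR by (rule edit_error_sound[OF ER cnm(1)])
        then show ?thesis by (intro suffix_gain[OF len_xf len_yf ones_yf m2 U1 _ E])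
      qed
      have "(2 * Q + 1) * 2 * 10 \<le> (4 * Q - 1) * 13" using Q1 by simp
      then have "(2 * Q + 1) * 2 * 10 * m \<le> (4 * Q - 1) * 13 * m" by (rule mult_right_mono) simp
      also have "\<dots> = (4 * Q - 1) * (13 * m)" by simp
      also have "\<dots> \<le> (4 * Q - 1) * (10 * ?Lam)" using g by (rule mult_left_mono) simp
      finally have "10 * ((2 * Q + 1) * m * 2) \<le> 10 * ((4 * Q - 1) * ?Lam)" by (simp only: ac_simps)
      then show ?thesis by (simp only: mult_le_cancel1)
    qed
    have "2 * (Q * (a + b)) \<le> 2 * ((2 * Q + 1) * m)" using ab by (rule mult_left_mono) simp
    also have "\<dots> \<le> (4 * Q - 1) * ?Lam" using key by (simp only: ac_simps)
    finally have "2 * Q * (a + b) \<le> (2 * (2 * Q) - 1) * ?Lam" by (simp add: mult.assoc)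
    then show ?thesis using up unfolding o by blast
  next
    case False
    then have o: "outv 20 (2 * Q) EL ER = (2 * (2 * Q) - 1) * M div (2 * Q)" using ov by auto
    have "2 * Q * outv 20 (2 * Q) EL ER \<le> (2 * (2 * Q) - 1) * M"
      unfolding o using times_div_less_eq_dividend by blast
    also have "\<dots> \<le> (2 * (2 * Q) - 1) * ?Lam" using M by (rule mult_left_mono) simp
    finally have res2: "2 * Q * outv 20 (2 * Q) EL ER \<le> (2 * (2 * Q) - 1) * ?Lam" .
    have "?Lam * (2 * Q) \<le> (4 * Q - 1) * M"
    proof -
      \<comment> \<open>If \<open>2 * M\<close> exceeds \<open>a + b\<close> by a gap
        \<open>w\<close> of at least M/(2Q), then \<open>a + b\<close> is at most (2 - 1/(2Q)) M. In
        the unbalanced case the gap is \<open>dl\<close>.\<close>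
      have suff: ?thesis if "a + b + w \<le> 2 * M" "M \<le> 2 * Q * w" for w
      proof -
        have "?Lam * (2 * Q) + M \<le> (a + b) * (2 * Q) + 2 * Q * w"
          using up that(2) by (intro add_mono mult_right_mono) auto
        also have "\<dots> = (a + b + w) * (2 * Q)" by (simp add: algebra_simps)
        also have "\<dots> \<le> 2 * M * (2 * Q)" using that(1) by (rule mult_right_mono) simp
        finally show ?thesis by (simp add: algebra_simps diff_mult_distrib)
      qed
      show ?thesis
      proof (cases "m = 0")
        case True
        then have "b = 0" by (simp add: b_def)
        then have "a + b + M \<le> 2 * M" by (simp add: M_def)
        moreover have "M \<le> 2 * Q * M" using Q1 by simp
        ultimately show ?thesis by (rule suff)
      next
        case m0: False
        show ?thesis
        proof (cases bal)
          case nb: False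
          have nbal: "m < Q * dl" using nb by (simp add: bal_def dl_def)
          have Qdl: "dl \<le> Q * dl" using Q1 by simp
          show ?thesis
          proof (cases "?U \<le> n - m")
            case True
            then have ab: "a = ?U" "b = m" using mle by (auto simp: a_def b_def)
            have "a + b + dl \<le> 2 * M" unfolding ab M_def dl_def by linarith
            moreover have "M \<le> m + dl" unfolding ab M_def dl_def by linarith
            then have "M \<le> 2 * Q * dl" using nbal Qdl by linarith
            ultimately show ?thesis by (rule suff)
          next
            case False
            then have ab: "a = n - m" "b = n - ?U" "?U - m \<le> dl" "dl \<le> ?U - m" "n - m < m + dl"
              using m2 ux(1) by (auto simp: a_def b_def dl_def)
            have M1: "M = n - m" using ab m2 False by (simp add: M_def)
            have "a + b + dl \<le> 2 * M" unfolding M1 ab(1,2) using ab(3,4) False m2 ux(1) by linarith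
            moreover have "M \<le> 2 * Q * dl" using ab(5) M1 nbal Qdl by linarith
            ultimately show ?thesis by (rule suff)
          qed
        next
          case True
          then have nF: "\<not> G" "\<not> 20 * EL \<le> m" "\<not> 20 * ER \<le> m" using False by auto
          have Qdl: "Q * dl \<le> m" using True by (simp add: bal_def dl_def)
          \<comment> \<open>In the balanced case without events, a larger LCS would make the pair
            \<open>near_extremal\<close> with slack \<open>3 * m div Q\<close>, and then one of the
            two ends would have been recognised as nearly equal.\<close>
          have Qle: "Q * ?Lam \<le> (2 * Q - 1) * m"
          proof (rule ccontr)
            assume neg: "\<not> ?thesis"
            define g where "g = 3 * m div Q"
            have gI: "t \<le> g" if "Q * t \<le> 3 * m" for t
              using that Q1 unfolding g_def by (subst less_eq_div_iff_mult_less_eq) (auto simp: mult.commute)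
            have dg: "dl \<le> g" using Qdl by (intro gI) linarith
            have "Q * (2 * m - ?Lam) \<le> 3 * m"
              using neg by (simp add: diff_mult_distrib diff_mult_distrib2 algebra_simps)
            then have big: "2 * m \<le> ?Lam + g" using gI by fastforce
            have cg: "t \<le> m + g" if "Q * t' \<le> (Q + 2) * m" "t \<le> t' + dl" for t t'
            proof -
              have "Q * t \<le> Q * (t' + dl)" using that(2) by (rule mult_left_mono) simp
              then have "Q * t \<le> (Q + 3) * m" using that(1) Qdl by (simp add: algebra_simps)
              then have "Q * (t - m) \<le> 3 * m" by (simp add: diff_mult_distrib2 algebra_simps)
              then show ?thesis using gI[of "t - m"] by linarith
            qed
            have ng: "Q * cand01 i j \<le> (Q + 2) * m \<and> Q * cand10 i j \<le> (Q + 2) * m" if "1 \<le> i" "i \<le> n" "j \<le> n" for i j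
              using nF(1) that unfolding G_def gain_def by (metis not_less)
            \<comment> \<open>Cuts before the first symbol of \<open>x\<close> are never tested,
              since a test follows a read; they match a single kind of symbol and are bounded
              directly.\<close>
            have cc: "cut01 xf yf i j \<le> m + g \<and> cut10 xf yf i j \<le> m + g" if "i \<le> n" "j \<le> n" for i j
            proof (cases "i = 0")
              case True
              have "cut01 xf yf 0 j \<le> m" "cut10 xf yf 0 j \<le> ?U"
                using drops(4)[of j] by (simp_all add: cut01_def cut10_def)
              moreover have "?U \<le> m + dl" by (simp add: dl_def)
              ultimately show ?thesis unfolding True using dg by (intro conjI) linarith+
            next
              case False
              then have "1 \<le> i" by (simp add: Suc_leI)
              note q = ng[OF this that]
              show ?thesis using cg[OF conjunct1[OF q] c1(2)] cg[OF conjunct2[OF q] c2(2)] by blast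
            qed
            have NE: "near_extremal xf yf n m g"
            proof
              show "m \<le> ?U + g" "?U \<le> m + g" using dg unfolding dl_def by linarith+
              show "m \<le> ones yf + g" "ones yf \<le> m + g" using ones_yf by simp_all
              show "2 * m \<le> ?Lam + g" by (rule big)
              show "cut01 xf yf i j \<le> m + g" for i j using cc[of "min i n" "min j n"] cut01_min[of i j] by simp
              show "cut10 xf yf i j \<le> m + g" for i j using cc[of "min i n" "min j n"] cut10_min[of i j] by simp
            qed simp_all
            have m1: "1 \<le> m" using m0 by simp
            \<comment> \<open>The slack vanishes when \<open>3 * m\<close> is less than
              \<open>Q\<close>; such small \<open>m\<close> need the separate argument without
              slack.\<close>
            show False
            proof (cases "g = 0")
              case True
              then show False using near_extremal_0_False[of xf yf n m] NE m1 by simp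
            next
              case False
              then have "m \<le> lcs (take m xf) (take m yf) + 34 * g \<or> m \<le> lcs (drop (n - m) xf) (drop (n - m) yf) + 34 * g"
                using near_extremal_ends_similar[OF NE mle] by simp
              then show False
                using edit_error_complete[OF EL cnm(2) m1] edit_error_complete[OF ER cnm(1) m1] nF(2,3)
                unfolding tkL tkR g_def by blast
            qed
          qed
          have "m \<le> M" using m2 mle by (auto simp: M_def a_def b_def)
          then have "(4 * Q - 2) * m \<le> (4 * Q - 1) * M" by (intro mult_le_mono) auto
          moreover have "?Lam * (2 * Q) \<le> (4 * Q - 2) * m"
            using Qle by (simp add: diff_mult_distrib algebra_simps)
          ultimately show ?thesis by linarith
        qed
      qed
    qed
    then have "?Lam \<le> outv 20 (2 * Q) EL ER"
      unfolding o using Q1 by (subst less_eq_div_iff_mult_less_eq) auto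
    then show ?thesis using res2 by blast
  qed
  then show "lcs x y \<le> outv 20 (2 * Q) EL ER" "2 * Q * outv 20 (2 * Q) EL ER \<le> (2 * (2 * Q) - 1) * lcs x y"
    unfolding lam by blast+
qed

end

definition factor :: "nat \<Rightarrow> nat" where "factor D = 8160 * 2 ^ (D + 2)"
definition gridc :: "nat \<Rightarrow> nat" where "gridc D = 40 * 2 ^ (D + 2) * D * 2 ^ D"
definition MAIN :: "nat \<Rightarrow> cmd" where
  "MAIN D = PRE D \<triangleright> BODY (factor D) 20 (2 * factor D) (gridc D) D"
text \<open>The layout parameter of the memory is read off from the source program, which does not
  mention it, so there is no circularity.\<close>

definition weight :: "nat \<Rightarrow> nat" where "weight D = wtc (MAIN D)"
definition prog_of :: "nat \<Rightarrow> prog" where "prog_of D = compiler.comp (weight D) (MAIN D)"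
text \<open>A single bound that meets the requirements on \<open>B0\<close> of both
  \<open>machine\<close> and \<open>params\<close>.\<close>

definition value_bound :: "nat \<Rightarrow> nat \<Rightarrow> nat \<Rightarrow> nat" where
  "value_bound D n k = 4 * (D + 2) * k ^ D + 2 * n + k * gridc D + 2 * weight D + 21"

lemma MAIN_runs:
  assumes D: "1 \<le> D" and lx: "length x = n" and ly: "length y = n"
  defines "k \<equiv> kval D (minority y)"
  shows "\<exists>out t m. computes (prog_of D) x y out t m \<and> lcs x y \<le> out \<and>
    2 * factor D * out \<le> (2 * (2 * factor D) - 1) * lcs x y \<and>
    t \<le> tb (value_bound D n k) (prog_of D) \<and>
    m \<le> machine.SP (weight D) (k * gridc D + 1) (value_bound D n k)"
proof -
  define B0 where "B0 = value_bound D n k"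
  define m where "m = minority y"
  define F where "F = flipped y"
  let ?om = "weight D" and ?C = "gridc D" and ?Q = "factor D"
  define Al where "Al = k * ?C + 1"
  have k1: "1 \<le> k" and mN: "m \<le> k ^ D" using kval_props(1,2)[OF D] by (simp_all add: k_def m_def)
  have "0 < D" using D by linarith
  then have "0 < ?C" by (simp add: gridc_def)
  then have C1: "1 \<le> ?C" by linarith
  have "0 < ?Q" by (simp add: factor_def)
  then have Q1: "1 \<le> 2 * ?Q" by linarith
  have mn: "m \<le> n" using length_filter_le[of id y] length_filter_le[of Not y] ly by (simp add: m_def minority_def)
  have m2: "2 * m \<le> n" using zeros_ones[of y] ly by (auto simp: m_def minority_def flipped_def)
  have Al0: "0 < Al" and nB: "n < B0" by (simp_all add: Al_def B0_def value_bound_def)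
  interpret tuned_run ?om y Al B0 n m k D ?C "k ^ D" x F ?Q
    by unfold_locales
      (use k1 C1 D lx ly mn in \<open>simp_all add: Al_def B0_def value_bound_def m_def F_def k_def gridc_def factor_def\<close>)
  define h0 :: store where "h0 = upd (\<lambda>_ _. 0) rn 0 n"
  have c0: "conc (\<lambda>_ _. 0) = (\<lambda>_. 0)" by (auto simp: conc_def)
  have rn0: "prod_encode rn = 0" by (simp add: prod_encode_def)
  have ch0: "conc h0 = (\<lambda>_. 0)(0 := n)"
    unfolding h0_def using conc_upd[of rn "\<lambda>_ _. 0" 0 n] rn0 c0 by simp
  have "ok (\<lambda>_ _. 0)" by (simp add: ok_def)
  then have okh0: "ok h0" unfolding h0_def using Al0 nB by (rule ok_upd)
  let ?post = "\<lambda>(xs', h'). \<exists>EL ER. edit_error 0 0 EL \<and> edit_error (n - m) (n - m) ER \<and>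
    h' rn 0 = outv 20 (2 * ?Q) EL ER"
  have "wp (MAIN D) ?post (x, h0)"
    unfolding MAIN_def
  proof (rule wp_Then, rule wp_mono[OF PRE_ok[OF D]])
    show "2 * length y + 10 \<le> B0" using ly by (simp add: B0_def value_bound_def)
    show "h0 rn 0 = length y" "h0 rm 0 = 0" "h0 rf 0 = 0" using ly by (simp_all add: h0_def)
    fix xs h
    assume "case (xs, h) of (xs', h') \<Rightarrow> xs' = x \<and> mods h0 h' {ri, rm, rf, rk} \<and> h' rm 0 = minority y \<and>
      h' rf 0 = of_bool (flipped y) \<and> h' rk 0 = kval D (minority y)"
    then have P: "xs = x" "mods h0 h {ri, rm, rf, rk}" "h rm 0 = m" "h rf 0 = of_bool F" "h rk 0 = k"
      by (simp_all add: m_def F_def k_def)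
    have rows: "h rn = h0 rn" "h roff = h0 roff" "h ru = h0 ru" "h rv = h0 rv" "h rG = h0 rG"
      using P(2) by (simp_all add: mods_def)
    have "stat 0 h" using P rows by (simp add: stat_def h0_def)
    moreover have "RD 0 xs h" using P rows by (simp add: RD_def h0_def)
    ultimately show "wp (BODY ?Q 20 (2 * ?Q) ?C D) ?post (xs, h)"
      using mN m2 Q1 by (intro BODY_ok) simp_all
  qed
  then obtain xs h where h: "rex (comp (MAIN D)) (x, conc h0) (xs, conc h)" "?post (xs, h)"
    unfolding wp_def using okh0 by (auto simp: weight_def)
  then obtain EL ER where E: "edit_error 0 0 EL" "edit_error (n - m) (n - m) ER" "h rn 0 = outv 20 (2 * ?Q) EL ER" by auto
  obtain t ms where ex: "exec y (comp (MAIN D)) (x, conc h0) t ms (xs, conc h)" "t \<le> tb B0 (comp (MAIN D))" "ms \<le> SP"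
    using h(1) unfolding rex_def by blast
  have "init x = (x, conc h0)" by (simp add: init_def ch0 lx)
  moreover have "conc h 0 = h rn 0" using conc_addr[of rn h 0] rn0 by simp
  ultimately have "computes (prog_of D) x y (h rn 0) t ms"
    unfolding computes_def prog_of_def using ex(1) by auto
  moreover note outv_correct[OF E(1,2)]
  ultimately show ?thesis
    using ex(2,3) unfolding E(3) prog_of_def B0_def Al_def by blast
qed

section \<open>Asymptotic bounds on time and space\<close>

lemma floorlog_le:
  assumes "1 \<le> v" shows "real (floorlog 2 v) \<le> 2 * ln (real v) + 1"
proof -
  have "real (floorlog 2 v) \<le> log 2 (real v) + 1" using assms by (simp add: floorlog_def)
  also have "log 2 (real v) = ln (real v) / ln 2" by (simp add: log_def)
  also have "\<dots> \<le> ln (real v) / (1 / 2)"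
    using assms ln_le_minus_one[of "1 / 2"] by (intro divide_left_mono) (auto simp: ln_div)
  finally show ?thesis by simp
qed

text \<open>Half of the gap between \<open>a\<close> and \<open>b\<close> absorbs the logarithm, the
  other half all constants, including the division by \<open>b\<close>.\<close>

lemma powr_ln_absorb:
  fixes a b K :: real
  assumes "0 < a" "a < b" "0 \<le> K"
  shows "\<exists>n0. \<forall>n\<ge>n0. K * (real n powr a * (ln (real n) + 1)) \<le> real n powr b / b"
proof -
  define e where "e = (b - a) / 2"
  have e: "0 < e" "a + e + e = b" using assms by (simp_all add: e_def)
  define n0 where "n0 = max 1 (nat \<lceil>(K * (1 / e + 1) * b) powr (1 / e)\<rceil>)"
  have "K * (real n powr a * (ln (real n) + 1)) \<le> real n powr b / b" if "n \<ge> n0" for n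
  proof -
    have n1: "1 \<le> real n" using that by (simp add: n0_def)
    have "(K * (1 / e + 1) * b) powr (1 / e) \<le> real n" using that unfolding n0_def by linarith
    then have "((K * (1 / e + 1) * b) powr (1 / e)) powr e \<le> real n powr e" using e by (intro powr_mono2) auto
    then have big: "K * (1 / e + 1) * b \<le> real n powr e"
      using e assms by (simp add: powr_powr)
    have "ln (real n) \<le> real n powr e / e" using n1 e by (intro ln_powr_bound)
    moreover have "1 \<le> real n powr e" using n1 e by (simp add: ge_one_powr_ge_zero)
    ultimately have "ln (real n) + 1 \<le> (1 / e + 1) * real n powr e" by (simp add: algebra_simps)
    then have "K * (real n powr a * (ln (real n) + 1)) \<le> K * (real n powr a * ((1 / e + 1) * real n powr e))"
      using assms by (intro mult_left_mono) auto
    also have "\<dots> = (K * (1 / e + 1) * b) * (real n powr a * real n powr e) / b" using assms by simp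
    also have "\<dots> \<le> real n powr e * (real n powr a * real n powr e) / b"
      using big assms by (intro divide_right_mono mult_right_mono) auto
    also have "\<dots> = real n powr b / b" using n1 by (simp add: powr_add[symmetric] e(2)[symmetric] add_ac)
    finally show ?thesis .
  qed
  then show ?thesis by blast
qed

lemma kval_le_powr:
  assumes D: "1 \<le> D" and m: "m \<le> n" and n: "1 \<le> n"
  shows "real (kval D m) \<le> 2 * real n powr (1 / real D)"
proof (cases "1 < kval D m")
  case True
  let ?j = "kval D m - 1"
  have "?j ^ D < m" by (rule kval_props(4)[OF D True])
  then have "real (?j ^ D) \<le> real n" using m by linarith
  then have "real (?j ^ D) powr (1 / real D) \<le> real n powr (1 / real D)" by (intro powr_mono2) auto
  moreover have "real (?j ^ D) powr (1 / real D) = real ?j"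
    using True D by (simp add: powr_realpow[symmetric] powr_powr)
  moreover have "real (kval D m) \<le> 2 * real ?j" using True by simp
  ultimately show ?thesis by linarith
next
  case False
  then have "real (kval D m) \<le> 1" by simp
  also have "1 \<le> real n powr (1 / real D)" using n by (simp add: ge_one_powr_ge_zero)
  finally show ?thesis by linarith
qed

text \<open>Linearity in \<open>n\<close> holds because the padded length
  \<open>kval D m ^ D\<close> is at most a constant times \<open>m\<close>.\<close>

lemma value_bound_le:
  assumes D: "1 \<le> D"
  shows "\<exists>A. \<forall>n m. m \<le> n \<longrightarrow> value_bound D n (kval D m) \<le> A * (n + 1)"
proof (intro exI allI impI)
  fix n m :: nat assume "m \<le> n"
  let ?k = "kval D m"
  have N: "?k ^ D \<le> 2 ^ D * (n + 1)"
  proof (cases "m = 0")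
    case True
    have "kval D 0 = 1" unfolding kval_def by (intro Least_equality) auto
    then show ?thesis using True mult_le_mono[OF one_le_power[of "2::nat" D], of 1 "n + 1"] by simp
  next
    case False
    then have "?k ^ D \<le> 2 ^ D * m" using kval_props(3)[OF D] by simp
    also have "\<dots> \<le> 2 ^ D * (n + 1)" using \<open>m \<le> n\<close> by simp
    finally show ?thesis .
  qed
  have "?k \<le> ?k ^ D" using kval_props(1)[OF D, of m] D by (intro self_le_power) auto
  then have k: "?k \<le> 2 ^ D * (n + 1)" using N by linarith
  have t1: "4 * (D + 2) * ?k ^ D \<le> 4 * (D + 2) * (2 ^ D * (n + 1))" using N by (rule mult_left_mono) simp
  have t2: "?k * gridc D \<le> (2 ^ D * (n + 1)) * gridc D" using k by (rule mult_right_mono) simp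
  have t3: "2 * weight D + 21 \<le> (2 * weight D + 21) * (n + 1)" by simp
  have "value_bound D n ?k = 4 * (D + 2) * ?k ^ D + 2 * n + ?k * gridc D + (2 * weight D + 21)"
    by (simp add: value_bound_def)
  also have "\<dots> \<le> 4 * (D + 2) * (2 ^ D * (n + 1)) + 2 * (n + 1) + (2 ^ D * (n + 1)) * gridc D
      + (2 * weight D + 21) * (n + 1)"
    by (intro add_mono t1 t2 t3) simp
  also have "\<dots> = (4 * (D + 2) * 2 ^ D + 2 + 2 ^ D * gridc D + (2 * weight D + 21)) * (n + 1)"
    by (simp add: algebra_simps)
  finally show "value_bound D n ?k \<le> (4 * (D + 2) * 2 ^ D + 2 + 2 ^ D * gridc D + (2 * weight D + 21)) * (n + 1)" .
qed

text \<open>The number of cells is a constant times \<open>kval D m\<close>, hence of order n^(1/D),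
  and addresses and contents are polynomial in n, hence of logarithmic length.\<close>

lemma SP_le:
  assumes D: "1 \<le> D"
  shows "\<exists>K\<ge>0. \<forall>n m. m \<le> n \<longrightarrow> 2 \<le> n \<longrightarrow>
    real (machine.SP (weight D) (kval D m * gridc D + 1) (value_bound D n (kval D m)))
      \<le> K * (real n powr (1 / real D) * (ln (real n) + 1))"
proof -
  obtain A where A: "\<And>n m. m \<le> n \<Longrightarrow> value_bound D n (kval D m) \<le> A * (n + 1)"
    using value_bound_le[OF D] by blast
  let ?om = "weight D" and ?C = "gridc D"
  define st where "st = real (2 * ?om + 9)"
  define K where "K = 2 * (st * (2 * real ?C + 1)) * (2 * (real ?om + 4) * (real A + 2) + 1)"
  have st0: "0 \<le> st" by (simp add: st_def)
  show ?thesis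
  proof (intro exI[of _ K] conjI allI impI)
    show "0 \<le> K" unfolding K_def using st0 by (intro mult_nonneg_nonneg) auto
    fix n m :: nat assume mn: "m \<le> n" and n2: "2 \<le> n"
    let ?k = "kval D m"
    define B0 where "B0 = value_bound D n ?k"
    define Al where "Al = ?k * ?C + 1"
    interpret machine ?om "[]" Al B0
      by unfold_locales (simp_all add: Al_def B0_def value_bound_def)
    have AlB: "Al \<le> B0" by (simp add: Al_def B0_def value_bound_def)
    have B2: "2 \<le> B0" using B0 by simp
    \<comment> \<open>Thus addresses are no longer than the bound on contents, and one logarithm
      serves both.\<close>
    have AB: "AA \<le> BB"
    proof -
      have "AA \<le> B0 * B0" unfolding AA_def using stride_le_B0 AlB by (rule mult_le_mono)
      also have "\<dots> = B0 ^ 2" by (simp add: power2_eq_square)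
      also have "\<dots> \<le> B0 ^ (?om + 3)" using B2 by (intro power_increasing) auto
      finally show ?thesis by (simp add: BB_def)
    qed
    let ?p = "real n powr (1 / real D)" and ?l = "ln (real n) + 1"
    have p1: "1 \<le> ?p" using n2 by (simp add: ge_one_powr_ge_zero)
    have l1: "1 \<le> ?l" using n2 by simp
    have "SP \<le> AA * (2 * floorlog 2 BB)"
      unfolding SP_def using floorlog_mono[OF AB, of 2] by (intro mult_left_mono) auto
    then have "real SP \<le> real (AA * (2 * floorlog 2 BB))" by (simp only: of_nat_le_iff)
    then have 1: "real SP \<le> 2 * real AA * real (floorlog 2 BB)" by simp
    have kp: "real ?k \<le> 2 * ?p" using kval_le_powr[OF D mn] n2 by simp
    have "real AA = real stride * real Al" unfolding AA_def by (rule of_nat_mult)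
    also have "\<dots> = st * (real ?k * real ?C + 1)" by (simp add: Al_def stride_def st_def)
    also have "\<dots> \<le> st * (2 * ?p * real ?C + ?p)" using kp p1 st0 by (intro mult_left_mono add_mono mult_right_mono) auto
    also have "\<dots> = st * (2 * real ?C + 1) * ?p" by (simp add: algebra_simps)
    finally have 2: "real AA \<le> st * (2 * real ?C + 1) * ?p" .
    have "BB \<le> B0 ^ (?om + 3) + B0 ^ (?om + 3)" using B2 by (simp add: BB_def)
    also have "\<dots> = 2 * B0 ^ (?om + 3)" by simp
    also have "\<dots> \<le> B0 * B0 ^ (?om + 3)" using B2 by (rule mult_right_mono) simp
    also have "\<dots> = B0 ^ (?om + 4)" by (simp add: add.commute flip: power_Suc)
    finally have BB: "BB \<le> B0 ^ (?om + 4)" .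
    have BB1: "1 \<le> BB" by (simp add: BB_def)
    have "ln (real BB) \<le> ln (real (B0 ^ (?om + 4)))" using BB BB1 by (subst ln_le_cancel_iff) (auto simp only: of_nat_le_iff of_nat_0_less_iff)
    also have "\<dots> = (real ?om + 4) * ln (real B0)" using B2 by (simp add: ln_realpow)
    also have "ln (real B0) \<le> (real A + 2) * ?l"
    proof -
      have "B0 \<le> A * (n + 1)" unfolding B0_def by (rule A[OF mn])
      then have "real B0 \<le> real A * (real n + 1)" by (metis of_nat_1 of_nat_add of_nat_le_iff of_nat_mult)
      moreover have A1: "1 \<le> real A" using \<open>B0 \<le> A * (n + 1)\<close> B2 by (cases A) auto
      ultimately have "ln (real B0) \<le> ln (real A * (real n + 1))" using B2 by (subst ln_le_cancel_iff) auto
      also have "\<dots> = ln (real A) + ln (real n + 1)" using A1 by (simp add: ln_mult)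
      also have "ln (real A) \<le> real A" using A1 ln_bound[of "real A"] by simp
      also have "ln (real n + 1) \<le> ln (real n * real n)"
      proof (subst ln_le_cancel_iff)
        have "real n * 2 \<le> real n * real n" using n2 by (intro mult_left_mono) auto
        then show "real n + 1 \<le> real n * real n" using n2 by linarith
      qed (use n2 in auto)
      also have "\<dots> = 2 * ln (real n)" using n2 by (simp add: ln_mult)
      finally have "ln (real B0) \<le> real A + 2 * ln (real n)" by simp
      also have "\<dots> \<le> real A * ?l + 2 * ?l"
        using l1 mult_left_mono[OF l1, of "real A"] by (intro add_mono) auto
      finally show ?thesis by (simp add: algebra_simps)
    qed
    finally have lnBB: "ln (real BB) \<le> (real ?om + 4) * ((real A + 2) * ?l)" by simp
    have "real (floorlog 2 BB) \<le> 2 * ((real ?om + 4) * ((real A + 2) * ?l)) + ?l"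
      using floorlog_le[OF BB1] lnBB l1 by linarith
    also have "\<dots> = (2 * (real ?om + 4) * (real A + 2) + 1) * ?l" by (simp add: algebra_simps)
    finally have 3: "real (floorlog 2 BB) \<le> (2 * (real ?om + 4) * (real A + 2) + 1) * ?l" .
    have "real SP \<le> 2 * (st * (2 * real ?C + 1) * ?p) * ((2 * (real ?om + 4) * (real A + 2) + 1) * ?l)"
      using 1 2 3 st0 p1 by (smt (verit) mult_mono of_nat_0_le_iff mult_nonneg_nonneg)
    also have "\<dots> = K * (?p * ?l)" by (simp add: K_def)
    finally show "real (machine.SP ?om (?k * ?C + 1) (value_bound D n ?k)) \<le> K * (?p * ?l)"
      unfolding Al_def[symmetric] B0_def[symmetric] .
  qed
qed

text \<open>The depth \<open>D\<close> is chosen with 1/D strictly below \<delta>. The remaining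
  power of n swallows all factors depending on \<delta> and the logarithms once n is large, so the
  uniform constants can be 1 and 0.\<close>

theorem theorem1p8:
  shows "\<exists>(C::real) (k::nat). \<forall>\<delta>::real. 0 < \<delta> \<and> \<delta> < 1/2 \<longrightarrow>
    (\<exists>\<epsilon>::real. \<epsilon> > 0 \<and>
    (\<exists>(p::prog) (c::nat) (d::nat) (n\<^sub>0::nat).
      \<forall>(n::nat) (x::bool list) (y::bool list). length x = n \<and> length y = n \<longrightarrow>
        (\<exists>out t m. computes p x y out t m \<and>
          real (lcs x y) \<le> real out \<and> real out \<le> (2 - \<epsilon>) * real (lcs x y) \<and>
          t \<le> c * n ^ d + c \<and>
          (n \<ge> n\<^sub>0 \<longrightarrow> real m \<le> C * (real n powr \<delta> / \<delta>) * ln (real n) ^ k))))"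
proof (rule exI[of _ "1::real"], rule exI[of _ "0::nat"], intro allI impI)
  fix \<delta> :: real assume \<delta>: "0 < \<delta> \<and> \<delta> < 1/2"
  obtain D0 where D0: "1 / \<delta> < real D0" using reals_Archimedean2 by blast
  define D where "D = max 1 D0"
  have D: "1 \<le> D" "1 / \<delta> < real D" using D0 by (auto simp: D_def)
  then have D\<delta>: "0 < 1 / real D" "1 / real D < \<delta>" using \<delta> by (auto simp: field_simps)
  let ?Q = "factor D"
  have "0 < ?Q" by (simp add: factor_def)
  then have Q: "1 \<le> ?Q" by linarith
  obtain A where A: "\<And>n m. m \<le> n \<Longrightarrow> value_bound D n (kval D m) \<le> A * (n + 1)"
    using value_bound_le[OF D(1)] by blast
  obtain K where K: "0 \<le> K" "\<And>n m. m \<le> n \<Longrightarrow> 2 \<le> n \<Longrightarrow>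
    real (machine.SP (weight D) (kval D m * gridc D + 1) (value_bound D n (kval D m)))
      \<le> K * (real n powr (1 / real D) * (ln (real n) + 1))"
    using SP_le[OF D(1)] by blast
  obtain n1 where n1: "\<And>n. n \<ge> n1 \<Longrightarrow> K * (real n powr (1 / real D) * (ln (real n) + 1)) \<le> real n powr \<delta> / \<delta>"
    using powr_ln_absorb[OF D\<delta> K(1)] by blast
  let ?p = "prog_of D"
  let ?e = "2 * prog_size ?p"
  let ?c = "(2 * (A + 2)) ^ ?e"
  show "\<exists>\<epsilon>>0. \<exists>(p::prog) (c::nat) (d::nat) (n\<^sub>0::nat).
      \<forall>(n::nat) (x::bool list) (y::bool list). length x = n \<and> length y = n \<longrightarrow>
        (\<exists>out t m. computes p x y out t m \<and>
          real (lcs x y) \<le> real out \<and> real out \<le> (2 - \<epsilon>) * real (lcs x y) \<and>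
          t \<le> c * n ^ d + c \<and>
          (n \<ge> n\<^sub>0 \<longrightarrow> real m \<le> 1 * (real n powr \<delta> / \<delta>) * ln (real n) ^ 0))"
  proof (rule exI[of _ "1 / (2 * real ?Q)"], rule conjI, (use Q in simp; fail), rule exI[of _ ?p], rule exI[of _ ?c],
      rule exI[of _ ?e], rule exI[of _ "max 2 n1"], intro allI impI)
    fix n :: nat and x y :: "bool list" assume l: "length x = n \<and> length y = n"
    let ?k = "kval D (minority y)"
    have mn: "minority y \<le> n" using length_filter_le[of id y] length_filter_le[of Not y] l by (simp add: minority_def)
    obtain out t m where r: "computes ?p x y out t m" "lcs x y \<le> out"
      "2 * ?Q * out \<le> (2 * (2 * ?Q) - 1) * lcs x y" "t \<le> tb (value_bound D n ?k) ?p"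
      "m \<le> machine.SP (weight D) (?k * gridc D + 1) (value_bound D n ?k)"
      using MAIN_runs[OF D(1)] l by blast
    have "real (2 * ?Q * out) \<le> real ((2 * (2 * ?Q) - 1) * lcs x y)" using r(3) by (simp only: of_nat_le_iff)
    then have "2 * real ?Q * real out \<le> (4 * real ?Q - 1) * real (lcs x y)" using Q by (simp add: of_nat_diff)
    then have app: "real out \<le> (2 - 1 / (2 * real ?Q)) * real (lcs x y)" using Q by (simp add: field_simps)
    have "t \<le> (value_bound D n ?k + 2) ^ ?e" using r(4) tb_le[of "value_bound D n ?k" ?p] by linarith
    also have "\<dots> \<le> ((A + 2) * (n + 1)) ^ ?e"
      using A[OF mn] by (intro power_mono) (auto simp: algebra_simps)
    also have "\<dots> \<le> ?c * n ^ ?e + ?c"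
    proof (cases "n = 0")
      case True
      then show ?thesis using power_mono[of "A + 2" "2 * (A + 2)" ?e] by simp
    next
      case False
      have "(A + 2) * (n + 1) \<le> (A + 2) * (2 * n)" using False by (intro mult_left_mono) auto
      also have "\<dots> = 2 * (A + 2) * n" by simp
      finally have "((A + 2) * (n + 1)) ^ ?e \<le> (2 * (A + 2) * n) ^ ?e" by (intro power_mono) auto
      then show ?thesis by (simp only: power_mult_distrib)
    qed
    finally have time: "t \<le> ?c * n ^ ?e + ?c" .
    have space: "real m \<le> 1 * (real n powr \<delta> / \<delta>) * ln (real n) ^ 0" if "max 2 n1 \<le> n"
    proof -
      have "real m \<le> K * (real n powr (1 / real D) * (ln (real n) + 1))"
        using r(5) K(2)[OF mn] that by (meson max.bounded_iff of_nat_le_iff order_trans)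
      also have "\<dots> \<le> real n powr \<delta> / \<delta>" using that by (intro n1) simp
      finally show ?thesis by simp
    qed
    show "\<exists>out t m. computes ?p x y out t m \<and> real (lcs x y) \<le> real out \<and>
      real out \<le> (2 - 1 / (2 * real ?Q)) * real (lcs x y) \<and> t \<le> ?c * n ^ ?e + ?c \<and>
      (max 2 n1 \<le> n \<longrightarrow> real m \<le> 1 * (real n powr \<delta> / \<delta>) * ln (real n) ^ 0)"
      using r(1,2) app time space by (intro exI[of _ out] exI[of _ t] exI[of _ m]) auto
  qed
qed

end
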